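(* Let $h$ be a completely multiplicative function such that $|h(n)|\le1$ for all integers $n\ge1$. Let $Q$ be large and $Z=Q^{21/40}$. There exist positive constants $b_1,b_2,b_3$ such that for all real numbers $b_1\le y\le \log Q/(b_2\log_2 Q)$, the number of characters $\chi\in\mathcal{F}_3(Q)$ such that \[\max_{t\in[0,1]}\max_{\alpha\in[0,1)}\Bigg|\sum_{\substack{1\le n\le Z\\ P^+(n)>y}}\frac{\chi(n)h(n)e(n\alpha)}{n^{1+it}}\Bigg|>1\] is $\ll Q\exp\left(-b_3\frac{y}{\log y}\right)$.
   Context: $\mathcal{F}_3(Q)$ is the set of primitive cubic Dirichlet characters $\chi \pmod q$ with $(q,3)=1$ and $q\le Q$. $e(x)=e^{2\pi i x}$. $P^+(n)$ is the largest prime divisor of $n$ ($P^+(1)=1$). $\log_2=\log\log$. *)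

theory Defs
  imports "HOL-Analysis.Analysis" "HOL-Number_Theory.Number_Theory"
begin

text \<open>Dirichlet characters modulo \<open>q\<close>, as completely multiplicative \<open>q\<close>-periodic functions
  on the natural numbers supported exactly on the integers coprime to \<open>q\<close>.\<close>

definition dirichlet_character :: "nat \<Rightarrow> (nat \<Rightarrow> complex) \<Rightarrow> bool" where
  "dirichlet_character q chi \<longleftrightarrow>
     q > 0 \<and> (\<forall>m n. chi (m * n) = chi m * chi n) \<and> (\<forall>n. chi (n + q) = chi n) \<and>
     (\<forall>n. chi n \<noteq> 0 \<longleftrightarrow> coprime n q)"

definition induced_modulus :: "nat \<Rightarrow> (nat \<Rightarrow> complex) \<Rightarrow> nat \<Rightarrow> bool" where
  "induced_modulus q chi d \<longleftrightarrow> d dvd q \<and> (\<forall>a. coprime a q \<and> [a = 1] (mod d) \<longrightarrow> chi a = 1)"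

definition primitive_character :: "nat \<Rightarrow> (nat \<Rightarrow> complex) \<Rightarrow> bool" where
  "primitive_character q chi \<longleftrightarrow>
     dirichlet_character q chi \<and> (\<forall>d. induced_modulus q chi d \<longrightarrow> d = q)"

text \<open>Cubic means of order exactly 3 in the group of characters modulo \<open>q\<close>; in particular the
  principal character (including the one modulo 1) is not cubic.\<close>

definition cubic_character :: "nat \<Rightarrow> (nat \<Rightarrow> complex) \<Rightarrow> bool" where
  "cubic_character q chi \<longleftrightarrow>
     dirichlet_character q chi \<and> (\<forall>n. coprime n q \<longrightarrow> chi n ^ 3 = 1) \<and>
     (\<exists>n. coprime n q \<and> chi n \<noteq> 1)"

text \<open>A primitive character determines its modulus, so characters may be collected as functions
  without recording \<open>q\<close>.\<close>

definition F3 :: "real \<Rightarrow> (nat \<Rightarrow> complex) set" where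
  "F3 Q = {chi. \<exists>q. real q \<le> Q \<and> coprime q 3 \<and> primitive_character q chi \<and> cubic_character q chi}"

definition completely_multiplicative :: "(nat \<Rightarrow> complex) \<Rightarrow> bool" where
  "completely_multiplicative h \<longleftrightarrow>
     h 1 = 1 \<and> (\<forall>m\<ge>1. \<forall>n\<ge>1. h (m * n) = h m * h n)"

definition e :: "real \<Rightarrow> complex" where
  "e x = exp (2 * complex_of_real pi * \<i> * complex_of_real x)"

text \<open>Inserting 1 realises the convention \<open>P\<^sup>+(1) = 1\<close> and changes nothing for \<open>n \<ge> 2\<close>.\<close>

definition largest_prime_factor :: "nat \<Rightarrow> nat" where
  "largest_prime_factor n = Max (insert 1 (prime_factors n))"

definition rough_sum ::
  "(nat \<Rightarrow> complex) \<Rightarrow> (nat \<Rightarrow> complex) \<Rightarrow> real \<Rightarrow> real \<Rightarrow> real \<Rightarrow> real \<Rightarrow> complex" where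
  "rough_sum chi h Z y t \<alpha> =
     (\<Sum>n | 1 \<le> n \<and> real n \<le> Z \<and> real (largest_prime_factor n) > y.
        chi n * h n * e (real n * \<alpha>) / of_nat n powr (1 + \<i> * complex_of_real t))"

text \<open>The suprema are maxima: the sum is finite, continuous in \<open>(t, \<alpha>)\<close> and 1-periodic in \<open>\<alpha>\<close>.\<close>

definition max_rough_sum ::
  "(nat \<Rightarrow> complex) \<Rightarrow> (nat \<Rightarrow> complex) \<Rightarrow> real \<Rightarrow> real \<Rightarrow> real" where
  "max_rough_sum chi h Z y = (SUP t\<in>{0..1}. SUP \<alpha>\<in>{0..<1}. norm (rough_sum chi h Z y t \<alpha>))"

text \<open>Two facts guarding against junk values of \<open>card\<close> (infinite sets) and of the real supremum
  (unbounded sets).\<close>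

lemma finite_F3: "finite (F3 Q)"
proof -
  define V where "V = insert 0 {z :: complex. z ^ 3 = 1}"
  define S where "S = (\<Union>q\<in>{..nat \<lfloor>Q\<rfloor>}. (\<lambda>f n. f (n mod q)) ` ({..<q} \<rightarrow>\<^sub>E V))"
  have "finite {z :: complex. z ^ 3 = 1}"
    using finite_roots_unity[of 3] by simp
  then have "finite S"
    unfolding S_def V_def by (intro finite_UN_I finite_imageI finite_PiE) auto
  moreover have "F3 Q \<subseteq> S"
  proof
    fix chi assume "chi \<in> F3 Q"
    then obtain q where q: "real q \<le> Q" "dirichlet_character q chi" "cubic_character q chi"
      by (auto simp: F3_def primitive_character_def)
    have q0: "q > 0" and per: "\<And>n. chi (n + q) = chi n"
      and supp: "\<And>n. chi n \<noteq> 0 \<longleftrightarrow> coprime n q"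
      using q(2) by (auto simp: dirichlet_character_def)
    have V: "chi n \<in> V" for n
      using supp[of n] q(3) by (auto simp: V_def cubic_character_def)
    have "chi (r + k * q) = chi r" for r k
    proof (induction k)
      case (Suc k)
      then show ?case using per[of "r + k * q"] by (simp add: add_ac)
    qed simp
    from this[of "n mod q" "n div q" for n] have "chi n = chi (n mod q)" for n
      by simp
    then have "chi = (\<lambda>n. restrict chi {..<q} (n mod q))"
      using q0 by auto
    moreover have "restrict chi {..<q} \<in> {..<q} \<rightarrow>\<^sub>E V"
      using V by auto
    moreover have "q \<in> {..nat \<lfloor>Q\<rfloor>}"
      using q(1) by (simp add: le_nat_floor)
    ultimately show "chi \<in> S"
      unfolding S_def by blast
  qed
  ultimately show ?thesis
    by (rule rev_finite_subset)
qed

lemma max_rough_sum_greater_iff: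
  "max_rough_sum chi h Z y > c \<longleftrightarrow>
     (\<exists>t\<in>{0..1}. \<exists>\<alpha>\<in>{0..<1}. norm (rough_sum chi h Z y t \<alpha>) > c)"
proof -
  define A where "A = {n. 1 \<le> n \<and> real n \<le> Z \<and> real (largest_prime_factor n) > y}"
  define B where "B = (\<Sum>n\<in>A. norm (chi n * h n))"
  have B: "norm (rough_sum chi h Z y t \<alpha>) \<le> B" for t \<alpha>
    unfolding rough_sum_def B_def A_def[symmetric]
  proof (rule sum_norm_le)
    fix n assume "n \<in> A"
    then have n: "n \<ge> 1" by (simp add: A_def)
    have "norm (e x) = 1" for x
      by (simp add: e_def)
    moreover have "norm ((of_nat n :: complex) powr (1 + \<i> * complex_of_real t)) = real n"
      using n norm_powr_real_powr[of "of_nat n" "1 + \<i> * complex_of_real t"] by simp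
    ultimately have "norm (chi n * h n * e (real n * \<alpha>) / of_nat n powr (1 + \<i> * complex_of_real t))
        = norm (chi n * h n) / real n"
      by (simp add: norm_divide norm_mult)
    also have "\<dots> \<le> norm (chi n * h n) / 1"
      using n by (intro divide_left_mono) auto
    finally show "norm (chi n * h n * e (real n * \<alpha>) / of_nat n powr (1 + \<i> * complex_of_real t))
        \<le> norm (chi n * h n)" by simp
  qed
  have bdd: "bdd_above ((\<lambda>\<alpha>. norm (rough_sum chi h Z y t \<alpha>)) ` {0..<1})" for t
    using B by (intro bdd_aboveI2)
  have "(SUP \<alpha>\<in>{0..<1}. norm (rough_sum chi h Z y t \<alpha>)) \<le> B" for t
    using B by (intro cSUP_least) auto
  then have "bdd_above ((\<lambda>t. SUP \<alpha>\<in>{0..<1}. norm (rough_sum chi h Z y t \<alpha>)) ` {0..1})"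
    by (intro bdd_aboveI2)
  then show ?thesis
    unfolding max_rough_sum_def by (simp add: less_cSUP_iff bdd)
qed

end

theory Submission imports Defs "HOL-Real_Asymp.Real_Asymp" begin

text \<open>
  A primitive cubic character \<open>\<chi>\<close> modulo \<open>q\<close> with \<open>(q, 3) = 1\<close> has a Gauss sum \<open>g\<close> with
  \<open>g\<^sup>3 = q J\<close>, where the Jacobi sum \<open>J\<close> is an Eisenstein integer of norm \<open>q\<close>. Applying Frobenius twice to
  the generating polynomial of \<open>\<chi>\<close> gives \<open>\<chi>(l) \<equiv> (N(J) J)\<close> to the power \<open>(l\<^sup>2 - 1) / 3\<close> modulo \<open>l\<close>, so that
  \<open>\<chi>(l)\<close> is a periodic function of \<open>J\<close> modulo \<open>l\<close>, with mean zero. As \<open>\<chi>\<close> is determined by \<open>J\<close>, every sum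
  of non-negative quantities over the family is bounded by the sum over all Eisenstein integers in a
  box of area \<open>O(Q)\<close>; in particular no squarefree sieve and no unique factorisation is needed. High
  moments of short sums over primes are therefore bounded by those of independent random variables
  uniform on the cube roots of unity. For long sums the crude large sieve inequality with
  constant \<open>N + O(Q\<^sup>3)\<close>, raised to a high power, suffices.

  The rough sum is split according to the dyadic block \<open>P < p \<le> 2P\<close> that contains \<open>p = P\<^sup>+(n)\<close>. Writing
  \<open>n = m p\<close>, the sum over the \<open>2P\<close>-smooth numbers \<open>m\<close> of \<open>1 / m\<close> costs \<open>O(log P)\<close>, and the maximum over
  \<open>t\<close>, \<open>\<alpha>\<close> and the range of \<open>p\<close> is replaced by a maximum over a grid. The grid must have
  only \<open>P\<close> times a power of \<open>log Q\<close> points when \<open>P\<close> is a power of \<open>Q\<close>, and this is affordable because \<open>21/40 < 1\<close>.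
\<close>

section \<open>Eisenstein integers\<close>

text \<open>The rate \<open>y / ln y\<close> comes from the first block. For y < p <= 2y the prime
  sum has mean square of order 1 / (y log y), while the smooth cofactors force a threshold of order
  1 / log y. The 2k-th moment therefore bounds the exceptional proportion by (C k log y / y)^k,
  which is at most e^(-k) when k is a small multiple of y / log y. Later blocks gain 2^i against a
  polynomial in i. The obstacle is the error in the moments: a box of side O(sqrt Q) leaves sqrt Q *
  P^(O(k)). With k = O(y / log y) and y <= log Q / (b2 log log Q) this stays below Q^(5/8), up to
  powers of log Q, only while P is at most a fixed power of log Q. Beyond that the moment order is
  lowered to about 3 log Q / log P: then P^k >= Q^3 swallows the wasteful term of the large sieve,
  and each grid point has at most about Q^(1/11) exceptions. The regimes meet at P = (log
  Q)^330.\<close>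

definition mcong :: "nat \<Rightarrow> 'a :: comm_ring_1 \<Rightarrow> 'a \<Rightarrow> bool" where
  "mcong l x y \<longleftrightarrow> of_nat l dvd x - y"

lemma mcong_refl [simp]: "mcong l x x"
  by (simp add: mcong_def)

lemma mcong_sym: "mcong l x y \<Longrightarrow> mcong l y x"
  unfolding mcong_def by (subst dvd_minus_iff [symmetric]) simp

lemma mcong_trans [trans]: "mcong l x y \<Longrightarrow> mcong l y z \<Longrightarrow> mcong l x z"
  unfolding mcong_def using dvd_add[of "of_nat l" "x - y" "y - z"] by simp

lemma mcong_add: "mcong l x y \<Longrightarrow> mcong l x' y' \<Longrightarrow> mcong l (x + x') (y + y')"
  unfolding mcong_def using dvd_add[of "of_nat l" "x - y" "x' - y'"] by (simp add: algebra_simps)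

lemma mcong_mult: "mcong l x y \<Longrightarrow> mcong l x' y' \<Longrightarrow> mcong l (x * x') (y * y')"
proof -
  assume "mcong l x y" "mcong l x' y'"
  then have "of_nat l dvd (x - y) * x' + y * (x' - y')"
    unfolding mcong_def by (intro dvd_add dvd_mult dvd_mult2)
  then show ?thesis by (simp add: mcong_def algebra_simps)
qed

lemma mcong_power: "mcong l x y \<Longrightarrow> mcong l (x ^ n) (y ^ n)"
  by (induction n) (auto intro: mcong_mult)

lemma mcong_sum: "(\<And>i. i \<in> A \<Longrightarrow> mcong l (f i) (g i)) \<Longrightarrow> mcong l (sum f A) (sum g A)"
  by (induction A rule: infinite_finite_induct) (auto intro: mcong_add)

text \<open>The inner binomial coefficients are divisible by \<open>l\<close>. The ring is arbitrary
  because the lemma serves both for \<open>eis\<close> and for polynomials over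
  \<open>eis\<close>.\<close>

lemma freshman:
  fixes x y :: "'a :: comm_ring_1"
  assumes "prime l"
  shows "mcong l ((x + y) ^ l) (x ^ l + y ^ l)"
proof -
  have l: "l > 0" using assms prime_gt_0_nat by blast
  have "(x + y) ^ l = (\<Sum>k\<le>l. of_nat (l choose k) * x ^ k * y ^ (l - k))"
    by (rule binomial_ring)
  also have "{..l} = insert 0 (insert l {1..<l})" using l by auto
  also have "(\<Sum>k\<in>\<dots>. of_nat (l choose k) * x ^ k * y ^ (l - k)) =
      y ^ l + (x ^ l + (\<Sum>k\<in>{1..<l}. of_nat (l choose k) * x ^ k * y ^ (l - k)))"
    using l by simp
  finally have eq: "(x + y) ^ l - (x ^ l + y ^ l) =
      (\<Sum>k\<in>{1..<l}. of_nat (l choose k) * x ^ k * y ^ (l - k))"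
    by simp
  show ?thesis unfolding mcong_def eq
  proof (intro dvd_sum dvd_mult2)
    fix k assume "k \<in> {1..<l}"
    then have "l dvd (l choose k)" using assms by (intro dvd_choose_prime) auto
    then show "of_nat l dvd (of_nat (l choose k) :: 'a)" by (auto elim!: dvdE)
  qed
qed

lemma freshman_sum:
  fixes f :: "'b \<Rightarrow> 'a :: comm_ring_1"
  assumes "prime l"
  shows "mcong l ((\<Sum>i\<in>A. f i) ^ l) (\<Sum>i\<in>A. f i ^ l)"
proof (induction A rule: infinite_finite_induct)
  case (insert x A)
  have "mcong l ((f x + sum f A) ^ l) (f x ^ l + sum f A ^ l)"
    by (rule freshman[OF assms])
  also have "mcong l \<dots> (f x ^ l + (\<Sum>i\<in>A. f i ^ l))"
    by (intro mcong_add insert mcong_refl)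
  finally show ?case using insert by simp
qed (use assms prime_gt_0_nat[of l] in \<open>auto simp: power_0_left\<close>)

text \<open>\<open>Eis a b\<close> stands for \<open>a + b \<omega>\<close> with \<open>\<omega>\<^sup>2 + \<omega> + 1 = 0\<close>.\<close>

datatype eis = Eis (ere: int) (eom: int)

lemma eis_eqI: "ere x = ere y \<Longrightarrow> eom x = eom y \<Longrightarrow> x = y"
  by (cases x; cases y) auto

instantiation eis :: comm_ring_1
begin
definition "0 = Eis 0 0"
definition "1 = Eis 1 0"
definition "x + y = Eis (ere x + ere y) (eom x + eom y)"
definition "x - y = Eis (ere x - ere y) (eom x - eom y)"
definition "- x = Eis (- ere x) (- eom x)"
definition "x * y = Eis (ere x * ere y - eom x * eom y)
   (ere x * eom y + eom x * ere y - eom x * eom y)"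
instance
  by standard (auto simp: zero_eis_def one_eis_def plus_eis_def minus_eis_def uminus_eis_def
      times_eis_def algebra_simps)
end

lemma eis_sel [simp]:
  "ere 0 = 0" "eom 0 = 0" "ere 1 = 1" "eom 1 = 0"
  "ere (x + y) = ere x + ere y" "eom (x + y) = eom x + eom y"
  "ere (x - y) = ere x - ere y" "eom (x - y) = eom x - eom y"
  "ere (- x) = - ere x" "eom (- x) = - eom x"
  "ere (x * y) = ere x * ere y - eom x * eom y"
  "eom (x * y) = ere x * eom y + eom x * ere y - eom x * eom y"
  by (simp_all add: zero_eis_def one_eis_def plus_eis_def minus_eis_def uminus_eis_def
      times_eis_def)

lemma eis_of_nat [simp]: "ere (of_nat n) = int n" "eom (of_nat n) = 0"
  by (induction n) auto

lemma eis_of_int [simp]: "ere (of_int n) = n" "eom (of_int n) = 0"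
  by (cases n; simp)+

lemma eis_dvd_iff: "of_nat l dvd x \<longleftrightarrow> int l dvd ere x \<and> int l dvd eom x"
proof
  assume "of_nat l dvd x"
  then show "int l dvd ere x \<and> int l dvd eom x" by (auto elim!: dvdE)
next
  assume "int l dvd ere x \<and> int l dvd eom x"
  then obtain a b where "ere x = int l * a" "eom x = int l * b" by (auto elim!: dvdE)
  then have "x = of_nat l * Eis a b" by (intro eis_eqI) auto
  then show "of_nat l dvd x" by simp
qed

lemma mcong_eis_iff: "mcong l x y \<longleftrightarrow> [ere x = ere y] (mod int l) \<and> [eom x = eom y] (mod int l)"
  by (simp add: mcong_def eis_dvd_iff cong_iff_dvd_diff)

definition enorm :: "eis \<Rightarrow> int" where
  "enorm x = ere x ^ 2 - ere x * eom x + eom x ^ 2"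

definition eomega :: eis where "eomega = Eis 0 1"

lemma eomega_sel [simp]: "ere eomega = 0" "eom eomega = 1"
  by (simp_all add: eomega_def)

lemma eomega_cube: "eomega ^ 3 = 1"
  by (intro eis_eqI) (auto simp: power3_eq_cube)

lemma enorm_mult: "enorm (x * y) = enorm x * enorm y"
  by (simp add: enorm_def power2_eq_square algebra_simps)

lemma enorm_cong: "mcong l x y \<Longrightarrow> [enorm x = enorm y] (mod int l)"
  unfolding mcong_eis_iff enorm_def by (intro cong_add cong_diff cong_mult cong_pow) auto

definition omega :: complex where "omega = Complex (- 1 / 2) (sqrt 3 / 2)"

lemma omega_sel [simp]: "Re omega = - 1 / 2" "Im omega = sqrt 3 / 2"
  by (simp_all add: omega_def)

lemma omega_sq: "omega * omega = - 1 - omega"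
  by (simp add: complex_eq_iff)

lemma omega_cube: "omega ^ 3 = 1"
proof -
  have "omega ^ 3 = omega * (omega * omega)" by (simp add: power3_eq_cube)
  also have "\<dots> = - omega - omega * omega" by (subst omega_sq) (simp add: algebra_simps)
  also have "\<dots> = 1" by (simp add: omega_sq)
  finally show ?thesis .
qed

lemma omega_neq [simp]: "omega \<noteq> 1" "omega \<noteq> 0"
  by (auto simp: complex_eq_iff)

lemma norm_omega [simp]: "norm omega = 1"
  by (simp add: cmod_def power_divide)

text \<open>The bridge between the two sides of the argument: congruences live in
  \<open>eis\<close>, character values in the complex numbers.\<close>

definition emb :: "eis \<Rightarrow> complex" where "emb x = of_int (ere x) + of_int (eom x) * omega"

lemma emb_simps [simp]: "emb 0 = 0" "emb 1 = 1" "emb (x + y) = emb x + emb y"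
  "emb (x - y) = emb x - emb y" "emb (- x) = - emb x" "emb (of_nat n) = of_nat n"
  "emb (of_int k) = of_int k" "emb eomega = omega"
  by (simp_all add: emb_def algebra_simps)

lemma emb_mult [simp]: "emb (x * y) = emb x * emb y"
proof -
  have "emb x * emb y = of_int (ere x * ere y) + of_int (ere x * eom y + eom x * ere y) * omega
      + of_int (eom x * eom y) * (omega * omega)"
    by (simp add: emb_def algebra_simps)
  then show ?thesis unfolding omega_sq by (simp add: emb_def algebra_simps)
qed

lemma emb_power [simp]: "emb (x ^ n) = emb x ^ n"
  by (induction n) auto

lemma emb_sum: "emb (sum f A) = (\<Sum>i\<in>A. emb (f i))"
  by (induction A rule: infinite_finite_induct) auto

lemma emb_inj: "emb x = emb y \<Longrightarrow> x = y"
  by (auto simp: emb_def complex_eq_iff intro: eis_eqI)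

lemma norm_emb: "norm (emb x) ^ 2 = of_int (enorm x)"
proof -
  have "norm (emb x) ^ 2 = (of_int (ere x) - of_int (eom x) / 2) ^ 2 + (of_int (eom x)
      * sqrt 3 / 2) ^ 2"
    by (simp add: cmod_power2 emb_def)
  also have "\<dots> = of_int (enorm x)"
    by (simp add: enorm_def power_divide power_mult_distrib) (simp add: power2_eq_square
        field_simps)
  finally show ?thesis .
qed

definition emu3 :: "eis set" where "emu3 = {1, eomega, eomega ^ 2}"

lemma emu3_cube: "z \<in> emu3 \<Longrightarrow> z ^ 3 = 1"
proof -
  have "(eomega ^ 2) ^ 3 = (eomega ^ 3) ^ 2" by (simp only: power_mult [symmetric] mult.commute)
  then show "z \<in> emu3 \<Longrightarrow> z ^ 3 = 1" by (auto simp: emu3_def eomega_cube)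
qed

lemma emu3_mult: "z \<in> emu3 \<Longrightarrow> z' \<in> emu3 \<Longrightarrow> z * z' \<in> emu3"
  by (auto simp: emu3_def intro!: eis_eqI simp: power2_eq_square)

text \<open>The difference of two distinct cube roots of unity has a coordinate 1 or -1, which no
  \<open>l > 1\<close> divides. Hence a congruence modulo \<open>l\<close> determines a character
  value.\<close>

lemma emu3_cong_unique:
  assumes "z \<in> emu3" "z' \<in> emu3" "mcong l z z'" "l > 1"
  shows "z = z'"
proof -
  have "int l dvd ere (z - z')" "int l dvd eom (z - z')"
    using assms(3) by (auto simp: mcong_def eis_dvd_iff)
  moreover have "z = z' \<or> \<bar>ere (z - z')\<bar> = 1 \<or> \<bar>eom (z - z')\<bar> = 1"
    using assms(1,2) by (auto simp: emu3_def power2_eq_square)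
  moreover have "\<not> int l dvd c" if "\<bar>c\<bar> = 1" for c
  proof
    assume "int l dvd c"
    then have "int l dvd \<bar>c\<bar>" by simp
    then show False using that assms(4) by simp
  qed
  ultimately show ?thesis by blast
qed

lemma emu3_not_cong_0:
  assumes "z \<in> emu3" "l > 1" shows "\<not> mcong l z 0"
  using assms by (auto simp: emu3_def mcong_def eis_dvd_iff power2_eq_square)

section \<open>Gauss sums of primitive cubic characters\<close>

lemma emb_zero_iff: "emb x = 0 \<longleftrightarrow> x = 0"
  using emb_inj[of x 0] by auto

lemma map_poly_emb_mult: "map_poly emb (p * q) = map_poly emb p * map_poly emb q"
  by (intro poly_eqI) (simp add: coeff_map_poly coeff_mult emb_sum)

lemma map_poly_emb_add: "map_poly emb (p + q) = map_poly emb p + map_poly emb q"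
  by (intro poly_eqI) (simp add: coeff_map_poly)

lemma map_poly_emb_diff: "map_poly emb (p - q) = map_poly emb p - map_poly emb q"
  by (intro poly_eqI) (simp add: coeff_map_poly)

lemma map_poly_emb_sum: "map_poly emb (sum f A) = (\<Sum>i\<in>A. map_poly emb (f i))"
  by (induction A rule: infinite_finite_induct) (auto simp: map_poly_emb_add)

lemma map_poly_emb_1: "map_poly emb 1 = 1"
  by (intro poly_eqI) (simp add: coeff_map_poly)

lemma map_poly_emb_power: "map_poly emb (p ^ n) = map_poly emb p ^ n"
  by (induction n) (auto simp: map_poly_emb_mult map_poly_emb_1)

lemma map_poly_emb_of_nat: "map_poly emb (of_nat n) = of_nat n"
  by (intro poly_eqI) (simp add: coeff_map_poly of_nat_poly coeff_pCons split: nat.split)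

definition zeta :: "nat \<Rightarrow> nat \<Rightarrow> complex" where
  "zeta q k = exp (2 * of_real pi * \<i> * of_nat k / of_nat q)"

lemma zeta_add: "zeta q (a + b) = zeta q a * zeta q b"
  by (simp add: zeta_def exp_add [symmetric] algebra_simps add_divide_distrib)

lemma zeta_0 [simp]: "zeta q 0 = 1"
  by (simp add: zeta_def)

lemma zeta_mult: "zeta q (a * b) = zeta q a ^ b"
  by (induction b) (auto simp: zeta_add)

lemma zeta_mult': "zeta q (a * b) = zeta q b ^ a"
  using zeta_mult[of q b a] by (simp add: mult.commute)

lemma norm_zeta [simp]: "norm (zeta q a) = 1"
  by (simp add: zeta_def)

lemma zeta_eq_iff: "q > 0 \<Longrightarrow> zeta q a = zeta q b \<longleftrightarrow> a mod q = b mod q"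
  unfolding zeta_def by (rule complex_root_unity_eq) auto

lemma cnj_mult_zeta: "cnj (zeta q a) * zeta q a = 1" "zeta q a * cnj (zeta q a) = 1"
  using complex_norm_square[of "zeta q a"] by (simp_all add: mult.commute)

lemma sum_zeta:
  assumes "q > 0"
  shows "(\<Sum>k<q. cnj (zeta q k) * zeta q k ^ i) = (if i mod q = 1 mod q then of_nat q else 0)"
proof -
  define r where "r = cnj (zeta q 1) * zeta q i"
  have "cnj (zeta q k) * zeta q k ^ i = r ^ k" for k
  proof -
    have "zeta q k ^ i = zeta q i ^ k" by (simp only: zeta_mult [symmetric] mult.commute)
    moreover have "zeta q k = zeta q 1 ^ k" using zeta_mult[of q 1 k] by simp
    ultimately show ?thesis by (simp only: r_def power_mult_distrib complex_cnj_power)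
  qed
  then have eq: "(\<Sum>k<q. cnj (zeta q k) * zeta q k ^ i) = (\<Sum>k<q. r ^ k)" by simp
  have zr: "zeta q 1 * r = zeta q i"
    unfolding r_def mult.assoc [symmetric] cnj_mult_zeta by simp
  then have "r = 1 \<longleftrightarrow> zeta q i = zeta q 1"
    using cnj_mult_zeta(1)[of q 1] zr unfolding r_def by (metis mult.right_neutral)
  then have r1: "r = 1 \<longleftrightarrow> i mod q = 1 mod q"
    by (simp only: zeta_eq_iff[OF assms])
  have "r ^ q = cnj (zeta q (1 * q)) * zeta q (i * q)"
    by (simp only: r_def power_mult_distrib zeta_mult complex_cnj_power)
  also have "\<dots> = 1" using zeta_eq_iff[OF assms, of q 0] zeta_eq_iff[OF assms, of "i * q" 0] by simp
  finally have rq: "r ^ q = 1" .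
  show ?thesis unfolding eq using r1 rq by (auto simp: geometric_sum)
qed

text \<open>The coefficient of \<open>X\<close> in the image of the polynomial in the group ring of the integers modulo \<open>q\<close>.\<close>

definition rescoeff :: "nat \<Rightarrow> eis poly \<Rightarrow> eis" where
  "rescoeff q p = (\<Sum>i | i \<le> degree p \<and> i mod q = 1 mod q. Polynomial.coeff p i)"

text \<open>Fourier inversion modulo \<open>q\<close>. The right-hand side is visibly linear in
  \<open>p\<close>, and this is how linearity of \<open>rescoeff\<close> is obtained although its
  definition mentions the degree.\<close>

lemma emb_rescoeff:
  assumes "q > 0"
  shows "emb (rescoeff q p) = (\<Sum>k<q. cnj (zeta q k) * poly (map_poly emb p) (zeta q k)) / of_nat q"
proof -
  have deg: "degree (map_poly emb p) = degree p"
    by (cases "p = 0") (auto simp: emb_zero_iff leading_coeff_0_iff intro!: map_poly_degree_eq)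
  have "(\<Sum>k<q. cnj (zeta q k) * poly (map_poly emb p) (zeta q k)) =
        (\<Sum>k<q. \<Sum>i\<le>degree p. emb (Polynomial.coeff p i) * (cnj (zeta q k) * zeta q k ^ i))"
    by (simp add: poly_altdef deg coeff_map_poly sum_distrib_left mult_ac)
  also have "\<dots> = (\<Sum>i\<le>degree p. emb (Polynomial.coeff p i) * (\<Sum>k<q. cnj (zeta q k) * zeta q k ^ i))"
    by (subst sum.swap) (simp add: sum_distrib_left)
  also have "\<dots> = (\<Sum>i\<le>degree p. if i mod q = 1 mod q then emb (Polynomial.coeff p i)
      * of_nat q else 0)"
    by (intro sum.cong refl) (simp add: sum_zeta[OF assms])
  also have "\<dots> = (\<Sum>i | i \<le> degree p \<and> i mod q = 1 mod q. emb (Polynomial.coeff p i) * of_nat q)"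
    by (subst sum.inter_filter [symmetric]) (auto intro!: sum.cong)
  also have "\<dots> = emb (rescoeff q p) * of_nat q"
    by (simp add: rescoeff_def emb_sum sum_distrib_right)
  finally show ?thesis using assms by simp
qed

lemma rescoeff_diff: "q > 0 \<Longrightarrow> rescoeff q (p - r) = rescoeff q p - rescoeff q r"
  by (intro emb_inj) (simp add: emb_rescoeff map_poly_emb_diff sum_subtractf algebra_simps
      diff_divide_distrib)

lemma rescoeff_add: "q > 0 \<Longrightarrow> rescoeff q (p + r) = rescoeff q p + rescoeff q r"
  by (intro emb_inj) (simp add: emb_rescoeff map_poly_emb_add sum.distrib algebra_simps
      add_divide_distrib)

lemma rescoeff_of_nat_mult: "q > 0 \<Longrightarrow> rescoeff q (of_nat n * p) = of_nat n * rescoeff q p"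
  by (intro emb_inj) (simp add: emb_rescoeff map_poly_emb_mult map_poly_emb_of_nat
        sum_distrib_left mult_ac)

lemma rescoeff_mcong: "q > 0 \<Longrightarrow> mcong l p r \<Longrightarrow> mcong l (rescoeff q p) (rescoeff q r)"
  unfolding mcong_def by (auto simp: rescoeff_of_nat_mult simp flip: rescoeff_diff elim!: dvdE)

lemma rescoeff_monom: "rescoeff q (Polynomial.monom c n) = (if n mod q = 1 mod q then c else 0)"
proof (cases "c = 0")
  case False
  then have "rescoeff q (Polynomial.monom c n) = (\<Sum>i | i \<le> n \<and> i mod q = 1 mod q. if i
      = n then c else 0)"
    by (auto simp: rescoeff_def degree_monom_eq intro!: sum.cong)
  also have "\<dots> = (if n mod q = 1 mod q then c else 0)" by (subst sum.delta) auto
  finally show ?thesis .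
qed (simp add: rescoeff_def)

lemma rescoeff_sum: "q > 0 \<Longrightarrow> rescoeff q (sum f A) = (\<Sum>i\<in>A. rescoeff q (f i))"
  by (induction A rule: infinite_finite_induct) (auto simp: rescoeff_add, simp_all add:
      rescoeff_def)

lemma sum_mult_residues:
  fixes f :: "nat \<Rightarrow> 'a :: comm_monoid_add"
  assumes "coprime a q" "q > 0"
  shows "(\<Sum>b<q. f (a * b mod q)) = (\<Sum>b<q. f b)"
proof -
  have inj: "inj_on (\<lambda>b. a * b mod q) {..<q}"
  proof (rule inj_onI)
    fix b c assume "b \<in> {..<q}" "c \<in> {..<q}" "a * b mod q = a * c mod q"
    then show "b = c"
      using cong_mult_lcancel_nat[OF assms(1), of b c] cong_less_modulus_unique_nat[of b c q]
      by (simp add: cong_def)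
  qed
  have "(\<lambda>b. a * b mod q) ` {..<q} = {..<q}"
    by (rule endo_inj_surj) (use assms(2) inj in auto)
  with inj have "bij_betw (\<lambda>b. a * b mod q) {..<q} {..<q}" by (simp add: bij_betw_def)
  then show ?thesis by (rule sum.reindex_bij_betw)
qed

lemma dirichlet_character_mod:
  assumes "dirichlet_character q chi" shows "chi (n mod q) = chi n"
proof -
  have per: "chi (n + q) = chi n" for n using assms by (auto simp: dirichlet_character_def)
  have "chi (r + k * q) = chi r" for r k
  proof (induction k)
    case (Suc k)
    then show ?case using per[of "r + k * q"] by (simp add: add_ac)
  qed simp
  from this[of "n mod q" "n div q"] show ?thesis by simp
qed

lemma dirichlet_character_cong:
  assumes "dirichlet_character q chi" "[m = n] (mod q)" shows "chi m = chi n"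
  using dirichlet_character_mod[OF assms(1), of m] dirichlet_character_mod[OF assms(1), of n]
      assms(2)
  by (simp add: cong_def)

lemma cube_root_cases:
  assumes "(x::complex) ^ 3 = 1" shows "\<exists>z\<in>emu3. emb z = x"
proof -
  have "(x - 1) * ((x - omega) * (x - omega * omega)) = x ^ 3 - 1 - (1 + omega + omega * omega)
      * x * x + (omega + omega * omega + omega ^ 3) * x - omega ^ 3 + 1"
    by (simp add: algebra_simps power3_eq_cube)
  also have "\<dots> = 0" by (simp add: omega_cube omega_sq assms)
  finally consider "x = 1" | "x = omega" | "x = omega * omega" by auto
  then show ?thesis by cases (auto simp: emu3_def power2_eq_square)
qed

locale cubic_primitive =
  fixes q :: nat and chi :: "nat \<Rightarrow> complex"
  assumes primitive: "primitive_character q chi" and cubic: "cubic_character q chi"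
begin

lemma dc: "dirichlet_character q chi"
  using primitive by (simp add: primitive_character_def)

lemma chi_mult: "chi (m * n) = chi m * chi n" and chi_0_iff: "chi n = 0 \<longleftrightarrow> \<not> coprime n q"
  and q_pos: "q > 0"
  using dc by (auto simp: dirichlet_character_def)

lemma chi_eq_0: "\<not> coprime n q \<Longrightarrow> chi n = 0"
  by (simp add: chi_0_iff)

lemma chi_cube: "coprime n q \<Longrightarrow> chi n ^ 3 = 1"
  using cubic by (auto simp: cubic_character_def)

lemma norm_chi: "coprime n q \<Longrightarrow> norm (chi n) = 1"
  using chi_cube[of n] norm_power[of "chi n" 3] power_eq_imp_eq_base[of "norm (chi n)" 3 1] by simp

lemma norm_chi_le: "norm (chi n) \<le> 1"
  using norm_chi[of n] chi_0_iff[of n] by (cases "coprime n q") auto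

lemma cnj_chi: "cnj (chi n) ^ 2 = chi n" and chi_sq: "chi n ^ 2 = cnj (chi n)"
proof -
  show *: "chi n ^ 2 = cnj (chi n)"
  proof (cases "coprime n q")
    case True
    have "chi n * cnj (chi n) = 1" using complex_norm_square[of "chi n"] norm_chi[OF True] by simp
    then have "chi n ^ 3 * cnj (chi n) = chi n ^ 2"
      by (simp add: power3_eq_cube power2_eq_square mult.assoc)
    then show ?thesis using chi_cube[OF True] by simp
  qed (simp add: chi_eq_0)
  show "cnj (chi n) ^ 2 = chi n"
    using arg_cong[OF *, of cnj] by simp
qed

lemma chi_1: "chi 1 = 1"
proof -
  have "chi 1 * chi 1 = chi 1" using chi_mult[of 1 1] by simp
  moreover have "chi 1 \<noteq> 0" by (simp add: chi_0_iff)
  ultimately show ?thesis by simp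
qed

lemma q_gt_1: "q > 1"
proof (rule ccontr)
  assume "\<not> q > 1"
  then have "q = 1" using q_pos by simp
  then have "chi n = 1" for n
    using dirichlet_character_mod[OF dc, of n] dirichlet_character_mod[OF dc, of 1] chi_1 by simp
  then show False using cubic by (auto simp: cubic_character_def)
qed

text \<open>The value has square 1 and is a cube root of unity. Evenness makes the Jacobi sum equal
  to \<open>g ^ 3 / q\<close> without a sign.\<close>

lemma chi_minus_1: "chi (q - 1) = 1"
proof -
  have "(q - 1) * (q - 1) = 1 + q * (q - 2)"
  proof -
    obtain m where "q = m + 2" using q_gt_1 by (metis add.commute le_Suc_ex Suc_1 Suc_leI)
    then show ?thesis by (simp add: algebra_simps)
  qed
  then have "[(q - 1) * (q - 1) = 1] (mod q)" by (simp only: cong_def mod_mult_self2)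
  then have "chi (q - 1) ^ 2 = 1"
    using dirichlet_character_cong[OF dc] chi_mult[of "q - 1" "q - 1"] chi_1
    by (simp add: power2_eq_square)
  moreover from this have "cnj (chi (q - 1)) = 1" by (simp add: chi_sq)
  ultimately show ?thesis by (metis complex_cnj_cnj complex_cnj_one)
qed

definition gauss_sum :: "nat \<Rightarrow> complex" where "gauss_sum k = (\<Sum>a<q. chi a * zeta q (a * k))"

lemma gauss_sum_shift: "coprime a q \<Longrightarrow> chi a * gauss_sum (a * k) = gauss_sum k"
proof -
  assume a: "coprime a q"
  have "chi a * gauss_sum (a * k) = (\<Sum>b<q. chi (a * b mod q) * zeta q ((a * b mod q) * k))"
    unfolding gauss_sum_def sum_distrib_left
  proof (intro sum.cong refl)
    fix b
    have "chi (a * b mod q) = chi a * chi b"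
      using dirichlet_character_mod[OF dc] by (simp add: chi_mult)
    moreover have "zeta q ((a * b mod q) * k) = zeta q (b * (a * k))"
      by (subst zeta_eq_iff[OF q_pos]) (simp add: mod_mult_right_eq mult_ac)
    ultimately show "chi a * (chi b * zeta q (b * (a * k))) = chi (a * b mod q) * zeta q (a
        * b mod q * k)"
      by simp
  qed
  also have "\<dots> = gauss_sum k" unfolding gauss_sum_def
    by (rule sum_mult_residues[OF a q_pos, where f = "\<lambda>b. chi b * zeta q (b * k)"])
  finally show ?thesis .
qed

text \<open>For \<open>k\<close> coprime to \<open>q\<close> this is a change of variables.
  Otherwise primitivity supplies \<open>a\<close> congruent to 1 modulo \<open>q / gcd k q\<close>
  with \<open>chi a\<close> different from 1; multiplication by \<open>a\<close> fixes
  \<open>k\<close> modulo \<open>q\<close>, so the sum equals \<open>chi a\<close> times itself and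
  vanishes.\<close>

lemma gauss_sum_eq: "gauss_sum k = cnj (chi k) * gauss_sum 1"
proof (cases "coprime k q")
  case True
  have "cnj (chi k) * chi k = 1" using complex_norm_square[of "chi k"] norm_chi[OF True]
      by (simp add: mult.commute)
  moreover have "chi k * gauss_sum k = gauss_sum 1" using gauss_sum_shift[OF True, of 1] by simp
  ultimately show ?thesis by (metis mult.assoc mult_1)
next
  case False
  define d where "d = gcd k q"
  have d1: "d \<noteq> 1" using False unfolding d_def coprime_iff_gcd_eq_1 .
  have d: "d dvd q" "d dvd k" by (simp_all add: d_def)
  then obtain q' k' where q': "q = d * q'" and k': "k = d * k'" by (auto elim!: dvdE)
  have "q' \<noteq> q" using q' q_pos d1 by auto
  then have "\<not> induced_modulus q chi q'" using primitive by (auto simp: primitive_character_def)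
  then obtain a where a: "coprime a q" "[a = 1] (mod q')" "chi a \<noteq> 1"
    using q' by (auto simp: induced_modulus_def)
  have "[d * a = d * 1] (mod (d * q'))" using a(2)
      by (simp add: cong_def mult_mod_right [symmetric])
  then have "[k' * (d * a) = k' * (d * 1)] (mod q)" unfolding q' by (rule cong_mult[OF cong_refl])
  then have "[a * k = k] (mod q)" by (simp add: k' mult_ac)
  then have "zeta q (b * (a * k)) = zeta q (b * k)" for b
    using cong_mult[OF cong_refl[of b q] \<open>[a * k = k] (mod q)\<close>]
    by (simp add: zeta_eq_iff[OF q_pos] cong_def)
  then have "gauss_sum (a * k) = gauss_sum k" by (simp add: gauss_sum_def)
  then have "gauss_sum k = 0" using gauss_sum_shift[OF a(1), of k] a(3) by auto
  then show ?thesis using False by (simp add: chi_eq_0)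
qed

text \<open>The congruence stays inside \<open>eis\<close>: instead of adjoining a
  \<open>q\<close>-th root of unity, powers of the generating polynomial \<open>F\<close> are read
  through \<open>rescoeff\<close>. Fourier inversion turns the coefficient of \<open>F ^ n\<close>
  into \<open>g ^ (n - 1)\<close> when \<open>n mod 3 = 1\<close>, a power of
  \<open>g ^ 3 = q J\<close>. Frobenius evaluates the same coefficient modulo \<open>l\<close>. The
  value \<open>z = 0\<close> occurs when \<open>l\<close> divides \<open>q\<close>.\<close>

theorem jacobi_sum_reciprocity:
  obtains J where "enorm J = int q"
    "\<And>l. prime l \<Longrightarrow> l \<noteq> 3 \<Longrightarrow> \<exists>z\<in>insert 0 emu3. emb z = chi l \<and>
         mcong l z ((of_int (enorm J) * J) ^ ((l * l - 1) div 3))"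
proof -
  have "\<exists>z\<in>insert 0 emu3. emb z = chi a" for a
  proof (cases "coprime a q")
    case True
    then show ?thesis using cube_root_cases[OF chi_cube[OF True]] by blast
  next
    case False
    then show ?thesis using chi_eq_0[OF False] by (intro bexI[of _ 0]) simp_all
  qed
  then have "\<forall>a. \<exists>z. z \<in> insert 0 emu3 \<and> emb z = chi a" by blast
  then obtain c where c': "\<forall>a. c a \<in> insert 0 emu3 \<and> emb (c a) = chi a"
    by (rule choice [THEN exE])
  then have c: "\<And>a. c a \<in> insert 0 emu3" "\<And>a. emb (c a) = chi a" by blast+
  define F where "F = (\<Sum>a<q. Polynomial.monom (c a) a)"
  define g where "g = gauss_sum 1"
  have polyF: "poly (map_poly emb F) (zeta q k) = cnj (chi k) * g" for k
    unfolding g_def gauss_sum_eq[of k, symmetric]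
    by (simp add: F_def map_poly_emb_sum map_poly_monom poly_sum poly_monom c gauss_sum_def
        zeta_mult')
  have Phipow: "emb (rescoeff q (F ^ n)) = g ^ n / of_nat q * (\<Sum>k<q. cnj (zeta q k)
      * cnj (chi k) ^ n)" for n
    by (subst emb_rescoeff[OF q_pos])
       (simp add: map_poly_emb_power polyF power_mult_distrib sum_distrib_left sum_divide_distrib
           mult_ac)
  have cg1: "(\<Sum>k<q. cnj (zeta q k) * cnj (chi k)) = cnj g"
    by (simp add: g_def gauss_sum_def mult.commute)
  have Phi1: "emb (rescoeff q F) = 1"
  proof -
    have "rescoeff q F = (\<Sum>a<q. if a = 1 then c a else 0)"
      unfolding F_def rescoeff_sum[OF q_pos] rescoeff_monom using q_gt_1 by (intro sum.cong) auto
    also have "\<dots> = c 1" using q_gt_1 by simp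
    finally show ?thesis using c chi_1 by simp
  qed
  \<comment> \<open>Comparing the two evaluations of the coefficient of \<open>F\<close> itself
    yields the absolute value of the Gauss sum.\<close>
  have gg: "g * cnj g = of_nat q"
    using Phipow[of 1] Phi1 cg1 q_pos by (simp add: field_simps)
  have Phipow1: "emb (rescoeff q (F ^ n)) = g ^ (n - 1)" if "n mod 3 = 1" for n
  proof -
    have "cnj (chi k) ^ n = cnj (chi k)" for k
    proof (cases "coprime k q")
      case True
      have "cnj (chi k) ^ (3 * (n div 3) + 1) = cnj (chi k)"
        using arg_cong[OF chi_cube[OF True], of cnj] by (simp add: power_add power_mult)
      moreover have "3 * (n div 3) + 1 = n" using that by presburger
      ultimately show ?thesis by metis
    next
      case False
      then show ?thesis using that by (cases n) (auto simp: chi_eq_0)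
    qed
    then have "emb (rescoeff q (F ^ n)) = g ^ n / of_nat q * cnj g" using Phipow[of n] cg1 by simp
    also have "g ^ n = g ^ (n - 1) * g" using that by (cases n) auto
    also have "g ^ (n - 1) * g / of_nat q * cnj g = g ^ (n - 1) * (g * cnj g) / of_nat q" by simp
    also have "\<dots> = g ^ (n - 1)" using gg q_pos by simp
    finally show ?thesis .
  qed
  define J where "J = rescoeff q (F ^ 2)"
  have "(\<Sum>k<q. cnj (zeta q k) * chi k) = gauss_sum (q - 1)"
    unfolding gauss_sum_def
  proof (intro sum.cong refl)
    fix k
    have "zeta q (k * (q - 1)) * zeta q k = zeta q (k * q)"
      unfolding zeta_add [symmetric] using q_gt_1 by (cases q) (auto simp: algebra_simps)
    also have "\<dots> = 1" using zeta_eq_iff[OF q_pos, of "k * q" 0] by simp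
    finally have "zeta q (k * (q - 1)) = cnj (zeta q k)"
      using cnj_mult_zeta[of q k] by (metis mult.assoc mult.commute mult_1)
    then show "cnj (zeta q k) * chi k = chi k * zeta q (k * (q - 1))" by simp
  qed
  also have "\<dots> = g" using gauss_sum_eq[of "q - 1"] chi_minus_1 by (simp add: g_def)
  finally have embJ: "emb J = g ^ 3 / of_nat q"
    using Phipow[of 2] by (simp add: J_def cnj_chi) (simp add: power2_eq_square power3_eq_cube)
  have ng: "norm g ^ 2 = real q"
  proof -
    have "complex_of_real (norm g ^ 2) = complex_of_real (real q)"
      using gg complex_norm_square[of g] by simp
    then show ?thesis by (rule of_real_eq_iff[THEN iffD1])
  qed
  have "real_of_int (enorm J) = (norm g ^ 2) ^ 3 / real q ^ 2"
    unfolding norm_emb [symmetric] embJ by (simp add: norm_divide norm_power power_divide flip: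
        power_mult)
  also have "\<dots> = real_of_int (int q)" using q_pos ng by (simp add: power2_eq_square power3_eq_cube)
  finally have normJ: "enorm J = int q" by (simp only: of_int_eq_iff)
  show ?thesis
  proof (rule that[OF normJ])
    fix l :: nat assume l: "prime l" "l \<noteq> 3"
    \<comment> \<open>The square of Frobenius is taken because \<open>l * l\<close> is 1 modulo 3
      for either residue of \<open>l\<close>, so that it fixes the coefficients
      \<open>c a\<close>.\<close>
    define L where "L = l * l"
    have "l mod 3 \<noteq> 0"
      using l primes_dvd_imp_eq[of 3 l] by (auto simp: mod_eq_0_iff_dvd)
    then have "l mod 3 = 1 \<or> l mod 3 = 2" by presburger
    then have L3: "L mod 3 = 1" unfolding L_def by (auto simp: mod_mult_eq [symmetric, of l l 3])
    have cL: "c a ^ L = c a" for a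
    proof (cases "c a = 0")
      case True
      then show ?thesis using L3 by (cases L) auto
    next
      case False
      then have "c a ^ 3 = 1" using c(1)[of a] emu3_cube by auto
      then have "c a ^ (3 * (L div 3) + 1) = c a" by (simp add: power_add power_mult)
      moreover have "3 * (L div 3) + 1 = L" using L3 by presburger
      ultimately show ?thesis by metis
    qed
    have "mcong l (F ^ l) (\<Sum>a<q. Polynomial.monom (c a ^ l) (a * l))"
      using freshman_sum[OF l(1), of "\<lambda>a. Polynomial.monom (c a) a" "{..<q}"]
          by (simp add: F_def monom_power mult.commute)
    then have "mcong l ((F ^ l) ^ l) ((\<Sum>a<q. Polynomial.monom (c a ^ l) (a * l)) ^ l)"
        by (rule mcong_power)
    also have "mcong l \<dots> (\<Sum>a<q. Polynomial.monom ((c a ^ l) ^ l) (a * l * l))"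
      using freshman_sum[OF l(1), of "\<lambda>a. Polynomial.monom (c a ^ l) (a * l)" "{..<q}"]
          by (simp add: monom_power mult.commute mult.left_commute)
    also have "(\<Sum>a<q. Polynomial.monom ((c a ^ l) ^ l) (a * l * l))
        = (\<Sum>a<q. Polynomial.monom (c a) (a * L))"
      using cL by (simp add: L_def mult.assoc flip: power_mult)
    finally have "mcong l (F ^ L) (\<Sum>a<q. Polynomial.monom (c a) (a * L))"
        by (simp add: L_def power_mult)
    then have "mcong l (rescoeff q (F ^ L)) (rescoeff q (\<Sum>a<q. Polynomial.monom (c a) (a * L)))"
        by (rule rescoeff_mcong[OF q_pos])
    also have "rescoeff q (\<Sum>a<q. Polynomial.monom (c a) (a * L)) = (\<Sum>a<q. if a * L mod q
        = 1 mod q then c a else 0)"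
      by (simp add: rescoeff_sum[OF q_pos] rescoeff_monom)
    \<comment> \<open>The only surviving index is the inverse of \<open>L\<close> modulo
      \<open>q\<close>, and \<open>chi\<close> takes there the value
      \<open>chi l ^ (-2) = chi l\<close>.\<close>
    also have "\<dots> = c l"
    proof (cases "coprime l q")
      case True
      then have "coprime L q" by (simp add: L_def)
      then obtain b where "[L * b = 1] (mod q)" using cong_solve_coprime_nat by auto
      then have b: "[b mod q * L = 1] (mod q)"
        by (simp only: cong_def mod_mult_left_eq mod_mult_right_eq mult.commute)
      define b' where "b' = b mod q"
      have b': "b' < q" "[b' * L = 1] (mod q)" using b q_pos by (auto simp: b'_def)
      have uniq: "a = b'" if "a < q" "[a * L = 1] (mod q)" for a
      proof -
        have "[a * L = b' * L] (mod q)" using cong_trans[OF that(2) cong_sym[OF b'(2)]] .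
        then have "[a = b'] (mod q)" using cong_mult_rcancel_nat[OF \<open>coprime L q\<close>] by blast
        then show ?thesis using cong_less_modulus_unique_nat that(1) b'(1) by blast
      qed
      have "(\<Sum>a<q. if a * L mod q = 1 mod q then c a else 0) = (\<Sum>a<q. if a = b' then c a else 0)"
      proof (intro sum.cong refl)
        fix a assume "a \<in> {..<q}"
        then have "(a * L mod q = 1 mod q) = (a = b')"
          using uniq b' unfolding cong_def by blast
        then show "(if a * L mod q = 1 mod q then c a else 0) = (if a = b' then c a else 0)"
            by metis
      qed
      also have "\<dots> = c b'" using b' by simp
      also have "c b' = c l"
      proof (rule emb_inj)
        have 1: "chi b' * chi L = 1"
          using dirichlet_character_cong[OF dc b'(2)] chi_1 by (simp add: chi_mult)
        have 2: "chi L = cnj (chi l)" by (simp add: L_def chi_mult chi_sq [symmetric]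
            power2_eq_square)
        have 3: "cnj (chi l) * chi l = 1"
          using complex_norm_square[of "chi l"] norm_chi[OF True] by (simp add: mult.commute)
        have "chi b' = chi b' * (cnj (chi l) * chi l)" unfolding 3 by simp
        also have "\<dots> = (chi b' * chi L) * chi l" unfolding 2 by (simp only: mult.assoc)
        also have "\<dots> = chi l" unfolding 1 by simp
        finally have "chi b' = chi l" .
        then show "emb (c b') = emb (c l)" by (simp add: c)
      qed
      finally show ?thesis .
    next
      case False
      then have "\<not> coprime (a * L) q" for a by (simp add: L_def)
      then have "a * L mod q \<noteq> 1 mod q" for a
        by (metis coprime_1_left coprime_mod_left_iff q_pos neq0_conv)
      then show ?thesis using c(2)[of l] False chi_0_iff[of l] emb_zero_iff[of "c l"] by simp
    qed
    finally have "mcong l (rescoeff q (F ^ L)) (c l)" .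
    moreover have "rescoeff q (F ^ L) = (of_int (enorm J) * J) ^ ((L - 1) div 3)"
    proof (rule emb_inj)
      have "emb (rescoeff q (F ^ L)) = g ^ (3 * ((L - 1) div 3))"
      proof -
        have "L - 1 = 3 * ((L - 1) div 3)" using L3 by presburger
        then show ?thesis using Phipow1[OF L3] by metis
      qed
      also have "\<dots> = (g ^ 3) ^ ((L - 1) div 3)" by (rule power_mult)
      also have "g ^ 3 = emb (of_int (enorm J) * J)" using embJ q_pos by (simp add: normJ)
      finally show "emb (rescoeff q (F ^ L)) = emb ((of_int (enorm J) * J) ^ ((L - 1) div 3))"
          by simp
    qed
    ultimately show "\<exists>z\<in>insert 0 emu3. emb z = chi l \<and>
         mcong l z ((of_int (enorm J) * J) ^ ((l * l - 1) div 3))"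
      using c mcong_sym unfolding L_def by metis
  qed
qed

end

section \<open>Nontriviality of the cubic power map modulo a prime\<close>

lemma sum_mult_residues_pow:
  fixes g l :: nat
  assumes "coprime g l" "l > 0"
  shows "[g ^ j * (\<Sum>x<l. x ^ j) = (\<Sum>x<l. x ^ j)] (mod l)"
proof -
  have "g ^ j * (\<Sum>x<l. x ^ j) = (\<Sum>x<l. (g * x) ^ j)"
    by (simp add: sum_distrib_left power_mult_distrib)
  also have "[\<dots> = (\<Sum>x<l. (g * x mod l) ^ j)] (mod l)"
    by (intro cong_sum) (simp add: cong_def power_mod)
  also have "(\<Sum>x<l. (g * x mod l) ^ j) = (\<Sum>x<l. x ^ j)"
    by (rule sum_mult_residues[OF assms, where f = "\<lambda>x. x ^ j"])
  finally show ?thesis .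
qed

text \<open>Multiplying the residues by a primitive root \<open>g\<close> multiplies the sum by
  \<open>g ^ j\<close>, which is not 1 modulo \<open>l\<close> in this range of
  \<open>j\<close>.\<close>

lemma power_sum_residues:
  assumes l: "prime l" and j: "0 < j" "j < l - 1"
  shows "l dvd (\<Sum>x<l. x ^ j)"
proof -
  obtain g where g: "residue_primroot l g" using prime_primitive_root_exists[OF prime_gt_1_nat[OF
      l]] l by auto
  have cop: "coprime g l" and ord: "ord l g = l - 1"
    using g l by (auto simp: residue_primroot_def totient_prime coprime_commute)
  define S where "S = (\<Sum>x<l. x ^ j)"
  have c: "[g ^ j * S = 1 * S] (mod l)"
    using sum_mult_residues_pow[OF cop, of j] prime_gt_0_nat[OF l] by (simp add: S_def)
  have "\<not> [g ^ j = 1] (mod l)" using ord_minimal[of j l g] j ord by simp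
  then have "\<not> coprime S l" using c cong_mult_rcancel_nat by blast
  then show ?thesis unfolding S_def using l by (metis coprime_commute prime_imp_coprime_nat)
qed

lemma power_sum_residues_top:
  assumes l: "prime l"
  shows "[(\<Sum>x<l. x ^ (l - 1)) = l - 1] (mod l)"
proof -
  have l1: "l > 1" by (rule prime_gt_1_nat[OF l])
  have "{..<l} = insert 0 {1..<l}" using l1 by auto
  then have "(\<Sum>x<l. x ^ (l - 1)) = (\<Sum>x\<in>{1..<l}. x ^ (l - 1))" using l1 by simp
  also have "[\<dots> = (\<Sum>x\<in>{1..<l}. 1)] (mod l)"
  proof (intro cong_sum)
    fix x assume "x \<in> {1..<l}"
    then have "\<not> l dvd x" using dvd_imp_le by fastforce
    then show "[x ^ (l - 1) = 1] (mod l)" by (rule fermat_theorem[OF l])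
  qed
  also have "(\<Sum>x\<in>{1..<l}. 1) = l - 1" by simp
  finally show ?thesis .
qed

text \<open>The right side of the reciprocity congruence; the norm factor stems from
  \<open>g ^ 3 = q J\<close> with \<open>q = enorm J\<close>. For inert \<open>l\<close> this is the
  Euler power of \<open>enorm x * x\<close> in the residue field with \<open>l * l\<close> elements;
  the same formula serves for split \<open>l\<close>.\<close>

definition cubpow :: "nat \<Rightarrow> eis \<Rightarrow> eis" where
  "cubpow l x = (of_int (enorm x) * x) ^ ((l * l - 1) div 3)"

lemma cubpow_mult: "cubpow l (x * y) = cubpow l x * cubpow l y"
  by (simp add: cubpow_def enorm_mult power_mult_distrib [symmetric] mult_ac)

lemma mcong_of_int_iff: "mcong l (of_int a :: eis) (of_int b) \<longleftrightarrow> [a = b] (mod int l)"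
  by (simp add: mcong_eis_iff)

lemma cubpow_cong: "mcong l x y \<Longrightarrow> mcong l (cubpow l x) (cubpow l y)"
  unfolding cubpow_def by (intro mcong_power mcong_mult) (simp_all add: mcong_of_int_iff enorm_cong)

lemma fermat_int:
  assumes "prime l" "\<not> int l dvd a" shows "[a ^ (l - 1) = 1] (mod int l)"
proof -
  define b where "b = nat (a mod int l)"
  have l: "int l > 0" using prime_gt_0_nat[OF assms(1)] by simp
  have b: "int b = a mod int l" using l by (simp add: b_def)
  have "\<not> l dvd b"
  proof
    assume "l dvd b"
    then have "int l dvd a mod int l" using b by (metis of_nat_dvd_iff)
    then show False using assms(2) by (simp add: dvd_mod_iff)
  qed
  then have "[b ^ (l - 1) = 1] (mod l)" by (rule fermat_theorem[OF assms(1)])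
  then have "[int (b ^ (l - 1)) = int 1] (mod int l)" by (simp only: cong_int_iff)
  then show ?thesis using b by (simp add: cong_def power_mod)
qed

text \<open>Reduction of \<open>\<int>[\<omega>]\<close> modulo one of the two primes above \<open>l\<close>, for a root \<open>r\<close> of \<open>x\<^sup>2 + x + 1\<close> modulo \<open>l\<close>.\<close>

definition root_hom :: "int \<Rightarrow> eis \<Rightarrow> int" where "root_hom r x = ere x + eom x * r"

lemma root_hom_mult:
  assumes "l dvd r ^ 2 + r + 1"
  shows "[root_hom r (x * y) = root_hom r x * root_hom r y] (mod l)"
proof -
  have "root_hom r x * root_hom r y - root_hom r (x * y) = eom x * eom y * (r ^ 2 + r + 1)"
    by (simp add: root_hom_def algebra_simps power2_eq_square)
  then have "l dvd root_hom r x * root_hom r y - root_hom r (x * y)" using assms by simp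
  then show ?thesis by (simp add: cong_iff_dvd_diff dvd_diff_commute)
qed

lemma root_hom_power:
  assumes "l dvd r ^ 2 + r + 1"
  shows "[root_hom r (x ^ n) = root_hom r x ^ n] (mod l)"
proof (induction n)
  case (Suc n)
  have "[root_hom r (x * x ^ n) = root_hom r x * root_hom r (x ^ n)] (mod l)"
    by (rule root_hom_mult[OF assms])
  also have "[root_hom r x * root_hom r (x ^ n) = root_hom r x * root_hom r x ^ n] (mod l)"
    by (intro cong_mult cong_refl Suc)
  finally show ?case by simp
qed (simp add: root_hom_def)

text \<open>Modulo \<open>l\<close> the ring is a product of two prime fields, via the roots
  \<open>r\<close> and \<open>r ^ 2\<close> of the cyclotomic polynomial. The element
  \<open>u\<close> is built with images \<open>G\<close>, a primitive root, and 1, hence with norm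
  \<open>G\<close>. The images of \<open>cubpow l u\<close> are then \<open>G ^ (2 * m)\<close> and
  \<open>G ^ m\<close>, which are \<open>r\<close> and \<open>r ^ 2\<close>, the images of
  \<open>eomega\<close>.\<close>

lemma cubpow_nontrivial_split:
  assumes l: "prime l" "l mod 3 = 1"
  shows "\<exists>u. mcong l (cubpow l u) eomega"
proof -
  define n where "n = (l - 1) div 3"
  have l1: "l > 1" by (rule prime_gt_1_nat[OF l(1)])
  have n: "l - 1 = 3 * n" using l(2) unfolding n_def by presburger
  have n0: "n > 0" using n l1 by (cases n) auto
  obtain g where g: "residue_primroot l g" using prime_primitive_root_exists[OF l1] l by auto
  have ord: "ord l g = l - 1" and cop: "coprime l g"
    using g l by (auto simp: residue_primroot_def totient_prime)
  define G where "G = int g"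
  define r where "r = G ^ n"
  have pl: "prime (int l)" using l by simp
  have ndvd: "\<not> int l dvd G"
  proof
    assume "int l dvd G"
    then have "l dvd g" by (simp add: G_def)
    then have "is_unit l" using coprime_common_divisor[OF cop, of l] by simp
    then show False using l1 by simp
  qed
  have "[r ^ 3 = 1] (mod int l)"
    using fermat_int[OF l(1) ndvd] n by (simp add: r_def power_mult [symmetric] mult.commute)
  then have "int l dvd r ^ 3 - 1" by (simp add: cong_iff_dvd_diff)
  also have "r ^ 3 - 1 = (r - 1) * (r ^ 2 + r + 1)"
      by (simp add: power3_eq_cube power2_eq_square algebra_simps)
  finally have "int l dvd r - 1 \<or> int l dvd r ^ 2 + r + 1" using pl prime_dvd_multD by blast
  moreover have "\<not> int l dvd r - 1"
  proof
    assume "int l dvd r - 1"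
    then have "[int (g ^ n) = int 1] (mod int l)" by (simp add: r_def G_def cong_iff_dvd_diff)
    then have "[g ^ n = 1] (mod l)" by (simp only: cong_int_iff)
    moreover have "n < ord l g" using n n0 by (simp add: ord)
    ultimately show False using ord_minimal[of n l g] n0 by blast
  qed
  ultimately have r1: "int l dvd r ^ 2 + r + 1" by blast
  have "(r ^ 2) ^ 2 + r ^ 2 + 1 = (r ^ 2 + r + 1) * (r ^ 2 - r + 1)"
    by (simp add: power2_eq_square algebra_simps)
  then have r2: "int l dvd (r ^ 2) ^ 2 + r ^ 2 + 1" using r1 by simp
  have r3: "[r ^ 3 = 1] (mod int l)" by fact
  \<comment> \<open>The squared difference of the two roots is the discriminant -3, so the
    difference is invertible modulo \<open>l\<close>.\<close>
  have "int l dvd (r - r ^ 2) * (r - r ^ 2) + 3"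
  proof -
    have "(r - r ^ 2) * (r - r ^ 2) + 3 = (r ^ 2 + r + 1) * (r ^ 2 - 3 * r + 3)"
      by (simp add: power2_eq_square algebra_simps)
    then show ?thesis using r1 by simp
  qed
  moreover have "\<not> int l dvd 3"
  proof
    assume "int l dvd 3"
    then have "l dvd 3" by (metis of_nat_dvd_iff of_nat_numeral)
    then have "l \<le> 3" by (simp add: dvd_imp_le)
    then show False using l(2) l1 by presburger
  qed
  ultimately have nd: "\<not> int l dvd r - r ^ 2" by (metis dvd_add_right_iff dvd_mult)
  then have "coprime (r - r ^ 2) (int l)" using pl by (metis coprime_commute prime_imp_coprime)
  then obtain k where k: "[(r - r ^ 2) * k = 1] (mod int l)" using cong_solve_coprime_int by auto
  \<comment> \<open>Interpolation: \<open>ere u + eom u * r\<close> is to be \<open>G\<close> and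
    \<open>ere u + eom u * r ^ 2\<close> is to be 1, so \<open>eom u\<close> is \<open>G - 1\<close>
    divided by \<open>r - r ^ 2\<close>.\<close>
  define d where "d = (G - 1) * k"
  define u where "u = Eis (G - d * r) d"
  have phi1: "root_hom r u = G" by (simp add: root_hom_def u_def)
  have "root_hom (r ^ 2) u = G - (G - 1) * ((r - r ^ 2) * k)"
    by (simp add: root_hom_def u_def d_def algebra_simps)
  also have "[\<dots> = G - (G - 1) * 1] (mod int l)" by (intro cong_diff cong_mult cong_refl k)
  finally have phi2: "[root_hom (r ^ 2) u = 1] (mod int l)" by simp
  have "root_hom r u * root_hom (r ^ 2) u - enorm u =
      eom u ^ 2 * (r - 1) * (r ^ 2 + r + 1) + ere u * eom u * (r ^ 2 + r + 1)"
    by (simp add: root_hom_def enorm_def power2_eq_square algebra_simps)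
  then have "int l dvd root_hom r u * root_hom (r ^ 2) u - enorm u" using r1 by simp
  then have "[enorm u = root_hom r u * root_hom (r ^ 2) u] (mod int l)"
    by (simp add: cong_iff_dvd_diff dvd_diff_commute)
  also have "[root_hom r u * root_hom (r ^ 2) u = G * 1] (mod int l)" unfolding phi1
      by (intro cong_mult cong_refl phi2)
  finally have N: "[enorm u = G] (mod int l)" by simp
  define m where "m = (l * l - 1) div 3"
  have "l * l - 1 = 3 * (n * (l + 1))"
  proof -
    have "l * l - 1 = (l - 1) * (l + 1)" using l1 by (simp add: algebra_simps diff_mult_distrib)
    then show ?thesis using n by simp
  qed
  then have m: "m = n * (l + 1)" by (simp add: m_def)
  have l3: "l + 1 = 3 * n + 2" using n l1 by simp
  have Gm: "[G ^ m = r ^ 2] (mod int l)"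
  proof -
    have "G ^ m = (r ^ 3) ^ n * r ^ 2"
      unfolding m l3 r_def
      by (simp add: power_mult [symmetric] power_add [symmetric] algebra_simps)
    also have "[\<dots> = 1 ^ n * r ^ 2] (mod int l)" by (intro cong_mult cong_pow r3 cong_refl)
    finally show ?thesis by simp
  qed
  have hom: "[root_hom s (cubpow l u) = (enorm u * root_hom s u) ^ m] (mod int l)"
    if "int l dvd s ^ 2 + s + 1" for s
  proof -
    have "[root_hom s (cubpow l u) = root_hom s (of_int (enorm u) * u) ^ m] (mod int l)"
      unfolding cubpow_def m_def by (rule root_hom_power[OF that])
    also have "root_hom s (of_int (enorm u) * u) = enorm u * root_hom s u"
      by (simp add: root_hom_def algebra_simps)
    finally show ?thesis .
  qed
  have "[root_hom r (cubpow l u) = (enorm u * root_hom r u) ^ m] (mod int l)" by (rule hom[OF r1])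
  also have "[(enorm u * root_hom r u) ^ m = (G * G) ^ m] (mod int l)" unfolding phi1
      by (intro cong_pow cong_mult N cong_refl)
  also have "(G * G) ^ m = G ^ m * G ^ m" by (simp add: power_mult_distrib)
  also have "[\<dots> = r ^ 2 * r ^ 2] (mod int l)" by (intro cong_mult Gm)
  also have "r ^ 2 * r ^ 2 = r ^ 3 * r" by (simp add: power2_eq_square power3_eq_cube)
  also have "[\<dots> = 1 * r] (mod int l)" by (intro cong_mult r3 cong_refl)
  finally have A: "[root_hom r (cubpow l u) = r] (mod int l)" by simp
  have "[root_hom (r ^ 2) (cubpow l u) = (enorm u * root_hom (r ^ 2) u) ^ m] (mod int l)"
      by (rule hom[OF r2])
  also have "[(enorm u * root_hom (r ^ 2) u) ^ m = (G * 1) ^ m] (mod int l)"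
      by (intro cong_pow cong_mult N phi2)
  also have "(G * 1) ^ m = G ^ m" by simp
  also have "[\<dots> = r ^ 2] (mod int l)" by (rule Gm)
  finally have B: "[root_hom (r ^ 2) (cubpow l u) = r ^ 2] (mod int l)" .
  define z where "z = cubpow l u - eomega"
  have zA: "int l dvd ere z + eom z * r"
    using A by (simp add: z_def root_hom_def cong_iff_dvd_diff algebra_simps)
  have zB: "int l dvd ere z + eom z * r ^ 2"
    using B by (simp add: z_def root_hom_def cong_iff_dvd_diff algebra_simps)
  have "int l dvd eom z * (r - r ^ 2)" using dvd_diff[OF zA zB] by (simp add: algebra_simps)
  then have zb: "int l dvd eom z" using nd pl prime_dvd_multD by blast
  then have "int l dvd ere z" using zA by (metis dvd_add_left_iff dvd_mult2)
  then have "mcong l (cubpow l u) eomega" using zb by (simp add: mcong_def eis_dvd_iff z_def)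
  then show ?thesis by blast
qed

text \<open>Since \<open>a ^ 3 + b ^ 3 = (a + b) * enorm x\<close>, the cubes of \<open>a\<close>
  and \<open>- b\<close> agree modulo \<open>l\<close>. Cubing is injective because 3 does not
  divide \<open>l - 1\<close>, so \<open>a\<close> is congruent to \<open>- b\<close> and the norm
  to \<open>3 * b ^ 2\<close>.\<close>

lemma inert_enorm_dvd:
  assumes l: "prime l" "l mod 3 = 2" and d: "int l dvd enorm x"
  shows "of_nat l dvd x"
proof -
  have pl: "prime (int l)" using l by simp
  define a b where "a = ere x" and "b = eom x"
  have n: "int l dvd a ^ 2 - a * b + b ^ 2" using d by (simp add: enorm_def a_def b_def)
  have "int l dvd b"
  proof (rule ccontr)
    assume nb: "\<not> int l dvd b"
    have na: "\<not> int l dvd a"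
    proof
      assume "int l dvd a"
      then have "int l dvd a ^ 2 - a * b" by (simp add: power2_eq_square)
      then have "int l dvd b ^ 2" using n by (metis dvd_add_right_iff)
      then show False using nb pl prime_dvd_power by blast
    qed
    define j where "j = (l - 2) div 3"
    have "l \<ge> 2" by (rule prime_ge_2_nat[OF l(1)])
    then have j: "l - 1 = Suc (3 * j)" using l(2) unfolding j_def by presburger
    have "a ^ 3 - (- b) ^ 3 = (a + b) * (a ^ 2 - a * b + b ^ 2)"
      by (simp add: power2_eq_square power3_eq_cube algebra_simps)
    then have c3: "[a ^ 3 = (- b) ^ 3] (mod int l)" using n by (simp add: cong_iff_dvd_diff)
    \<comment> \<open>Injectivity of cubing made explicit: as \<open>l - 1 = 3 * j + 1\<close>,
      Fermat makes \<open>a\<close> the inverse of \<open>(a ^ 3) ^ j\<close>, and likewise for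
      \<open>- b\<close>.\<close>
    have "[a * ((- b) ^ 3) ^ j = a * (a ^ 3) ^ j] (mod int l)"
      by (intro cong_mult cong_refl cong_pow cong_sym[OF c3])
    also have "a * (a ^ 3) ^ j = a ^ (l - 1)" by (simp only: j power_Suc power_mult)
    also have "[\<dots> = 1] (mod int l)" by (rule fermat_int[OF l(1) na])
    also have "[1 = (- b) ^ (l - 1)] (mod int l)"
      by (rule cong_sym, rule fermat_int[OF l(1)]) (use nb in simp)
    also have "(- b) ^ (l - 1) = - b * ((- b) ^ 3) ^ j" by (simp only: j power_Suc power_mult)
    finally have "[a * ((- b) ^ 3) ^ j = - b * ((- b) ^ 3) ^ j] (mod int l)" .
    moreover have "coprime (((- b) ^ 3) ^ j) (int l)"
    proof -
      have "coprime (- b) (int l)" using nb prime_imp_coprime[OF pl, of b]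
          by (simp add: coprime_commute)
      then show ?thesis by simp
    qed
    ultimately have "[a = - b] (mod int l)" using cong_mult_rcancel by blast
    then have ab: "int l dvd a + b" by (simp add: cong_iff_dvd_diff)
    have "3 * b ^ 2 = (a ^ 2 - a * b + b ^ 2) - (a + b) * (a - 2 * b)"
      by (simp add: power2_eq_square algebra_simps)
    then have "int l dvd 3 * b ^ 2" using n ab by (metis dvd_diff dvd_mult2)
    then have "int l dvd 3 \<or> int l dvd b" using pl prime_dvd_multD prime_dvd_power by blast
    then have "int l dvd int 3" using nb by simp
    then have "l dvd 3" by (simp only: of_nat_dvd_iff)
    then have "l \<le> 3" by (simp add: dvd_imp_le)
    then have "l = 2" using l \<open>l \<ge> 2\<close> by (cases "l = 3") auto
    then show False using \<open>l dvd 3\<close> by simp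
  qed
  moreover have "int l dvd a"
  proof -
    have "int l dvd a * b - b ^ 2" using \<open>int l dvd b\<close> by (simp add: power2_eq_square)
    then have "int l dvd (a ^ 2 - a * b + b ^ 2) + (a * b - b ^ 2)" using n
        by (rule dvd_add[rotated])
    then have "int l dvd a ^ 2" by simp
    then show ?thesis using pl prime_dvd_power by blast
  qed
  ultimately show ?thesis by (simp add: eis_dvd_iff a_def b_def)
qed

lemma inert_no_zero_divisors:
  assumes l: "prime l" "l mod 3 = 2" and "of_nat l dvd x * (y :: eis)"
  shows "of_nat l dvd x \<or> of_nat l dvd y"
proof -
  have "int l dvd ere (x * y)" "int l dvd eom (x * y)" using assms(3)
      by (simp_all only: eis_dvd_iff)
  then have "int l dvd enorm (x * y)" unfolding enorm_def
      by (simp add: power2_eq_square del: eis_sel)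
  then have "int l dvd enorm x \<or> int l dvd enorm y" using l
      by (simp add: enorm_mult prime_dvd_mult_iff)
  then show ?thesis using inert_enorm_dvd[OF l] by blast
qed

text \<open>If \<open>x + \<omega>\<close> had trivial symbol for every integer \<open>x\<close>, then, Frobenius being conjugation, the \<open>M\<close>-th powers of
  \<open>x + \<omega>\<close> and \<open>x + \<omega>\<^sup>2\<close> would be congruent, where \<open>M = (l + 1) / 3\<close>. Multiply by the \<open>(l - M)\<close>-th power of \<open>x\<close> and
  sum over \<open>x\<close> modulo \<open>l\<close>: only the linear term of the binomial expansion survives.\<close>

lemma cubpow_nontrivial_inert:
  assumes l: "prime l" "l mod 3 = 2" "l > 3"
  shows "\<exists>u. mcong l (cubpow l u) eomega \<or> mcong l (cubpow l u) (eomega ^ 2)"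
proof (rule ccontr)
  assume contra: "\<not> ?thesis"
  define M where "M = (l + 1) div 3"
  have l1: "l > 1" using l by simp
  have M: "l + 1 = 3 * M" using l(2) unfolding M_def by presburger
  have m: "(l * l - 1) div 3 = (l - 1) * M"
  proof -
    have eq: "l * l - 1 = (l - 1) * (l + 1)" using l1 by (simp add: algebra_simps diff_mult_distrib)
    show ?thesis unfolding eq M by simp
  qed
  have M0: "M > 0" "M < l - 1" using M l by linarith+
  have om: "eomega ^ n = eomega ^ (n mod 3)" for n
  proof -
    have "eomega ^ (3 * (n div 3) + n mod 3) = eomega ^ (n mod 3)"
      by (simp only: power_add power_mult eomega_cube) simp
    then show ?thesis by simp
  qed
  have frob: "mcong l ((of_int a + of_int b * eomega) ^ l) (of_int a + of_int b
      * eomega ^ 2)" for a b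
  proof -
    have pw: "mcong l (of_int c ^ l) (of_int c :: eis)" for c
    proof (cases "int l dvd c")
      case True
      have "int l dvd c ^ l" using dvd_trans[OF True dvd_power[of l c]] l1 by simp
      then have "int l dvd c ^ l - c" using True by simp
      then show ?thesis by (simp add: mcong_of_int_iff cong_iff_dvd_diff flip: of_int_power)
    next
      case False
      have "[c * c ^ (l - 1) = c * 1] (mod int l)" by (intro cong_mult cong_refl fermat_int l False)
      moreover have "c * c ^ (l - 1) = c ^ l" using l1 by (cases l) auto
      ultimately show ?thesis by (simp add: mcong_of_int_iff flip: of_int_power)
    qed
    have "mcong l ((of_int a + of_int b * eomega) ^ l) (of_int a ^ l + (of_int b * eomega) ^ l)"
      by (rule freshman[OF l(1)])
    also have "mcong l \<dots> (of_int a + of_int b * eomega ^ l)"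
      unfolding power_mult_distrib by (intro mcong_add mcong_mult pw mcong_refl)
    also have "eomega ^ l = eomega ^ 2" using om[of l] l(2) by simp
    finally show ?thesis .
  qed
  have eis_eq: "y = of_int (ere y) + of_int (eom y) * eomega" for y :: eis
    by (rule eis_eqI) auto
  have frob2: "mcong l (y ^ (l * l)) y" for y :: eis
  proof -
    obtain a b where y: "y = of_int a + of_int b * eomega" using eis_eq by blast
    have bb: "of_int a + of_int b * eomega ^ 2 = of_int (a - b) + of_int (- b) * eomega"
      by (rule eis_eqI) (auto simp: power2_eq_square)
    have "mcong l (y ^ l) (of_int (a - b) + of_int (- b) * eomega)"
      using frob[of a b] unfolding bb y .
    then have "mcong l ((y ^ l) ^ l) ((of_int (a - b) + of_int (- b) * eomega) ^ l)"
        by (rule mcong_power)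
    also have "mcong l \<dots> (of_int (a - b) + of_int (- b) * eomega ^ 2)" by (rule frob)
    also have "of_int (a - b) + of_int (- b) * eomega ^ 2 = y"
      unfolding y by (rule eis_eqI) (auto simp: power2_eq_square)
    finally show ?thesis by (simp add: power_mult)
  qed
  have key: "mcong l ((of_nat x + eomega ^ 2) ^ M) ((of_nat x + eomega) ^ M)" for x :: nat
  proof -
    define u where "u = of_nat x + eomega"
    have nd: "\<not> of_nat l dvd u" using l1 by (simp add: u_def eis_dvd_iff)
    then have nN: "\<not> int l dvd enorm u" using inert_enorm_dvd[OF l(1,2)] by blast
    define y where "y = of_int (enorm u) * u"
    have ndy: "\<not> of_nat l dvd y"
    proof
      assume "of_nat l dvd y"
      then have "of_nat l dvd (of_int (enorm u) :: eis)"
        using inert_no_zero_divisors[OF l(1,2)] nd unfolding y_def by blast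
      then show False using nN by (simp add: eis_dvd_iff)
    qed
    have ll: "l * l = Suc (l * l - 1)" using l1 by simp
    have "y * (y ^ (l * l - 1) - 1) = y ^ (l * l) - y"
      by (subst (2) ll) (simp only: power_Suc right_diff_distrib mult_1_right)
    then have "of_nat l dvd y * (y ^ (l * l - 1) - 1)" using frob2[of y] by (simp only: mcong_def)
    then have "of_nat l dvd y ^ (l * l - 1) - 1" using inert_no_zero_divisors[OF l(1,2)] ndy
        by blast
    moreover have "y ^ (l * l - 1) = cubpow l u ^ 3"
    proof -
      have "l * l - 1 = 3 * ((l - 1) * M)"
      proof -
        have eq: "l * l - 1 = (l - 1) * (l + 1)" using l1
            by (simp add: algebra_simps diff_mult_distrib)
        show ?thesis unfolding eq M by simp
      qed
      then show ?thesis unfolding cubpow_def m y_def [symmetric] power_mult [symmetric]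
        by (simp only: mult.commute mult.left_commute)
    qed
    ultimately have "of_nat l dvd cubpow l u ^ 3 - 1" by simp
    also have "cubpow l u ^ 3 - 1 = (cubpow l u - 1) * ((cubpow l u - eomega)
        * (cubpow l u - eomega ^ 2))"
      by (rule eis_eqI) (auto simp: power2_eq_square power3_eq_cube algebra_simps)
    finally have "of_nat l dvd cubpow l u - 1 \<or> of_nat l dvd cubpow l u - eomega \<or> of_nat l dvd
        cubpow l u - eomega ^ 2"
      using inert_no_zero_divisors[OF l(1,2)] by blast
    then have J1: "mcong l (cubpow l u) 1" using contra by (auto simp: mcong_def)
    have "cubpow l u = of_int (enorm u) ^ ((l - 1) * M) * u ^ ((l - 1) * M)"
      unfolding cubpow_def m by (rule power_mult_distrib)
    moreover have "mcong l (of_int (enorm u) ^ ((l - 1) * M)) (1 :: eis)"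
    proof -
      have "[(enorm u ^ (l - 1)) ^ M = 1 ^ M] (mod int l)" by (intro cong_pow fermat_int l nN)
      then have "mcong l (of_int ((enorm u ^ (l - 1)) ^ M)) (of_int 1 :: eis)"
          by (simp only: mcong_of_int_iff power_one)
      then show ?thesis by (simp add: power_mult)
    qed
    ultimately have "mcong l (cubpow l u) (1 * u ^ ((l - 1) * M))"
      using mcong_mult[OF _ mcong_refl] by metis
    then have u1: "mcong l (u ^ ((l - 1) * M)) 1" using J1 mcong_sym mcong_trans by (metis mult_1)
    have "mcong l ((u ^ l) ^ M) ((of_nat x + eomega ^ 2) ^ M)"
      using frob[of "int x" 1] by (intro mcong_power) (simp add: u_def)
    then have "mcong l ((of_nat x + eomega ^ 2) ^ M) ((u ^ l) ^ M)" by (rule mcong_sym)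
    also have "(u ^ l) ^ M = u ^ ((l - 1) * M) * u ^ M"
    proof -
      have "l * M = (l - 1) * M + M" using l1 by (cases l) auto
      then show ?thesis by (simp only: power_mult [symmetric] power_add)
    qed
    also have "mcong l \<dots> (1 * u ^ M)" by (intro mcong_mult u1 mcong_refl)
    finally show ?thesis by (simp add: u_def)
  qed
  define C where "C i = of_nat (M choose i) * (eomega ^ i - (eomega ^ 2) ^ i)" for i
  have expand: "(\<Sum>x<l. of_nat x ^ (l - M) * ((of_nat x + eomega) ^ M - (of_nat x
      + eomega ^ 2) ^ M)) =
      (\<Sum>i\<le>M. C i * of_nat (\<Sum>x<l. x ^ (l - i)))"
  proof -
    have bin: "(of_nat x + w) ^ M = (\<Sum>i\<le>M. of_nat (M choose i) * w ^ i
        * of_nat x ^ (M - i))" for x and w :: eis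
      using binomial_ring[of w "of_nat x" M] by (simp add: add.commute)
    have "of_nat x ^ (l - M) * ((of_nat x + eomega) ^ M - (of_nat x + eomega ^ 2) ^ M)
        = (\<Sum>i\<le>M. C i * of_nat (x ^ (l - i)))" for x
    proof -
      have "of_nat x ^ (l - M) * ((of_nat x + eomega) ^ M - (of_nat x + eomega ^ 2) ^ M) =
         (\<Sum>i\<le>M. C i * (of_nat x ^ (l - M) * of_nat x ^ (M - i)))"
        unfolding bin sum_subtractf [symmetric] sum_distrib_left
        by (intro sum.cong refl) (simp add: C_def algebra_simps)
      also have "\<dots> = (\<Sum>i\<le>M. C i * of_nat (x ^ (l - i)))"
        using M0 by (intro sum.cong refl) (simp add: power_add [symmetric])
      finally show ?thesis .
    qed
    then have "(\<Sum>x<l. of_nat x ^ (l - M) * ((of_nat x + eomega) ^ M - (of_nat x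
        + eomega ^ 2) ^ M)) =
      (\<Sum>x<l. \<Sum>i\<le>M. C i * of_nat (x ^ (l - i)))" by simp
    also have "\<dots> = (\<Sum>i\<le>M. C i * of_nat (\<Sum>x<l. x ^ (l - i)))"
      by (subst sum.swap) (simp add: sum_distrib_left)
    finally show ?thesis .
  qed
  have "mcong l (\<Sum>x<l. of_nat x ^ (l - M) * ((of_nat x + eomega) ^ M - (of_nat x
      + eomega ^ 2) ^ M)) 0"
    unfolding mcong_def using key by (auto intro!: dvd_sum dvd_mult simp: mcong_def) (metis
        mcong_def mcong_sym)
  then have zero: "mcong l (\<Sum>i\<le>M. C i * of_nat (\<Sum>x<l. x ^ (l - i))) 0" by (simp only: expand)
  \<comment> \<open>The term \<open>i = 0\<close> vanishes because \<open>C 0 = 0\<close>. For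
    \<open>2 <= i <= M\<close> the exponent \<open>l - i\<close> lies strictly between 0 and
    \<open>l - 1\<close>, so the power sum is 0 modulo \<open>l\<close>. Only \<open>i = 1\<close>
    reaches the exponent \<open>l - 1\<close>.\<close>
  have "mcong l (\<Sum>i\<le>M. C i * of_nat (\<Sum>x<l. x ^ (l - i))) (\<Sum>i\<le>M. if i = 1 then C 1
      * of_nat (l - 1) else 0)"
  proof (intro mcong_sum)
    fix i assume "i \<in> {..M}"
    consider "i = 0" | "i = 1" | "i \<ge> 2" by linarith
    then show "mcong l (C i * of_nat (\<Sum>x<l. x ^ (l - i))) (if i = 1 then C 1
        * of_nat (l - 1) else 0)"
    proof cases
      case 2
      have "[int (\<Sum>x<l. x ^ (l - 1)) = int (l - 1)] (mod int l)"
        using power_sum_residues_top[OF l(1)] by (simp only: cong_int_iff)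
      then have "mcong l (of_nat (\<Sum>x<l. x ^ (l - 1))) (of_nat (l - 1) :: eis)"
        by (simp only: mcong_eis_iff eis_of_nat) simp
      then show ?thesis using 2 by (simp only: if_True simp_thms) (intro mcong_mult mcong_refl)
    next
      case 3
      then have "l dvd (\<Sum>x<l. x ^ (l - i))" using \<open>i \<in> {..M}\<close> M0
          by (intro power_sum_residues l) auto
      then have "of_nat l dvd (of_nat (\<Sum>x<l. x ^ (l - i)) :: eis)"
          by (auto elim!: dvdE simp del: of_nat_sum)
      then show ?thesis using 3 by (simp add: mcong_def del: of_nat_sum)
    qed (simp add: C_def)
  qed
  also have "(\<Sum>i\<le>M. if i = 1 then C 1 * of_nat (l - 1) else 0) = C 1 * of_nat (l - 1)"
    using M0 by simp
  finally have "mcong l (C 1 * of_nat (l - 1)) 0" using zero mcong_sym mcong_trans by blast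
  then have "int l dvd eom (C 1 * of_nat (l - 1))" by (simp only: mcong_def eis_dvd_iff diff_zero)
  \<comment> \<open>The second coordinate of \<open>eomega - eomega ^ 2\<close> is 2. The product is
    prime to \<open>l\<close> since \<open>l > 3\<close> and \<open>0 < M < l - 1\<close>, which is
    the contradiction.\<close>
  also have "eom (C 1 * of_nat (l - 1)) = int (2 * M * (l - 1))"
    by (simp add: C_def power2_eq_square)
  finally have "l dvd 2 * M * (l - 1)" by (simp only: of_nat_dvd_iff)
  then have "l dvd 2 \<or> l dvd M \<or> l dvd l - 1" using l(1)
      by (simp only: prime_dvd_mult_iff disj_assoc)
  then show False using M0 l l1 by (auto dest: dvd_imp_le)
qed

lemma cubpow_nontrivial:
  assumes "prime l" "l > 3"
  shows "\<exists>u. mcong l (cubpow l u) eomega \<or> mcong l (cubpow l u) (eomega ^ 2)"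
proof -
  have "l mod 3 \<noteq> 0" using assms primes_dvd_imp_eq[of 3 l] by (auto simp: mod_eq_0_iff_dvd)
  then consider "l mod 3 = 1" | "l mod 3 = 2" by linarith
  then show ?thesis using cubpow_nontrivial_split cubpow_nontrivial_inert assms by cases blast+
qed

text \<open>The value at \<open>l\<close> of a cubic character with Jacobi sum \<open>x\<close>. The second branch covers \<open>x\<close> that are not
  invertible modulo \<open>l\<close>.\<close>

definition cubsym :: "nat \<Rightarrow> eis \<Rightarrow> complex" where
  "cubsym l x = (if \<exists>z\<in>emu3. mcong l z (cubpow l x) then emb (THE z. z \<in> emu3
      \<and> mcong l z (cubpow l x)) else 0)"

lemma cubsym_eqI:
  assumes "l > 1" "z \<in> emu3" "mcong l z (cubpow l x)" shows "cubsym l x = emb z"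
proof -
  have "(THE z. z \<in> emu3 \<and> mcong l z (cubpow l x)) = z"
    using assms emu3_cong_unique[OF _ _ _ assms(1)] mcong_sym mcong_trans
        by (intro the_equality) blast+
  then show ?thesis using assms unfolding cubsym_def by auto
qed

lemma cubsym_eq_0I: "(\<And>z. z \<in> emu3 \<Longrightarrow> \<not> mcong l z (cubpow l x)) \<Longrightarrow> cubsym l x = 0"
  unfolding cubsym_def by auto

lemma cubsym_cases:
  assumes "l > 1"
  obtains z where "z \<in> emu3" "mcong l z (cubpow l x)" "cubsym l x = emb z"
  | "\<And>z. z \<in> emu3 \<Longrightarrow> \<not> mcong l z (cubpow l x)" "cubsym l x = 0"
  using cubsym_eqI[OF assms] cubsym_eq_0I by metis

lemma emb_emu3_cube: "z \<in> emu3 \<Longrightarrow> emb z ^ 3 = 1"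
  using arg_cong[OF emu3_cube, of z emb] by simp

lemma norm_emb_emu3: "z \<in> emu3 \<Longrightarrow> norm (emb z) = 1"
  using emb_emu3_cube[of z] norm_power[of "emb z" 3] power_eq_imp_eq_base[of "norm (emb z)" 3 1]
      by simp

lemma norm_cubsym_le: "l > 1 \<Longrightarrow> norm (cubsym l x) \<le> 1"
  by (rule cubsym_cases[of l x]) (auto simp: norm_emb_emu3)

lemma cubsym_cong:
  assumes "l > 1" "mcong l x y" shows "cubsym l x = cubsym l y"
proof (rule cubsym_cases[OF assms(1), of x])
  fix z assume z: "z \<in> emu3" "mcong l z (cubpow l x)" "cubsym l x = emb z"
  have "mcong l z (cubpow l y)" using z(2) cubpow_cong[OF assms(2)] by (rule mcong_trans)
  then show ?thesis using cubsym_eqI[OF assms(1) z(1)] z(3) by simp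
next
  assume n: "\<And>z. z \<in> emu3 \<Longrightarrow> \<not> mcong l z (cubpow l x)" "cubsym l x = 0"
  have "\<not> mcong l z (cubpow l y)" if "z \<in> emu3" for z
    using n(1)[OF that] mcong_trans[OF _ mcong_sym[OF cubpow_cong[OF assms(2)]]] by blast
  then show ?thesis using cubsym_eq_0I[of l y] n(2) by simp
qed

text \<open>The multiplier \<open>u\<close> has a cube root of unity as its symbol, and
  \<open>z0 ^ 2\<close> inverts \<open>z0\<close>; therefore multiplication by \<open>u\<close> also
  preserves the degenerate value 0.\<close>

lemma cubsym_mult:
  assumes l: "l > 1" and z0: "z0 \<in> emu3" "mcong l (cubpow l u) z0"
  shows "cubsym l (u * x) = emb z0 * cubsym l x"
proof (rule cubsym_cases[OF l, of x])
  fix z assume z: "z \<in> emu3" "mcong l z (cubpow l x)" "cubsym l x = emb z"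
  have "mcong l (z0 * z) (cubpow l (u * x))"
    unfolding cubpow_mult by (intro mcong_mult mcong_sym[OF z0(2)] z(2))
  then show ?thesis using cubsym_eqI[OF l emu3_mult[OF z0(1) z(1)]] z(3) by simp
next
  assume n: "\<And>z. z \<in> emu3 \<Longrightarrow> \<not> mcong l z (cubpow l x)" "cubsym l x = 0"
  have "\<not> mcong l z (cubpow l (u * x))" if z: "z \<in> emu3" for z
  proof
    assume "mcong l z (cubpow l (u * x))"
    then have "mcong l (z0 ^ 2 * z) (z0 ^ 2 * (cubpow l u * cubpow l x))"
      unfolding cubpow_mult by (intro mcong_mult mcong_refl)
    also have "mcong l (z0 ^ 2 * (cubpow l u * cubpow l x)) (z0 ^ 2 * (z0 * cubpow l x))"
      by (intro mcong_mult mcong_refl z0)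
    also have "z0 ^ 2 * (z0 * cubpow l x) = z0 ^ 3 * cubpow l x"
        by (simp add: power2_eq_square power3_eq_cube mult.assoc)
    also have "\<dots> = cubpow l x" using emu3_cube[OF z0(1)] by simp
    finally have "mcong l (z0 ^ 2 * z) (cubpow l x)" .
    moreover have "z0 ^ 2 * z \<in> emu3" unfolding power2_eq_square by (intro emu3_mult z z0)
    ultimately show False using n(1) by blast
  qed
  then show ?thesis using cubsym_eq_0I[of l "u * x"] n(2) by simp
qed

lemma sum_eis_residues_mult:
  fixes f :: "eis \<Rightarrow> complex"
  assumes l: "l > 0" and f: "\<And>x y. mcong l x y \<Longrightarrow> f x = f y" and uv: "mcong l (u * v) 1"
  shows "(\<Sum>a\<in>{0..<int l}. \<Sum>b\<in>{0..<int l}. f (u * Eis a b))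
      = (\<Sum>a\<in>{0..<int l}. \<Sum>b\<in>{0..<int l}. f (Eis a b))"
proof -
  define R where "R = {0..<int l} \<times> {0..<int l}"
  define s where "s = (\<lambda>(a, b). (ere (u * Eis a b) mod int l, eom (u * Eis a b) mod int l))"
  have cgs: "mcong l (case s ab of (c, d) \<Rightarrow> Eis c d) (case ab of (a, b) \<Rightarrow> u * Eis a b)" for ab
    by (cases ab) (auto simp: s_def mcong_eis_iff cong_def)
  have "s ` R \<subseteq> R" using l by (auto simp: s_def R_def)
  moreover have "inj_on s R"
  proof (rule inj_onI)
    fix p p' assume p: "p \<in> R" "p' \<in> R" "s p = s p'"
    obtain a b a' b' where ab: "p = (a, b)" "p' = (a', b')" by fastforce
    have "mcong l (u * Eis a b) (case s p of (c, d) \<Rightarrow> Eis c d)" using cgs[of p] ab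
        by (auto intro: mcong_sym)
    also have "mcong l (case s p of (c, d) \<Rightarrow> Eis c d) (u * Eis a' b')" using cgs[of p'] ab p by auto
    finally have "mcong l (u * Eis a b) (u * Eis a' b')" .
    then have "mcong l (v * (u * Eis a b)) (v * (u * Eis a' b'))"
        by (rule mcong_mult[OF mcong_refl])
    then have "mcong l ((u * v) * Eis a b) ((u * v) * Eis a' b')"
        by (simp only: mult.assoc mult.left_commute)
    moreover have "mcong l ((u * v) * x) x" for x using mcong_mult[OF uv mcong_refl[of l x]] by simp
    ultimately have "mcong l (Eis a b) (Eis a' b')" by (meson mcong_sym mcong_trans)
    then have "[a = a'] (mod int l)" "[b = b'] (mod int l)" by (auto simp: mcong_eis_iff)
    then show "p = p'" using p ab by (auto simp: R_def cong_def)
  qed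
  moreover have "finite R" by (simp add: R_def)
  ultimately have bij: "bij_betw s R R" by (simp add: bij_betw_def endo_inj_surj)
  have "(\<Sum>(a, b)\<in>R. f (u * Eis a b)) = (\<Sum>p\<in>R. case s p of (c, d) \<Rightarrow> f (Eis c d))"
  proof (intro sum.cong refl)
    fix p
    show "(case p of (a, b) \<Rightarrow> f (u * Eis a b)) = (case s p of (c, d) \<Rightarrow> f (Eis c d))"
      using f[OF cgs[of p]] by (cases "s p"; cases p) auto
  qed
  also have "\<dots> = (\<Sum>(c, d)\<in>R. f (Eis c d))"
    by (rule sum.reindex_bij_betw[OF bij, where g = "\<lambda>(c, d). f (Eis c d)"])
  finally show ?thesis by (simp add: R_def sum.cartesian_product)
qed

lemma emb_emu3_power_ne:
  assumes "z \<in> {eomega, eomega ^ 2}" "i mod 3 \<noteq> j mod 3"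
  shows "emb z ^ i * cnj (emb z) ^ j \<noteq> 1"
proof
  assume eq: "emb z ^ i * cnj (emb z) ^ j = 1"
  have z: "z \<in> emu3" using assms by (auto simp: emu3_def)
  have "emb z \<noteq> 1" using assms(1) by (auto simp: power2_eq_square omega_sq complex_eq_iff)
  have n1: "cnj (emb z) * emb z = 1" using complex_norm_square[of "emb z"] norm_emb_emu3[OF z]
      by (simp add: mult.commute)
  have red: "emb z ^ n = emb z ^ (n mod 3)" for n
  proof -
    have "emb z ^ (3 * (n div 3) + n mod 3) = emb z ^ (n mod 3)"
      by (simp only: power_add power_mult emb_emu3_cube[OF z]) simp
    then show ?thesis by simp
  qed
  have "emb z ^ j = emb z ^ i * cnj (emb z) ^ j * emb z ^ j" using eq by simp
  also have "\<dots> = emb z ^ i * (cnj (emb z) * emb z) ^ j" by (simp add: power_mult_distrib)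
  also have "\<dots> = emb z ^ i" by (simp add: n1)
  finally have "emb z ^ (j mod 3) = emb z ^ (i mod 3)" using red by metis
  moreover have "i mod 3 \<in> {0,1,2}" "j mod 3 \<in> {0,1,2}" by auto
  moreover have "emb z ^ 2 \<noteq> 1"
  proof
    assume "emb z ^ 2 = 1"
    then have "emb z ^ 3 = emb z" by (simp add: power3_eq_cube power2_eq_square)
    then show False using emb_emu3_cube[OF z] \<open>emb z \<noteq> 1\<close> by simp
  qed
  moreover have "emb z ^ 2 \<noteq> emb z"
    using \<open>emb z \<noteq> 1\<close> norm_emb_emu3[OF z] by (auto simp: power2_eq_square)
  ultimately show False using assms(2) \<open>emb z \<noteq> 1\<close> by auto
qed

text \<open>Multiplication by an element \<open>u\<close> of nontrivial symbol permutes the residues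
  modulo \<open>l\<close> and multiplies the summand by a constant other than 1. This mean-zero
  property is the arithmetic input to all moments over the box.\<close>

lemma sum_cubsym_zero:
  assumes l: "prime l" "l > 3" and ij: "i mod 3 \<noteq> j mod 3"
  shows "(\<Sum>a\<in>{0..<int l}. \<Sum>b\<in>{0..<int l}. cubsym l (Eis a b) ^ i * cnj (cubsym l (Eis a b)) ^ j)
      = 0"
proof -
  have l1: "l > 1" using l by simp
  obtain u z0 where u: "mcong l (cubpow l u) z0" "z0 \<in> {eomega, eomega ^ 2}"
    using cubpow_nontrivial[OF l] by auto
  then have z0: "z0 \<in> emu3" by (auto simp: emu3_def)
  define m where "m = (l * l - 1) div 3 - 1"
  have "l * l \<ge> 4 * 4" using l by (intro mult_mono) auto
  then have m: "(l * l - 1) div 3 = Suc m" by (simp add: m_def)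
  \<comment> \<open>The inverse of \<open>u\<close> modulo \<open>l\<close>: the power
    \<open>cubpow l u\<close> contains a factor \<open>u\<close>, and \<open>z0 ^ 2\<close> cancels
    its value \<open>z0\<close>.\<close>
  define v where "v = of_int (enorm u) * (of_int (enorm u) * u) ^ m * z0 ^ 2"
  have "u * v = cubpow l u * z0 ^ 2" unfolding v_def cubpow_def m by (simp add: mult_ac)
  also have "mcong l \<dots> (z0 * z0 ^ 2)" by (intro mcong_mult u mcong_refl)
  also have "z0 * z0 ^ 2 = 1" using emu3_cube[OF z0]
      by (simp add: power2_eq_square power3_eq_cube mult.assoc)
  finally have uv: "mcong l (u * v) 1" .
  define f where "f x = cubsym l x ^ i * cnj (cubsym l x) ^ j" for x
  define S where "S = (\<Sum>a\<in>{0..<int l}. \<Sum>b\<in>{0..<int l}. f (Eis a b))"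
  define c where "c = emb z0 ^ i * cnj (emb z0) ^ j"
  have "f (u * x) = c * f x" for x
    unfolding f_def c_def cubsym_mult[OF l1 z0 u(1)] by (simp add: power_mult_distrib mult_ac)
  then have "c * S = (\<Sum>a\<in>{0..<int l}. \<Sum>b\<in>{0..<int l}. f (u * Eis a b))"
    by (simp add: S_def sum_distrib_left)
  also have "\<dots> = S" unfolding S_def
    by (rule sum_eis_residues_mult[OF _ _ uv]) (use l cubsym_cong[OF l1] in \<open>auto simp: f_def\<close>)
  finally have "(c - 1) * S = 0" by (simp add: algebra_simps)
  moreover have "c \<noteq> 1" unfolding c_def by (rule emb_emu3_power_ne[OF u(2) ij])
  ultimately show ?thesis by (simp add: S_def f_def)
qed

section \<open>Passage from characters to Jacobi sums\<close>

lemma multiplicative_eq_off_3: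
  fixes f g :: "nat \<Rightarrow> complex"
  assumes f: "f 1 = 1" "\<And>m n. f (m * n) = f m * f n" and g: "g 1 = 1" "\<And>m n. g (m * n) = g m * g n"
    and eq: "\<And>l. prime l \<Longrightarrow> l \<noteq> 3 \<Longrightarrow> f l = g l"
  shows "n > 0 \<Longrightarrow> \<not> 3 dvd n \<Longrightarrow> f n = g n"
proof (induction n rule: less_induct)
  case (less n)
  show ?case
  proof (cases "n = 1")
    case False
    then obtain p where p: "prime p" "p dvd n" using prime_factor_nat by blast
    then obtain k where k: "n = p * k" by (elim dvdE)
    have "k > 0" "k < n" using k less.prems prime_gt_1_nat[OF p(1)] by auto
    moreover have "\<not> 3 dvd k" "p \<noteq> 3" using less.prems k by auto
    ultimately show ?thesis using less.IH[of k] eq[OF p(1)] by (simp add: k f g)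
  qed (use f g in simp)
qed

lemma F3_eis:
  assumes "chi \<in> F3 Q"
  shows "\<exists>J q. real q \<le> Q \<and> coprime q 3 \<and> primitive_character q chi \<and> cubic_character q chi
      \<and> enorm J = int q \<and>
    (\<forall>l. prime l \<and> l \<noteq> 3 \<longrightarrow> chi l = cubsym l J)"
proof -
  obtain q where q: "real q \<le> Q" "coprime q 3" "primitive_character q chi" "cubic_character q chi"
    using assms by (auto simp: F3_def)
  interpret cubic_primitive q chi by standard (use q in auto)
  obtain J where J: "enorm J = int q"
    "\<And>l. prime l \<Longrightarrow> l \<noteq> 3 \<Longrightarrow> \<exists>z\<in>insert 0 emu3. emb z = chi l \<and>
         mcong l z ((of_int (enorm J) * J) ^ ((l * l - 1) div 3))"
    using jacobi_sum_reciprocity by blast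
  have "chi l = cubsym l J" if l: "prime l" "l \<noteq> 3" for l
  proof -
    have l1: "l > 1" by (rule prime_gt_1_nat[OF l(1)])
    obtain z where z: "z \<in> insert 0 emu3" "emb z = chi l" "mcong l z (cubpow l J)"
      using J(2)[OF l] unfolding cubpow_def by blast
    show ?thesis
    proof (cases "z = 0")
      case True
      then have "\<not> mcong l z' (cubpow l J)" if "z' \<in> emu3" for z'
        using emu3_not_cong_0[OF that l1] z(3) mcong_sym mcong_trans by blast
      then show ?thesis using cubsym_eq_0I[of l J] z(2) True by auto
    next
      case False
      then show ?thesis using cubsym_eqI[OF l1 _ z(3)] z by auto
    qed
  qed
  then show ?thesis using q J(1) by blast
qed

text \<open>Reciprocity is silent about the prime 3. If 3 divides \<open>n\<close>, then
  \<open>n + q\<close> is prime to 3 and has the same character value; this is where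
  \<open>coprime q 3\<close> enters.\<close>

lemma F3_eis_inj:
  assumes "enorm J = int q" "coprime q 3"
    and c: "primitive_character q chi" "cubic_character q chi" "\<And>l. prime l \<Longrightarrow> l \<noteq> 3 \<Longrightarrow> chi l
        = cubsym l J"
    and c': "primitive_character q chi'" "cubic_character q chi'" "\<And>l. prime l \<Longrightarrow> l \<noteq> 3 \<Longrightarrow> chi' l
        = cubsym l J"
  shows "chi = chi'"
proof
  interpret A: cubic_primitive q chi by standard (use c in auto)
  interpret B: cubic_primitive q chi' by standard (use c' in auto)
  have eq: "chi n = chi' n" if "n > 0" "\<not> 3 dvd n" for n
    by (rule multiplicative_eq_off_3[OF A.chi_1 A.chi_mult B.chi_1 B.chi_mult _ that]) (simp add:
        c c')
  fix n
  have q3: "\<not> 3 dvd q"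
  proof
    assume "3 dvd q"
    then have "is_unit (3::nat)" using coprime_common_divisor[OF assms(2), of 3] by simp
    then show False by simp
  qed
  define n' where "n' = (if 3 dvd n then n + q else n)"
  have "\<not> 3 dvd n'" using q3 by (auto simp: n'_def dvd_add_right_iff)
  moreover from this have "n' > 0" by (cases n') auto
  ultimately have "chi n' = chi' n'" by (rule eq[rotated])
  moreover have "[n' = n] (mod q)" by (auto simp: n'_def cong_def)
  ultimately show "chi n = chi' n"
    using dirichlet_character_cong[OF A.dc] dirichlet_character_cong[OF B.dc] by metis
qed

definition sqbox :: "nat \<Rightarrow> int set" where "sqbox X = {- int X..<int X}"

lemma enorm_le_imp_box:
  assumes "real_of_int (enorm J) \<le> Q" "real X > 2 * sqrt Q"
  shows "ere J \<in> sqbox X" "eom J \<in> sqbox X"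
proof -
  define a b where "a = real_of_int (ere J)" and "b = real_of_int (eom J)"
  have N: "a ^ 2 - a * b + b ^ 2 \<le> Q" using assms(1) by (simp add: enorm_def a_def b_def)
  have *: "x ^ 2 \<le> 4 * Q" if "x ^ 2 - x * y + y ^ 2 \<le> Q" for x y :: real
  proof -
    have "3 * x ^ 2 = 4 * (x ^ 2 - x * y + y ^ 2) - (2 * y - x) ^ 2"
      by (simp add: power2_eq_square algebra_simps)
    also have "\<dots> \<le> 4 * Q - 0" by (intro diff_mono) (use that in auto)
    finally show ?thesis using zero_le_power2[of x] by linarith
  qed
  have ab: "a ^ 2 \<le> 4 * Q" "b ^ 2 \<le> 4 * Q"
    using *[of a b] *[of b a] N by (simp_all add: algebra_simps)
  have s: "2 * sqrt Q = sqrt (4 * Q)" by (simp add: real_sqrt_mult)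
  have "\<bar>a\<bar> \<le> 2 * sqrt Q" "\<bar>b\<bar> \<le> 2 * sqrt Q" unfolding s using ab by (simp_all add: real_le_rsqrt)
  then have "\<bar>a\<bar> < real X" "\<bar>b\<bar> < real X" using assms(2) by linarith+
  then have "\<bar>ere J\<bar> < int X" "\<bar>eom J\<bar> < int X" unfolding a_def b_def by linarith+
  then show "ere J \<in> sqbox X" "eom J \<in> sqbox X" by (auto simp: sqbox_def)
qed

text \<open>Positivity: the map from characters to Jacobi sums is injective, its image need not be known.\<close>

theorem F3_sum_le_box_sum:
  fixes g :: "(nat \<Rightarrow> complex) \<Rightarrow> real" and G :: "eis \<Rightarrow> real"
  assumes X: "real X > 2 * sqrt Q" and G: "\<And>x. G x \<ge> 0"
    and g: "\<And>chi J. chi \<in> F3 Q \<Longrightarrow> (\<And>l. prime l \<Longrightarrow> l \<noteq> 3 \<Longrightarrow> chi l = cubsym l J) \<Longrightarrow> g chi \<le> G J"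
  shows "(\<Sum>chi\<in>F3 Q. g chi) \<le> (\<Sum>a\<in>sqbox X. \<Sum>b\<in>sqbox X. G (Eis a b))"
proof -
  have "\<forall>chi\<in>F3 Q. \<exists>J. \<exists>q. real q \<le> Q \<and> coprime q 3 \<and> primitive_character q chi
      \<and> cubic_character q chi \<and> enorm J = int q \<and>
    (\<forall>l. prime l \<and> l \<noteq> 3 \<longrightarrow> chi l = cubsym l J)" using F3_eis by blast
  then obtain J where J: "\<forall>chi\<in>F3 Q. \<exists>q. real q \<le> Q \<and> coprime q 3 \<and> primitive_character q chi
      \<and> cubic_character q chi \<and> enorm (J chi) = int q \<and>
    (\<forall>l. prime l \<and> l \<noteq> 3 \<longrightarrow> chi l = cubsym l (J chi))" by (rule bchoice [THEN exE])
  have inj: "inj_on J (F3 Q)"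
  proof (rule inj_onI)
    fix chi chi' assume *: "chi \<in> F3 Q" "chi' \<in> F3 Q" "J chi = J chi'"
    obtain q where q: "coprime q 3" "primitive_character q chi" "cubic_character q chi" "enorm (J
        chi) = int q"
      "\<forall>l. prime l \<and> l \<noteq> 3 \<longrightarrow> chi l = cubsym l (J chi)" using J * by blast
    obtain q' where q': "primitive_character q' chi'" "cubic_character q' chi'" "enorm (J chi')
        = int q'"
      "\<forall>l. prime l \<and> l \<noteq> 3 \<longrightarrow> chi' l = cubsym l (J chi')" using J * by blast
    have "q' = q" using q q' * by simp
    then show "chi = chi'" using F3_eis_inj[of "J chi" q chi chi'] q q' * by metis
  qed
  define B where "B = (\<lambda>(a, b). Eis a b) ` (sqbox X \<times> sqbox X)"
  have fB: "finite B" by (simp add: B_def sqbox_def)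
  have "(\<Sum>chi\<in>F3 Q. g chi) \<le> (\<Sum>chi\<in>F3 Q. G (J chi))"
    using J by (intro sum_mono g) blast+
  also have "\<dots> = (\<Sum>x\<in>J ` F3 Q. G x)" using inj by (simp add: sum.reindex)
  also have "\<dots> \<le> (\<Sum>x\<in>B. G x)"
  proof (intro sum_mono2 fB G)
    show "J ` F3 Q \<subseteq> B"
    proof
      fix x assume "x \<in> J ` F3 Q"
      then obtain chi where chi: "chi \<in> F3 Q" "x = J chi" by blast
      then obtain q where "real q \<le> Q" "enorm x = int q" using J by blast
      then have "real_of_int (enorm x) \<le> Q" by simp
      from enorm_le_imp_box[OF this X] show "x \<in> B" unfolding B_def
        by (intro image_eqI[of _ _ "(ere x, eom x)"]) auto
    qed
  qed
  also have "\<dots> = (\<Sum>(a, b)\<in>sqbox X \<times> sqbox X. G (Eis a b))"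
    unfolding B_def by (subst sum.reindex) (auto simp: inj_on_def case_prod_unfold)
  also have "\<dots> = (\<Sum>a\<in>sqbox X. \<Sum>b\<in>sqbox X. G (Eis a b))" by (simp add: sum.cartesian_product)
  finally show ?thesis .
qed

section \<open>Moments over a box of Eisenstein integers\<close>

lemma sum_periodic_bound:
  fixes f :: "int \<Rightarrow> complex"
  assumes d: "d > 0" and per: "\<And>x. f (x + int d) = f x" and bd: "\<And>x. norm (f x) \<le> M"
  shows "norm ((\<Sum>x\<in>{A..<A + int n}. f x) - of_nat (n div d) * (\<Sum>x\<in>{0..<int d}. f x)) \<le> real d * M"
proof -
  have perk: "f (x + int k * int d) = f x" for x k
  proof (induction k)
    case (Suc k)
    then show ?case using per[of "x + int k * int d"] by (simp add: algebra_simps)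
  qed simp
  have shift: "(\<Sum>x\<in>{a..<a + int m}. f x) = (\<Sum>k<m. f (a + int k))" for a m
    by (rule sum.reindex_bij_witness[of _ "\<lambda>k. a + int k" "\<lambda>x. nat (x - a)"]) auto
  have full: "(\<Sum>k<d. f (a + int k)) = (\<Sum>k<d. f (int k))" for a
  proof -
    have one: "(\<Sum>k<d. f (a + 1 + int k)) = (\<Sum>k<d. f (a + int k))" for a
    proof -
      have "(\<Sum>k<d. f (a + 1 + int k)) + f a = (\<Sum>k<Suc d. f (a + int k))"
        by (subst sum.lessThan_Suc_shift) (simp add: algebra_simps)
      also have "\<dots> = (\<Sum>k<d. f (a + int k)) + f a" using per[of a] by simp
      finally show ?thesis by simp
    qed
    have up: "(\<Sum>k<d. f (a + int j + int k)) = (\<Sum>k<d. f (a + int k))" for a j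
    proof (induction j)
      case (Suc j)
      then show ?case using one[of "a + int j"] by (simp add: algebra_simps)
    qed simp
    show ?thesis
    proof (cases "a \<ge> 0")
      case True
      then show ?thesis using up[of 0 "nat a"] by simp
    next
      case False
      then show ?thesis using up[of a "nat (- a)"] by simp
    qed
  qed
  have split: "(\<Sum>k<p + r. f (a + int k)) = (\<Sum>k<p. f (a + int k)) + (\<Sum>k<r. f (a + int p
      + int k))" for a p r
    by (induction r) (simp_all add: add_ac)
  have blocks: "(\<Sum>k<m * d. f (a + int k)) = of_nat m * (\<Sum>k<d. f (int k))" for a m
  proof (induction m)
    case (Suc m)
    have "(\<Sum>k<Suc m * d. f (a + int k)) = (\<Sum>k<m * d + d. f (a + int k))" by (simp add: add.commute)
    also have "\<dots> = of_nat m * (\<Sum>k<d. f (int k)) + (\<Sum>k<d. f (int k))"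
      unfolding split Suc full ..
    finally show ?case by (simp add: algebra_simps)
  qed simp
  define m where "m = n div d"
  have n: "n = m * d + n mod d" by (simp add: m_def)
  have "(\<Sum>x\<in>{A..<A + int n}. f x) = (\<Sum>k<m * d + n mod d. f (A + int k))"
    using shift n by simp
  also have "\<dots> = of_nat m * (\<Sum>k<d. f (int k)) + (\<Sum>k<n mod d. f (A + int (m * d) + int k))"
    unfolding split blocks ..
  also have "(\<Sum>k<d. f (int k)) = (\<Sum>x\<in>{0..<int d}. f x)" using shift[of 0 d] by simp
  finally have "(\<Sum>x\<in>{A..<A + int n}. f x) - of_nat (n div d) * (\<Sum>x\<in>{0..<int d}. f x) =
      (\<Sum>k<n mod d. f (A + int (m * d) + int k))" by (simp add: m_def)
  also have "norm \<dots> \<le> (\<Sum>k<n mod d. M)" by (intro order_trans[OF norm_sum] sum_mono bd)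
  also have "\<dots> = real (n mod d) * M" by simp
  also have "\<dots> \<le> real d * M"
    using d order_trans[OF norm_ge_zero bd[of 0]]
        by (intro mult_right_mono) (auto intro: less_imp_le)
  finally show ?thesis .
qed

text \<open>Completing first in \<open>x\<close> and then in \<open>y\<close> leaves errors of size
  side times period. The mean vanishes only over the two-dimensional period, so neither coordinate
  can be treated alone.\<close>

lemma box_sum_periodic_bound:
  fixes f :: "int \<Rightarrow> int \<Rightarrow> complex"
  assumes d: "d > 0" and per: "\<And>x y. f (x + int d) y = f x y" "\<And>x y. f x (y + int d) = f x y"
    and bd: "\<And>x y. norm (f x y) \<le> 1"
    and zero: "(\<Sum>x\<in>{0..<int d}. \<Sum>y\<in>{0..<int d}. f x y) = 0"
  shows "norm (\<Sum>x\<in>sqbox X. \<Sum>y\<in>sqbox X. f x y) \<le> 2 * real (2 * X) * real d"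
proof -
  define Y where "Y = 2 * X"
  have sqbox: "sqbox X = {- int X..<- int X + int Y}" by (simp add: sqbox_def Y_def)
  have cardb: "card (sqbox X) = Y" by (simp add: sqbox_def Y_def)
  define h where "h x = (\<Sum>y\<in>sqbox X. f x y)" for x
  have bh: "norm (h x) \<le> real Y" for x
  proof -
    have "norm (h x) \<le> (\<Sum>y\<in>sqbox X. 1)" unfolding h_def
        by (intro order_trans[OF norm_sum] sum_mono bd)
    then show ?thesis by (simp add: cardb)
  qed
  have 1: "norm ((\<Sum>x\<in>sqbox X. h x) - of_nat (Y div d) * (\<Sum>x\<in>{0..<int d}. h x)) \<le> real d * real Y"
    unfolding sqbox by (rule sum_periodic_bound[OF d _ bh]) (simp add: h_def per)
  define k where "k y = (\<Sum>x\<in>{0..<int d}. f x y)" for y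
  have bk: "norm (k y) \<le> real d" for y
  proof -
    have "norm (k y) \<le> (\<Sum>x\<in>{0..<int d}. 1)" unfolding k_def
        by (intro order_trans[OF norm_sum] sum_mono bd)
    then show ?thesis by simp
  qed
  have k0: "(\<Sum>y\<in>{0..<int d}. k y) = 0" unfolding k_def using zero by (subst sum.swap) simp
  have "norm ((\<Sum>y\<in>sqbox X. k y) - of_nat (Y div d) * (\<Sum>y\<in>{0..<int d}. k y)) \<le> real d * real d"
    unfolding sqbox by (rule sum_periodic_bound[OF d _ bk]) (simp add: k_def per)
  then have "norm (\<Sum>y\<in>sqbox X. k y) \<le> real d * real d" by (simp add: k0)
  moreover have "(\<Sum>x\<in>{0..<int d}. h x) = (\<Sum>y\<in>sqbox X. k y)" unfolding h_def k_def by (rule sum.swap)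
  ultimately have 2: "norm (\<Sum>x\<in>{0..<int d}. h x) \<le> real d * real d" by simp
  have "norm (\<Sum>x\<in>sqbox X. h x) \<le> norm ((\<Sum>x\<in>sqbox X. h x) - of_nat (Y div d) * (\<Sum>x\<in>{0..<int d}. h x))
     + norm (of_nat (Y div d) * (\<Sum>x\<in>{0..<int d}. h x))" by (metis norm_triangle_sub add.commute)
  also have "\<dots> \<le> real d * real Y + real (Y div d) * (real d * real d)"
    using 1 2 by (intro add_mono) (auto simp: norm_mult intro: mult_left_mono)
  also have "real (Y div d) * (real d * real d) = real (Y div d * d) * real d" by simp
  also have "\<dots> \<le> real Y * real d" by (intro mult_right_mono of_nat_mono
      div_times_less_eq_dividend) auto
  finally show ?thesis by (simp add: h_def Y_def)
qed

lemma sum_mod_product: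
  fixes g h :: "int \<Rightarrow> complex"
  assumes co: "coprime m n" "m > 0" "n > 0"
    and per: "\<And>x. g (x mod int m) = g x" "\<And>x. h (x mod int n) = h x"
  shows "(\<Sum>x\<in>{0..<int (m * n)}. g x * h x) = (\<Sum>x\<in>{0..<int m}. g x) * (\<Sum>x\<in>{0..<int n}. h x)"
proof -
  define s where "s x = (x mod int m, x mod int n)" for x
  define R where "R = {0..<int m} \<times> {0..<int n}"
  have inj: "inj_on s {0..<int (m * n)}"
  proof (rule inj_onI)
    fix x y assume xy: "x \<in> {0..<int (m * n)}" "y \<in> {0..<int (m * n)}" "s x = s y"
    then have "[x = y] (mod int m)" "[x = y] (mod int n)" by (auto simp: s_def cong_def)
    moreover have "coprime (int m) (int n)" using co by simp
    ultimately have "[x = y] (mod (int m * int n))" by (rule coprime_cong_mult)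
    then show "x = y" using xy by (simp add: cong_def)
  qed
  have "s ` {0..<int (m * n)} \<subseteq> R" using co by (auto simp: s_def R_def)
  moreover have "card (s ` {0..<int (m * n)}) = card R"
    using inj by (simp add: card_image R_def card_cartesian_product nat_mult_distrib)
  ultimately have "s ` {0..<int (m * n)} = R" by (intro card_subset_eq) (auto simp: R_def)
  with inj have bij: "bij_betw s {0..<int (m * n)} R" by (simp add: bij_betw_def)
  have "(\<Sum>x\<in>{0..<int (m * n)}. g x * h x) = (\<Sum>x\<in>{0..<int (m * n)}. (\<lambda>(a, b). g a * h b) (s x))"
    by (simp add: s_def per)
  also have "\<dots> = (\<Sum>(a, b)\<in>R. g a * h b)" by (rule sum.reindex_bij_betw[OF bij])
  also have "\<dots> = (\<Sum>x\<in>{0..<int m}. g x) * (\<Sum>x\<in>{0..<int n}. h x)"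
    by (simp add: R_def sum.cartesian_product [symmetric] sum_product)
  finally show ?thesis .
qed

lemma box_sum_mod_product:
  fixes g h :: "int \<Rightarrow> int \<Rightarrow> complex"
  assumes co: "coprime m n" "m > 0" "n > 0"
    and per: "\<And>x y. g (x mod int m) y = g x y" "\<And>x y. g x (y mod int m) = g x y"
     "\<And>x y. h (x mod int n) y = h x y" "\<And>x y. h x (y mod int n) = h x y"
  shows "(\<Sum>x\<in>{0..<int (m * n)}. \<Sum>y\<in>{0..<int (m * n)}. g x y * h x y) =
    (\<Sum>x\<in>{0..<int m}. \<Sum>y\<in>{0..<int m}. g x y) * (\<Sum>x\<in>{0..<int n}. \<Sum>y\<in>{0..<int n}. h x y)"
proof -
  have "(\<Sum>y\<in>{0..<int (m * n)}. g x y * h x y) = (\<Sum>y\<in>{0..<int m}. g x y)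
      * (\<Sum>y\<in>{0..<int n}. h x y)" for x
    by (rule sum_mod_product[OF co]) (simp_all add: per)
  then show ?thesis
    by (simp only:) (rule sum_mod_product[OF co]; simp add: per)
qed

lemma cubsym_Eis_mod:
  assumes "l > 1"
  shows "cubsym l (Eis (a mod int l) b) = cubsym l (Eis a b)" "cubsym l (Eis a (b mod int l))
      = cubsym l (Eis a b)"
  by (rule cubsym_cong[OF assms]; simp add: mcong_eis_iff)+

definition cubsym_prod :: "nat set \<Rightarrow> (nat \<Rightarrow> nat) \<Rightarrow> (nat \<Rightarrow> nat) \<Rightarrow> eis \<Rightarrow> complex" where
  "cubsym_prod T i j x = (\<Prod>l\<in>T. cubsym l x ^ i l * cnj (cubsym l x) ^ j l)"

lemma cubsym_prod_mod:
  assumes T: "finite T" "\<And>l. l \<in> T \<Longrightarrow> prime l"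
  shows "cubsym_prod T i j (Eis (a mod int (\<Prod>T)) b) = cubsym_prod T i j (Eis a b)"
    "cubsym_prod T i j (Eis a (b mod int (\<Prod>T))) = cubsym_prod T i j (Eis a b)"
proof -
  have "cubsym l (Eis (a mod int (\<Prod>T)) b) = cubsym l (Eis a b)" "cubsym l (Eis a (b mod int (\<Prod>T)))
      = cubsym l (Eis a b)"
    if "l \<in> T" for l
  proof -
    have l1: "l > 1" using T(2)[OF that] by (rule prime_gt_1_nat)
    have "l dvd \<Prod>T" using dvd_prodI[OF T(1) that, of "\<lambda>x. x"] by simp
    then have "int l dvd int (\<Prod>T)" by (simp only: of_nat_dvd_iff)
    then show "cubsym l (Eis (a mod int (\<Prod>T)) b)
        = cubsym l (Eis a b)" "cubsym l (Eis a (b mod int (\<Prod>T))) = cubsym l (Eis a b)"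
      by (intro cubsym_cong[OF l1]; simp add: mcong_eis_iff cong_def mod_mod_cancel)+
  qed
  then show "cubsym_prod T i j (Eis (a mod int (\<Prod>T)) b) = cubsym_prod T i j (Eis a b)"
    "cubsym_prod T i j (Eis a (b mod int (\<Prod>T))) = cubsym_prod T i j (Eis a b)"
    by (simp_all add: cubsym_prod_def)
qed

lemma norm_cubsym_prod_le:
  assumes "\<And>l. l \<in> T \<Longrightarrow> prime l"
  shows "norm (cubsym_prod T i j x) \<le> 1"
proof -
  have "norm (cubsym l x ^ i l * cnj (cubsym l x) ^ j l) \<le> 1" if "l \<in> T" for l
  proof -
    have "norm (cubsym l x) \<le> 1" using norm_cubsym_le prime_gt_1_nat assms that by blast
    then show ?thesis by (simp add: norm_mult norm_power mult_le_one power_le_one)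
  qed
  then show ?thesis unfolding cubsym_prod_def prod_norm [symmetric] by (intro prod_le_1) auto
qed

text \<open>By the Chinese remainder theorem one prime \<open>l0\<close> with a nontrivial exponent
  already annihilates the complete sum; the remaining primes are felt only through the
  period.\<close>

lemma cubsym_prod_box_sum:
  assumes T: "finite T" "\<And>l. l \<in> T \<Longrightarrow> prime l" "\<And>l. l \<in> T \<Longrightarrow> l > 3"
    and l0: "l0 \<in> T" "i l0 mod 3 \<noteq> j l0 mod 3"
  shows "norm (\<Sum>a\<in>sqbox X. \<Sum>b\<in>sqbox X. cubsym_prod T i j (Eis a b)) \<le> 2 * real (2 * X) * real (\<Prod>T)"
proof (rule box_sum_periodic_bound)
  show "0 < \<Prod>T" using T by (auto intro!: prod_pos dest: prime_gt_0_nat)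
  show "cubsym_prod T i j (Eis (x + int (\<Prod>T)) y) = cubsym_prod T i j (Eis x y)" for x y
    using cubsym_prod_mod(1)[OF T(1,2), of i j "x
        + int (\<Prod>T)" y] cubsym_prod_mod(1)[OF T(1,2), of i j x y] by simp
  show "cubsym_prod T i j (Eis x (y + int (\<Prod>T))) = cubsym_prod T i j (Eis x y)" for x y
    using cubsym_prod_mod(2)[OF T(1,2), of i j x "y
        + int (\<Prod>T)"] cubsym_prod_mod(2)[OF T(1,2), of i j x y] by simp
  show "norm (cubsym_prod T i j (Eis x y)) \<le> 1" for x y by (rule norm_cubsym_prod_le[OF T(2)])
  define T' where "T' = T - {l0}"
  have TT: "T = insert l0 T'" "l0 \<notin> T'" "finite T'" using l0 T by (auto simp: T'_def)
  have T': "\<And>l. l \<in> T' \<Longrightarrow> prime l" using T TT by auto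
  have pr: "\<Prod>T = l0 * \<Prod>T'" using TT by simp
  have co: "coprime l0 (\<Prod>T')"
    using TT T l0 by (intro prod_coprime_right) (auto intro: primes_coprime)
  have sp: "cubsym_prod T i j x = cubsym l0 x ^ i l0 * cnj (cubsym l0 x) ^ j l0
      * cubsym_prod T' i j x" for x
    using TT by (simp add: cubsym_prod_def)
  have l01: "l0 > 1" using T l0 prime_gt_1_nat by blast
  have "(\<Sum>x\<in>{0..<int (\<Prod>T)}. \<Sum>y\<in>{0..<int (\<Prod>T)}. cubsym_prod T i j (Eis x y)) =
     (\<Sum>x\<in>{0..<int l0}. \<Sum>y\<in>{0..<int l0}. cubsym l0 (Eis x y) ^ i l0
         * cnj (cubsym l0 (Eis x y)) ^ j l0) *
     (\<Sum>x\<in>{0..<int (\<Prod>T')}. \<Sum>y\<in>{0..<int (\<Prod>T')}. cubsym_prod T' i j (Eis x y))"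
    unfolding pr sp
    by (rule box_sum_mod_product[OF co])
       (use l01 T' TT in \<open>auto simp: cubsym_Eis_mod cubsym_prod_mod simp del: of_nat_prod intro!:
           prod_pos dest: prime_gt_0_nat\<close>)
  also have "\<dots> = 0" using sum_cubsym_zero[of l0 "i l0" "j l0"] T l0 by simp
  finally show "(\<Sum>x\<in>{0..<int (\<Prod>T)}. \<Sum>y\<in>{0..<int (\<Prod>T)}. cubsym_prod T i j (Eis x y)) = 0" .
qed

section \<open>Moments of sums of independent random cube roots of unity\<close>

text \<open>The linear term averages to zero for a centred variable, which leaves a subgaussian
  bound.\<close>

lemma exp_le_add_exp_sq: "exp z \<le> z + exp (z ^ 2)" for z :: real
proof -
  have E: "1 + z ^ 2 \<le> exp (z ^ 2)" by (rule exp_ge_add_one_self)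
  consider "z > 1" | "0 \<le> z \<and> z \<le> 1" | "-1 \<le> z \<and> z < 0" | "z < -1" by linarith
  then show ?thesis
  proof cases
    case 1
    then have "z * 1 \<le> z * z" by (intro mult_left_mono) auto
    then have "exp z \<le> exp (z ^ 2)" by (simp add: power2_eq_square)
    then show ?thesis using 1 by linarith
  next
    case 2
    then have "exp z \<le> 1 + z + z ^ 2" by (intro exp_bound) auto
    then show ?thesis using E by linarith
  next
    case 3
    have "exp (- z) \<ge> 1 - z" using exp_ge_add_one_self[of "- z"] by simp
    then have "exp z * (1 - z) \<le> exp z * exp (- z)" by (intro mult_left_mono) auto
    also have "\<dots> = 1" by (simp add: exp_minus)
    also have "1 \<le> (1 + z + z ^ 2) * (1 - z)"
    proof -
      have "(1 + z + z ^ 2) * (1 - z) = 1 - z ^ 3"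
          by (simp add: power2_eq_square power3_eq_cube algebra_simps)
      moreover have "z ^ 3 \<le> 0" using 3 by (simp add: power_le_zero_eq)
      ultimately show ?thesis by simp
    qed
    finally have "exp z \<le> 1 + z + z ^ 2" by (rule mult_right_le_imp_le) (use 3 in simp)
    then show ?thesis using E by linarith
  next
    case 4
    then have "exp z \<le> 1" by simp
    moreover have "z ^ 2 \<ge> - z"
    proof -
      have "(- z) * 1 \<le> (- z) * (- z)" using 4 by (intro mult_left_mono) auto
      then show ?thesis by (simp add: power2_eq_square)
    qed
    ultimately show ?thesis using E by linarith
  qed
qed

lemma power_le_fact_exp: "v \<ge> 0 \<Longrightarrow> v ^ n \<le> fact n * exp v" for v :: real
proof -
  assume v: "v \<ge> 0"
  have s: "summable (\<lambda>m. v ^ m /\<^sub>R fact m)" by (rule summable_exp_generic)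
  have "(\<Sum>m\<in>{n}. v ^ m /\<^sub>R fact m) \<le> (\<Sum>m. v ^ m /\<^sub>R fact m)"
    by (rule sum_le_suminf[OF s]) (use v in auto)
  then have "v ^ n / fact n \<le> exp v" by (simp add: exp_def divide_inverse mult.commute)
  then show ?thesis by (simp add: field_simps)
qed

lemma even_power_le_fact_exp: "v ^ (2 * k) \<le> fact (2 * k) * (exp v + exp (- v))" for v :: real
proof -
  have "v ^ (2 * k) = \<bar>v\<bar> ^ (2 * k)" by (simp add: power_even_abs)
  also have "\<dots> \<le> fact (2 * k) * exp \<bar>v\<bar>" by (rule power_le_fact_exp) simp
  also have "\<dots> \<le> fact (2 * k) * (exp v + exp (- v))" by (intro mult_left_mono) (auto simp: abs_if)
  finally show ?thesis .
qed

definition mu3 :: "complex set" where "mu3 = {1, omega, omega ^ 2}"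

lemma omega_sq': "omega ^ 2 = - 1 - omega" using omega_sq by (simp add: power2_eq_square)

lemma sum_mu3: "sum f mu3 = f 1 + f omega + f (omega ^ 2)" and card_mu3: "card mu3
    = 3" and finite_mu3: "finite mu3"
proof -
  have d: "1 \<noteq> omega" "1 \<noteq> omega ^ 2" "omega \<noteq> omega ^ 2" unfolding omega_sq'
      by (auto simp: complex_eq_iff)
  show "sum f mu3 = f 1 + f omega + f (omega ^ 2)" "card mu3 = 3" "finite mu3"
    using d by (simp_all add: mu3_def add.assoc)
qed

lemma mu3_norm: "z \<in> mu3 \<Longrightarrow> norm z = 1"
  by (auto simp: mu3_def norm_power)

text \<open>Independence factorises the sum over \<open>PiE\<close>, which is
  \<open>3 ^ card S\<close> times an expectation, and each factor is subgaussian. The function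
  \<open>x\<close> will be \<open>Re\<close> or \<open>Im\<close>, both centred on
  \<open>mu3\<close>.\<close>

lemma mgf_mu3:
  fixes c :: "'a \<Rightarrow> real" and x :: "complex \<Rightarrow> real"
  assumes S: "finite S" and x: "\<And>z. z \<in> mu3 \<Longrightarrow> \<bar>x z\<bar> \<le> 1" "(\<Sum>z\<in>mu3. x z) = 0"
  shows "(\<Sum>g\<in>PiE S (\<lambda>_. mu3). exp (s * (\<Sum>p\<in>S. c p * x (g p)))) \<le> 3 ^ card S * exp (s ^ 2
      * (\<Sum>p\<in>S. c p ^ 2))"
proof -
  have "(\<Sum>g\<in>PiE S (\<lambda>_. mu3). exp (s * (\<Sum>p\<in>S. c p * x (g p)))) =
     (\<Sum>g\<in>PiE S (\<lambda>_. mu3). \<Prod>p\<in>S. exp (s * c p * x (g p)))"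
    using S by (simp add: sum_distrib_left exp_sum mult.assoc)
  also have "\<dots> = (\<Prod>p\<in>S. \<Sum>z\<in>mu3. exp (s * c p * x z))"
    by (rule prod_sum_PiE[symmetric]) (use S finite_mu3 in auto)
  also have "\<dots> \<le> (\<Prod>p\<in>S. 3 * exp (s ^ 2 * c p ^ 2))"
  proof (intro prod_mono conjI sum_nonneg)
    fix p
    have "(\<Sum>z\<in>mu3. exp (s * c p * x z)) \<le> (\<Sum>z\<in>mu3. s * c p * x z + exp (s ^ 2 * c p ^ 2))"
    proof (intro sum_mono)
      fix z assume z: "z \<in> mu3"
      have "(s * c p * x z) ^ 2 = (s ^ 2 * c p ^ 2) * (x z) ^ 2" by (simp add: power_mult_distrib)
      also have "\<dots> \<le> (s ^ 2 * c p ^ 2) * 1"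
        using x(1)[OF z] by (intro mult_left_mono) (auto simp: abs_square_le_1)
      finally have "exp ((s * c p * x z) ^ 2) \<le> exp (s ^ 2 * c p ^ 2)" by simp
      then show "exp (s * c p * x z) \<le> s * c p * x z + exp (s ^ 2 * c p ^ 2)"
        using exp_le_add_exp_sq[of "s * c p * x z"] by linarith
    qed
    also have "\<dots> = 3 * exp (s ^ 2 * c p ^ 2)"
      using x(2) by (simp add: sum.distrib sum_distrib_left [symmetric] card_mu3)
    finally show "(\<Sum>z\<in>mu3. exp (s * c p * x z)) \<le> 3 * exp (s ^ 2 * c p ^ 2)" .
  qed auto
  also have "\<dots> = 3 ^ card S * exp (s ^ 2 * (\<Sum>p\<in>S. c p ^ 2))"
    using S by (simp add: prod.distrib exp_sum sum_distrib_left)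
  finally show ?thesis .
qed

lemma real_moment_mu3:
  fixes c :: "'a \<Rightarrow> real" and x :: "complex \<Rightarrow> real"
  assumes S: "finite S" and x: "\<And>z. z \<in> mu3 \<Longrightarrow> \<bar>x z\<bar> \<le> 1" "(\<Sum>z\<in>mu3. x z) = 0"
    and s: "s > 0"
  shows "(\<Sum>g\<in>PiE S (\<lambda>_. mu3). (\<Sum>p\<in>S. c p * x (g p)) ^ (2 * k)) \<le>
    3 ^ card S * (2 * fact (2 * k) * exp (s ^ 2 * (\<Sum>p\<in>S. c p ^ 2)) / s ^ (2 * k))"
proof -
  define L where "L g = (\<Sum>p\<in>S. c p * x (g p))" for g
  have "s ^ (2 * k) * (\<Sum>g\<in>PiE S (\<lambda>_. mu3). L g ^ (2 * k)) = (\<Sum>g\<in>PiE S (\<lambda>_. mu3). (s * L g) ^ (2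
      * k))"
    by (simp add: sum_distrib_left power_mult_distrib)
  also have "\<dots> \<le> (\<Sum>g\<in>PiE S (\<lambda>_. mu3). fact (2 * k) * (exp (s * L g) + exp ((- s) * L g)))"
    by (intro sum_mono) (use even_power_le_fact_exp[of "s * L g" k for g] in simp)
  also have "\<dots> = fact (2 * k) * ((\<Sum>g\<in>PiE S (\<lambda>_. mu3). exp (s * L g))
      + (\<Sum>g\<in>PiE S (\<lambda>_. mu3). exp ((- s) * L g)))"
    by (simp only: sum_distrib_left [symmetric] sum.distrib)
  also have "\<dots> \<le> fact (2 * k) * (3 ^ card S * exp (s ^ 2 * (\<Sum>p\<in>S. c p ^ 2)) + 3 ^ card S
      * exp ((- s) ^ 2 * (\<Sum>p\<in>S. c p ^ 2)))"
    unfolding L_def by (intro mult_left_mono add_mono mgf_mu3 S x) auto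
  also have "\<dots> = 3 ^ card S * (2 * fact (2 * k) * exp (s ^ 2 * (\<Sum>p\<in>S. c p ^ 2)))" by simp
  finally have "(\<Sum>g\<in>PiE S (\<lambda>_. mu3). L g ^ (2 * k)) \<le>
    3 ^ card S * (2 * fact (2 * k) * exp (s ^ 2 * (\<Sum>p\<in>S. c p ^ 2))) / s ^ (2 * k)"
    using s by (simp add: pos_le_divide_eq mult.commute)
  then show ?thesis by (simp add: L_def)
qed

lemma moment_mu3:
  fixes c :: "'a \<Rightarrow> real"
  assumes S: "finite S" and t: "(\<Sum>p\<in>S. c p ^ 2) \<le> t" "t > 0" and k: "k > 0"
  shows "(\<Sum>g\<in>PiE S (\<lambda>_. mu3). norm (\<Sum>p\<in>S. of_real (c p) * g p) ^ (2 * k)) \<le> 3 ^ card S * (4 * (24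
      * real k * t) ^ k)"
proof -
  \<comment> \<open>This \<open>s\<close> minimises \<open>exp (s ^ 2 * t) / s ^ (2 * k)\<close>.
    With \<open>fact (2 * k) <= (4 * k ^ 2) ^ k\<close> and \<open>e <= 3\<close> it produces
    \<open>12 * k * t\<close>; recombining real and imaginary parts doubles this to the constant
    24.\<close>
  define s where "s = sqrt (real k / t)"
  have s0: "s > 0" using k t by (simp add: s_def)
  have s2: "s ^ 2 = real k / t" using k t by (simp add: s_def)
  define B where "B = 2 * fact (2 * k) * exp (s ^ 2 * (\<Sum>p\<in>S. c p ^ 2)) / s ^ (2 * k)"
  define A where "A g = (\<Sum>p\<in>S. of_real (c p) * g p)" for g :: "'a \<Rightarrow> complex"
  have ReA: "Re (A g) = (\<Sum>p\<in>S. c p * Re (g p))" and ImA: "Im (A g) = (\<Sum>p\<in>S. c p * Im (g p))" for g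
    by (simp_all add: A_def)
  have pt: "norm (A g) ^ (2 * k) \<le> 2 ^ k * (Re (A g) ^ (2 * k) + Im (A g) ^ (2 * k))" for g
  proof -
    define a b where "a = Re (A g) ^ 2" and "b = Im (A g) ^ 2"
    have ab: "a \<ge> 0" "b \<ge> 0" by (auto simp: a_def b_def)
    have "norm (A g) ^ (2 * k) = (a + b) ^ k" by (simp add: power_mult cmod_power2 a_def b_def)
    also have "\<dots> \<le> (2 * max a b) ^ k" using ab by (intro power_mono) auto
    also have "\<dots> = 2 ^ k * max a b ^ k" by (simp add: power_mult_distrib)
    also have "max a b ^ k \<le> a ^ k + b ^ k" using ab by (auto simp: max_def)
    finally show ?thesis by (simp add: a_def b_def power_mult)
  qed
  have R: "(\<Sum>g\<in>PiE S (\<lambda>_. mu3). Re (A g) ^ (2 * k)) \<le> 3 ^ card S * B"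
    unfolding ReA B_def
    by (rule real_moment_mu3[OF S _ _ s0])
       (use mu3_norm abs_Re_le_cmod in \<open>auto simp: sum_mu3 omega_sq' intro: order_trans[OF
           abs_Re_le_cmod]\<close>)
  have I: "(\<Sum>g\<in>PiE S (\<lambda>_. mu3). Im (A g) ^ (2 * k)) \<le> 3 ^ card S * B"
    unfolding ImA B_def
    by (rule real_moment_mu3[OF S _ _ s0])
       (use mu3_norm abs_Im_le_cmod in \<open>auto simp: sum_mu3 omega_sq' intro: order_trans[OF
           abs_Im_le_cmod]\<close>)
  have "(\<Sum>g\<in>PiE S (\<lambda>_. mu3). norm (A g) ^ (2 * k)) \<le>
     (\<Sum>g\<in>PiE S (\<lambda>_. mu3). 2 ^ k * (Re (A g) ^ (2 * k) + Im (A g) ^ (2 * k)))"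
    by (intro sum_mono pt)
  also have "\<dots> = 2 ^ k * ((\<Sum>g\<in>PiE S (\<lambda>_. mu3). Re (A g) ^ (2 * k))
      + (\<Sum>g\<in>PiE S (\<lambda>_. mu3). Im (A g) ^ (2 * k)))"
    by (simp only: sum_distrib_left [symmetric] sum.distrib)
  also have "\<dots> \<le> 2 ^ k * (3 ^ card S * B + 3 ^ card S * B)"
      by (intro mult_left_mono add_mono R I) auto
  also have "\<dots> = 3 ^ card S * (2 ^ k * 2 * B)" by simp
  also have "2 ^ k * 2 * B \<le> 4 * (24 * real k * t) ^ k"
  proof -
    have "s ^ 2 * (\<Sum>p\<in>S. c p ^ 2) \<le> s ^ 2 * t" using t by (intro mult_left_mono) auto
    also have "\<dots> = real k * 1" using t by (simp add: s2)
    finally have "exp (s ^ 2 * (\<Sum>p\<in>S. c p ^ 2)) \<le> exp (real k * 1)" by simp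
    also have "\<dots> = exp 1 ^ k" by (simp only: exp_of_nat_mult)
    also have "\<dots> \<le> 3 ^ k" using exp_le by (intro power_mono) auto
    finally have e3: "exp (s ^ 2 * (\<Sum>p\<in>S. c p ^ 2)) \<le> 3 ^ k" .
    have "fact (2 * k) \<le> real ((2 * k) ^ (2 * k))"
      by (rule fact_le_power)
    then have f: "fact (2 * k) \<le> (4 * real k ^ 2) ^ k" by (simp add: power_mult power_mult_distrib)
    have sk: "s ^ (2 * k) = (real k / t) ^ k" by (simp add: power_mult s2)
    have pow: "2 * a ^ k * b ^ k / d ^ k = 2 * (a * b / d) ^ k" for a b d :: real
      by (simp add: power_mult_distrib power_divide)
    have "B \<le> 2 * (4 * real k ^ 2) ^ k * 3 ^ k / s ^ (2 * k)"
      unfolding B_def using s0 by (intro divide_right_mono mult_mono f e3 mult_left_mono) auto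
    also have "\<dots> = 2 * (4 * real k ^ 2 * 3 / (real k / t)) ^ k" unfolding sk by (rule pow)
    also have "4 * real k ^ 2 * 3 / (real k / t) = 12 * real k * t"
      using k t by (simp add: field_simps power2_eq_square)
    finally have "2 ^ k * 2 * B \<le> 2 ^ k * 2 * (2 * (12 * real k * t) ^ k)"
        by (intro mult_left_mono) auto
    also have "\<dots> = 4 * (2 * (12 * real k * t)) ^ k" by (simp only: power_mult_distrib)
    also have "2 * (12 * real k * t) = 24 * real k * t" by simp
    finally show ?thesis .
  qed
  finally show ?thesis by (simp add: A_def)
qed

section \<open>Expansion of high moments over tuples of primes\<close>

lemma power_sum_PiE:
  fixes F :: "'a \<Rightarrow> 'b :: comm_ring_1"
  assumes "finite S"
  shows "(\<Sum>p\<in>S. F p) ^ k = (\<Sum>P\<in>PiE {..<k} (\<lambda>_. S). \<Prod>i<k. F (P i))"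
  using prod_sum_PiE[of "{..<k}" "\<lambda>_. S" "\<lambda>_ y. F y"] assms by simp

text \<open>Multiplicity of \<open>l\<close> in the tuple \<open>P\<close>. The orthogonality
  relations see a pair of tuples only through these multiplicities modulo 3.\<close>

definition occs :: "nat \<Rightarrow> (nat \<Rightarrow> 'a) \<Rightarrow> 'a \<Rightarrow> nat" where
  "occs k P l = card {i\<in>{..<k}. P i = l}"

lemma prod_occs:
  fixes F :: "'a \<Rightarrow> 'b :: comm_monoid_mult"
  assumes "finite T" "P ` {..<k} \<subseteq> T"
  shows "(\<Prod>i<k. F (P i)) = (\<Prod>l\<in>T. F l ^ occs k P l)"
proof -
  have "(\<Prod>i<k. F (P i)) = (\<Prod>l\<in>T. \<Prod>i\<in>{i\<in>{..<k}. P i = l}. F (P i))"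
    using assms by (intro prod.group[symmetric]) auto
  also have "\<dots> = (\<Prod>l\<in>T. F l ^ occs k P l)" by (intro prod.cong refl) (simp add: occs_def)
  finally show ?thesis .
qed

lemma norm_power_expand:
  fixes c F :: "'a \<Rightarrow> complex"
  assumes "finite S"
  shows "of_real (norm (\<Sum>p\<in>S. c p * F p) ^ (2 * k)) =
    (\<Sum>P\<in>PiE {..<k} (\<lambda>_. S). \<Sum>P'\<in>PiE {..<k} (\<lambda>_. S).
       ((\<Prod>i<k. c (P i)) * (\<Prod>i<k. cnj (c (P' i)))) * ((\<Prod>i<k. F (P i)) * (\<Prod>i<k. cnj (F (P' i)))))"
proof -
  have "complex_of_real (norm (\<Sum>p\<in>S. c p * F p) ^ (2 * k)) = of_real (norm (\<Sum>p\<in>S. c p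
      * F p) ^ 2) ^ k"
    by (simp add: power_mult)
  also have "\<dots> = ((\<Sum>p\<in>S. c p * F p) * cnj (\<Sum>p\<in>S. c p * F p)) ^ k"
    by (simp only: complex_norm_square)
  also have "\<dots> = (\<Sum>p\<in>S. c p * F p) ^ k * (\<Sum>p\<in>S. cnj (c p) * cnj (F p)) ^ k"
    by (simp add: power_mult_distrib)
  also have "\<dots> = (\<Sum>P\<in>PiE {..<k} (\<lambda>_. S). \<Sum>P'\<in>PiE {..<k} (\<lambda>_. S).
     (\<Prod>i<k. c (P i) * F (P i)) * (\<Prod>i<k. cnj (c (P' i)) * cnj (F (P' i))))"
    unfolding power_sum_PiE[OF assms] sum_product ..
  finally show ?thesis by (simp add: prod.distrib mult_ac)
qed

lemma sum_mu3_powers: "(\<Sum>z\<in>mu3. z ^ i * cnj z ^ j) = (if i mod 3 = j mod 3 then 3 else 0)"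
proof -
  define t where "t = omega ^ i * cnj omega ^ j"
  have t3: "t ^ 3 = 1"
  proof -
    have "t ^ 3 = (omega ^ 3) ^ i * cnj (omega ^ 3) ^ j"
      by (simp only: t_def power_mult_distrib power_mult [symmetric] complex_cnj_power mult.commute)
    then show ?thesis by (simp add: omega_cube)
  qed
  have S: "(\<Sum>z\<in>mu3. z ^ i * cnj z ^ j) = 1 + t + t ^ 2"
  proof -
    have "(omega ^ 2) ^ i * cnj (omega ^ 2) ^ j = t ^ 2"
      by (simp only: t_def power_mult_distrib power_mult [symmetric] complex_cnj_power mult.commute)
    then show ?thesis by (simp add: sum_mu3 t_def)
  qed
  show ?thesis
  proof (cases "i mod 3 = j mod 3")
    case True
    have n1: "omega * cnj omega = 1" using complex_norm_square[of omega] by simp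
    have red: "w ^ n = w ^ (n mod 3)" if "w ^ 3 = 1" for w :: complex and n
    proof -
      have "w ^ (3 * (n div 3) + n mod 3) = w ^ (n mod 3)"
          by (simp only: power_add power_mult that) simp
      then show ?thesis by simp
    qed
    have "cnj omega ^ 3 = 1" using arg_cong[OF omega_cube, of cnj] by simp
    then have "t = omega ^ (i mod 3) * cnj omega ^ (j mod 3)"
      unfolding t_def using red[OF omega_cube, of i] red[of "cnj omega" j] by simp
    also have "\<dots> = (omega * cnj omega) ^ (j mod 3)" using True by (simp add: power_mult_distrib)
    finally have "t = 1" by (simp add: n1)
    then show ?thesis using S True by simp
  next
    case False
    then have "t \<noteq> 1" using emb_emu3_power_ne[of eomega i j] by (simp add: t_def)
    moreover have "(t - 1) * (1 + t + t ^ 2) = t ^ 3 - 1"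
      by (simp add: power2_eq_square power3_eq_cube algebra_simps)
    ultimately have "1 + t + t ^ 2 = 0" using t3 by simp
    then show ?thesis using S False by simp
  qed
qed

lemma sum_mu3_product:
  assumes "finite S"
  shows "(\<Sum>g\<in>PiE S (\<lambda>_. mu3). \<Prod>l\<in>S. g l ^ i l * cnj (g l) ^ j l) =
    (if \<forall>l\<in>S. i l mod 3 = j l mod 3 then 3 ^ card S else 0)"
proof -
  have "(\<Sum>g\<in>PiE S (\<lambda>_. mu3). \<Prod>l\<in>S. g l ^ i l * cnj (g l) ^ j l) = (\<Prod>l\<in>S. \<Sum>z\<in>mu3. z ^ i l
      * cnj z ^ j l)"
    by (rule prod_sum_PiE[symmetric]) (use assms finite_mu3 in auto)
  also have "\<dots> = (\<Prod>l\<in>S. if i l mod 3 = j l mod 3 then 3 else 0)" by (simp only: sum_mu3_powers)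
  also have "\<dots> = (if \<forall>l\<in>S. i l mod 3 = j l mod 3 then 3 ^ card S else 0)"
  proof (cases "\<forall>l\<in>S. i l mod 3 = j l mod 3")
    case False
    then have "(\<Prod>l\<in>S. if i l mod 3 = j l mod 3 then 3 else 0 :: complex) = 0"
      using assms by (intro prod_zero) auto
    then show ?thesis by (simp only: if_not_P[OF False])
  qed simp
  finally show ?thesis .
qed

text \<open>A pair of tuples whose multiplicities agree modulo 3 is bounded trivially by the number
  of points of the box. In any other pair some prime carries a nontrivial exponent, and the period
  is a product of at most \<open>2 * k\<close> primes up to \<open>M\<close>.\<close>

lemma cubsym_tuple_box_sum:
  assumes S: "\<And>p. p \<in> S \<Longrightarrow> prime p" "\<And>p. p \<in> S \<Longrightarrow> p > 3" "\<And>p. p \<in> S \<Longrightarrow> p \<le> M"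
    and P: "P \<in> PiE {..<k} (\<lambda>_. S)" "P' \<in> PiE {..<k} (\<lambda>_. S)" and M: "M \<ge> 1"
  shows "norm (\<Sum>a\<in>sqbox X. \<Sum>b\<in>sqbox X. (\<Prod>i<k. cubsym (P i) (Eis a b))
      * (\<Prod>i<k. cnj (cubsym (P' i) (Eis a b))))
    \<le> (if \<forall>l\<in>S. occs k P l mod 3 = occs k P' l mod 3 then real (2 * X) ^ 2 else 0) + 2 * real (2
        * X) * real M ^ (2 * k)"
proof -
  define T where "T = P ` {..<k} \<union> P' ` {..<k}"
  have T: "finite T" "T \<subseteq> S" using P by (auto simp: T_def)
  have eq: "(\<Prod>i<k. cubsym (P i) x) * (\<Prod>i<k. cnj (cubsym (P' i) x))
      = cubsym_prod T (occs k P) (occs k P') x" for x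
    unfolding cubsym_prod_def prod.distrib
    using prod_occs[OF T(1), of P k "\<lambda>l. cubsym l x"] prod_occs[OF T(1), of P' k
        "\<lambda>l. cnj (cubsym l x)"]
    by (simp add: T_def)
  show ?thesis
  proof (cases "\<forall>l\<in>S. occs k P l mod 3 = occs k P' l mod 3")
    case True
    have "norm (\<Sum>a\<in>sqbox X. \<Sum>b\<in>sqbox X. cubsym_prod T (occs k P) (occs k P') (Eis a b))
        \<le> (\<Sum>a\<in>sqbox X. \<Sum>b\<in>sqbox X. 1)"
      by (intro order_trans[OF norm_sum] sum_mono norm_cubsym_prod_le) (use S T in auto)
    also have "\<dots> = real (2 * X) ^ 2" by (simp add: sqbox_def power2_eq_square)
    finally show ?thesis unfolding eq if_P[OF True] by (rule order_trans) simp
  next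
    case False
    then obtain l where l: "l \<in> S" "occs k P l mod 3 \<noteq> occs k P' l mod 3" by blast
    have "l \<in> T"
    proof (rule ccontr)
      assume "l \<notin> T"
      then have "occs k P l = 0" "occs k P' l = 0" by (auto simp: occs_def T_def)
      then show False using l by simp
    qed
    have "norm (\<Sum>a\<in>sqbox X. \<Sum>b\<in>sqbox X. cubsym_prod T (occs k P) (occs k P') (Eis a b)) \<le> 2
        * real (2 * X) * real (\<Prod>T)"
      by (rule cubsym_prod_box_sum[of T l "occs k P" "occs k P'" X]) (use S T l \<open>l \<in> T\<close> in auto)
    also have "\<dots> \<le> 2 * real (2 * X) * real M ^ (2 * k)"
    proof (intro mult_left_mono)
      have "\<Prod>T \<le> (\<Prod>l\<in>T. M)" by (rule prod_mono) (use S T in auto)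
      also have "\<dots> = M ^ card T" by simp
      also have "\<dots> \<le> M ^ (2 * k)"
      proof (intro power_increasing M)
        have "card T \<le> card (P ` {..<k}) + card (P' ` {..<k})" unfolding T_def by (rule card_Un_le)
        also have "\<dots> \<le> k + k" using card_image_le[of "{..<k}" P] card_image_le[of "{..<k}" P']
            by simp
        finally show "card T \<le> 2 * k" by simp
      qed
      finally have "real (\<Prod>T) \<le> real (M ^ (2 * k))" by (rule of_nat_mono)
      then show "real (\<Prod>T) \<le> real M ^ (2 * k)" by simp
    qed auto
    finally show ?thesis unfolding eq if_not_P[OF False] by simp
  qed
qed

text \<open>The diagonal pairs are never counted directly. With coefficients replaced by their
  absolute values, their total is exactly the \<open>2 * k\<close>-th moment of the random model,
  where the same pairs survive and all others average to zero; \<open>moment_mu3\<close> then bounds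
  it.\<close>

theorem cubsym_moment:
  fixes c :: "nat \<Rightarrow> complex"
  assumes fin: "finite S" and S: "\<And>p. p \<in> S \<Longrightarrow> prime p" "\<And>p. p \<in> S \<Longrightarrow> p > 3" "\<And>p. p \<in> S \<Longrightarrow> p \<le> M"
    and M: "M \<ge> 1" and t: "(\<Sum>p\<in>S. norm (c p) ^ 2) \<le> t" "t > 0" and k: "k > 0"
  shows "(\<Sum>a\<in>sqbox X. \<Sum>b\<in>sqbox X. norm (\<Sum>p\<in>S. c p * cubsym p (Eis a b)) ^ (2 * k)) \<le>
    real (2 * X) ^ 2 * (4 * (24 * real k * t) ^ k) + 2 * real (2 * X) * real M ^ (2 * k)
        * (\<Sum>p\<in>S. norm (c p)) ^ (2 * k)"
proof -
  define PS where "PS = PiE {..<k} (\<lambda>_. S)"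
  define W where "W P P' = (\<Prod>i<k. norm (c (P i))) * (\<Prod>i<k. norm (c (P' i)))" for P P'
  define C where "C P P' = (\<Prod>i<k. c (P i)) * (\<Prod>i<k. cnj (c (P' i)))" for P P'
  define f where "f P P' x = (\<Prod>i<k. cubsym (P i) x) * (\<Prod>i<k. cnj (cubsym (P' i) x))" for P P' x
  define dg where "dg P P' \<longleftrightarrow> (\<forall>l\<in>S. occs k P l mod 3 = occs k P' l mod 3)" for P P'
  define E where "E = 2 * real (2 * X) * real M ^ (2 * k)"
  define L where "L = (\<Sum>a\<in>sqbox X. \<Sum>b\<in>sqbox X. norm (\<Sum>p\<in>S. c p * cubsym p (Eis a b)) ^ (2 * k))"
  have finPS: "finite PS" unfolding PS_def by (intro finite_PiE) (use fin in auto)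
  have W0: "W P P' \<ge> 0" for P P' by (auto simp: W_def intro!: prod_nonneg mult_nonneg_nonneg)
  have nC: "norm (C P P') = W P P'" for P P' by (simp add: C_def W_def norm_mult prod_norm
      [symmetric])
  have "complex_of_real L = (\<Sum>a\<in>sqbox X. \<Sum>b\<in>sqbox X. \<Sum>P\<in>PS. \<Sum>P'\<in>PS. C P P' * f P P' (Eis a b))"
    unfolding L_def of_real_sum norm_power_expand[OF fin] PS_def C_def f_def ..
  also have "\<dots> = (\<Sum>P\<in>PS. \<Sum>P'\<in>PS. \<Sum>a\<in>sqbox X. \<Sum>b\<in>sqbox X. C P P' * f P P' (Eis a b))"
    by (simp only: sum.swap[of _ PS "sqbox X"])
  also have "\<dots> = (\<Sum>P\<in>PS. \<Sum>P'\<in>PS. C P P' * (\<Sum>a\<in>sqbox X. \<Sum>b\<in>sqbox X. f P P' (Eis a b)))"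
    by (simp only: sum_distrib_left)
  finally have eqL: "complex_of_real L = (\<Sum>P\<in>PS. \<Sum>P'\<in>PS. C P P'
      * (\<Sum>a\<in>sqbox X. \<Sum>b\<in>sqbox X. f P P' (Eis a b)))" .
  have "L \<le> norm (complex_of_real L)" by simp
  also have "\<dots> \<le> (\<Sum>P\<in>PS. \<Sum>P'\<in>PS. W P P' * ((if dg P P' then real (2 * X) ^ 2 else 0) + E))"
    unfolding eqL
  proof (intro order_trans[OF norm_sum] sum_mono)
    fix P P' assume P: "P \<in> PS" "P' \<in> PS"
    have "norm (\<Sum>a\<in>sqbox X. \<Sum>b\<in>sqbox X. f P P' (Eis a b)) \<le> (if dg P P' then real (2
        * X) ^ 2 else 0) + E"
      unfolding f_def dg_def E_def by (rule cubsym_tuple_box_sum) (use S M P in \<open>auto simp: PS_def\<close>)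
    then show "norm (C P P' * (\<Sum>a\<in>sqbox X. \<Sum>b\<in>sqbox X. f P P' (Eis a b))) \<le> W P P'
        * ((if dg P P' then real (2 * X) ^ 2 else 0) + E)"
      unfolding norm_mult nC by (intro mult_left_mono W0)
  qed
  also have "\<dots> = real (2 * X) ^ 2 * (\<Sum>P\<in>PS. \<Sum>P'\<in>PS. W P P' * (if dg P P' then 1 else 0)) + E
      * (\<Sum>P\<in>PS. \<Sum>P'\<in>PS. W P P')"
    unfolding sum_distrib_left sum.distrib [symmetric]
    by (intro sum.cong refl) (simp add: algebra_simps)
  also have "(\<Sum>P\<in>PS. \<Sum>P'\<in>PS. W P P') = (\<Sum>p\<in>S. norm (c p)) ^ (2 * k)"
  proof -
    have "(\<Sum>P\<in>PS. \<Sum>P'\<in>PS. W P P') = (\<Sum>p\<in>S. norm (c p)) ^ k * (\<Sum>p\<in>S. norm (c p)) ^ k"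
      unfolding power_sum_PiE[OF fin] sum_product W_def PS_def ..
    then show ?thesis by (simp add: mult_2 power_add)
  qed
  also have "(\<Sum>P\<in>PS. \<Sum>P'\<in>PS. W P P' * (if dg P P' then 1 else 0)) \<le> 4 * (24 * real k * t) ^ k"
  proof -
    define N where "N = (\<Sum>g\<in>PiE S (\<lambda>_. mu3). norm (\<Sum>p\<in>S. complex_of_real (norm (c p)) * g p) ^ (2
        * k))"
    have "complex_of_real N = (\<Sum>g\<in>PiE S (\<lambda>_. mu3). \<Sum>P\<in>PS. \<Sum>P'\<in>PS. of_real (W P P')
        * ((\<Prod>i<k. g (P i)) * (\<Prod>i<k. cnj (g (P' i)))))"
      unfolding N_def of_real_sum norm_power_expand[OF fin] PS_def W_def by simp
    also have "\<dots> = (\<Sum>P\<in>PS. \<Sum>P'\<in>PS. \<Sum>g\<in>PiE S (\<lambda>_. mu3). of_real (W P P') * ((\<Prod>i<k. g (P i))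
        * (\<Prod>i<k. cnj (g (P' i)))))"
      by (simp only: sum.swap[of _ PS "PiE S (\<lambda>_. mu3)"])
    also have "\<dots> = (\<Sum>P\<in>PS. \<Sum>P'\<in>PS. of_real (W P P') * (if dg P P' then 3 ^ card S else 0))"
    proof (intro sum.cong refl)
      fix P P' assume P: "P \<in> PS" "P' \<in> PS"
      have "(\<Prod>i<k. g (P i)) * (\<Prod>i<k. cnj (g (P' i))) = (\<Prod>l\<in>S. g l ^ occs k P l
          * cnj (g l) ^ occs k P' l)" for g
        unfolding prod.distrib
        using prod_occs[OF fin, of P k g] prod_occs[OF fin, of P' k "\<lambda>l. cnj (g l)"] P
        by (auto simp: PS_def PiE_def Pi_def image_subset_iff)
      then show "(\<Sum>g\<in>PiE S (\<lambda>_. mu3). complex_of_real (W P P') * ((\<Prod>i<k. g (P i))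
          * (\<Prod>i<k. cnj (g (P' i))))) =
         of_real (W P P') * (if dg P P' then 3 ^ card S else 0)"
        by (simp only: sum_distrib_left [symmetric] sum_mu3_product[OF fin] dg_def)
    qed
    also have "\<dots> = complex_of_real (3 ^ card S * (\<Sum>P\<in>PS. \<Sum>P'\<in>PS. W P P'
        * (if dg P P' then 1 else 0)))"
      unfolding sum_distrib_left of_real_sum by (intro sum.cong refl) simp
    finally have "N = 3 ^ card S * (\<Sum>P\<in>PS. \<Sum>P'\<in>PS. W P P' * (if dg P P' then 1 else 0))"
      by (simp only: of_real_eq_iff)
    moreover have "N \<le> 3 ^ card S * (4 * (24 * real k * t) ^ k)"
      unfolding N_def by (rule moment_mu3[OF fin t k])
    ultimately show ?thesis by simp
  qed
  finally show ?thesis unfolding L_def E_def by (simp add: mult_left_mono)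
qed

section \<open>A large sieve inequality for cubic characters\<close>

lemma bezout_cong:
  fixes a q1 q2 :: nat
  assumes "q1 > 0" "q2 > 0" "[a = 1] (mod (gcd q1 q2))"
  obtains b where "[b = a] (mod q1)" "[b = 1] (mod q2)"
proof -
  obtain u v where uv: "u * int q1 + v * int q2 = gcd (int q1) (int q2)" using bezout_int by blast
  have "[int a = int 1] (mod int (gcd q1 q2))" using assms(3) by (simp only: cong_int_iff)
  then have "gcd (int q1) (int q2) dvd int a - 1" by (simp add: cong_iff_dvd_diff)
  then obtain t where t: "int a - 1 = gcd (int q1) (int q2) * t" by (elim dvdE)
  define m where "m = int (q1 * q2)"
  define B where "B = int a - t * u * int q1"
  have m0: "m > 0" using assms by (simp add: m_def)
  define b where "b = nat (B mod m)"
  have b: "int b = B mod m" using m0 by (simp add: b_def)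
  have "B = 1 + t * v * int q2" using t unfolding uv [symmetric] by (simp add: B_def algebra_simps)
  then have B2: "[B = 1] (mod int q2)" by (simp add: cong_iff_dvd_diff)
  have B1: "[B = int a] (mod int q1)" by (simp add: cong_iff_dvd_diff B_def)
  have "[int b = B] (mod m)" by (simp add: b cong_def)
  then have bq: "[int b = B] (mod int q1)" "[int b = B] (mod int q2)"
    by (rule cong_dvd_modulus; simp add: m_def)+
  have "[int b = int a] (mod int q1)" using bq(1) B1 by (rule cong_trans)
  moreover have "[int b = int 1] (mod int q2)" using cong_trans[OF bq(2) B2] by simp
  ultimately show ?thesis using that by (simp only: cong_int_iff)
qed

text \<open>If \<open>a\<close> is 1 modulo the gcd, some \<open>b\<close> agrees with
  \<open>a\<close> modulo \<open>q1\<close> and with 1 modulo \<open>q2\<close>; evaluating both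
  characters at \<open>b\<close> gives \<open>chi1 a = 1\<close>. For primitive characters it
  follows that both moduli equal the gcd.\<close>

lemma primitive_induced_gcd:
  assumes 1: "dirichlet_character q1 chi1" and 2: "dirichlet_character q2 chi2"
    and one: "\<And>n. coprime n q2 \<Longrightarrow> [n = 1] (mod q2) \<Longrightarrow> chi2 n = 1"
    and eq: "\<And>n. coprime n (q1 * q2) \<Longrightarrow> chi1 n = chi2 n"
  shows "induced_modulus q1 chi1 (gcd q1 q2)"
  unfolding induced_modulus_def
proof (intro conjI allI impI)
  fix a assume a: "coprime a q1 \<and> [a = 1] (mod (gcd q1 q2))"
  have q: "q1 > 0" "q2 > 0" using 1 2 by (auto simp: dirichlet_character_def)
  obtain b where b: "[b = a] (mod q1)" "[b = 1] (mod q2)" using bezout_cong[OF q] a by blast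
  have "coprime b q1" using a b(1) by (metis cong_imp_coprime cong_sym)
  moreover have b2: "coprime b q2" using b(2) by (metis cong_imp_coprime cong_sym coprime_1_left)
  ultimately have "chi1 b = chi2 b" using eq by simp
  then show "chi1 a = 1" using dirichlet_character_cong[OF 1 b(1)] one[OF b2 b(2)] by simp
qed simp

lemma primitive_eqI:
  assumes c1: "primitive_character q1 chi1" and c2: "primitive_character q2 chi2"
    and one: "chi1 1 = 1" "chi2 1 = 1"
    and eq: "\<And>n. coprime n (q1 * q2) \<Longrightarrow> chi1 n = chi2 n"
  shows "chi1 = chi2"
proof -
  have d: "dirichlet_character q1 chi1" "dirichlet_character q2 chi2"
    using c1 c2 by (auto simp: primitive_character_def)
  have "induced_modulus q1 chi1 (gcd q1 q2)"
    by (rule primitive_induced_gcd[OF d]) (use dirichlet_character_cong[OF d(2)] one eq in auto)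
  then have g1: "gcd q1 q2 = q1" using c1 by (auto simp: primitive_character_def)
  have "induced_modulus q2 chi2 (gcd q2 q1)"
    by (rule primitive_induced_gcd[OF d(2,1)]) (use dirichlet_character_cong[OF d(1)] one eq in
        \<open>auto simp: mult.commute\<close>)
  then have g2: "gcd q1 q2 = q2" using c2 by (auto simp: primitive_character_def gcd.commute)
  have q: "q1 = q2" using g1 g2 by simp
  show ?thesis
  proof
    fix n show "chi1 n = chi2 n"
    proof (cases "coprime n q1")
      case True
      then show ?thesis using eq[of n] q by simp
    next
      case False
      then have "chi1 n = 0" "chi2 n = 0" using d q by (auto simp: dirichlet_character_def)
      then show ?thesis by simp
    qed
  qed
qed

lemma F3_obtain:
  assumes "chi \<in> F3 Q"
  obtains q where "cubic_primitive q chi" "real q \<le> Q"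
  using assms by (auto simp: F3_def cubic_primitive_def)

text \<open>Distinct primitive characters disagree at an integer coprime to both moduli, so the
  product of one with the conjugate of the other sums to zero over the period
  \<open>q1 * q2\<close>, and an incomplete period contributes at most its length.\<close>

lemma F3_orthogonality:
  assumes chi: "chi1 \<in> F3 Q" "chi2 \<in> F3 Q" and ne: "chi1 \<noteq> chi2"
  shows "norm (\<Sum>n=1..N. chi1 n * cnj (chi2 n)) \<le> Q ^ 2"
proof -
  obtain q1 where q1: "cubic_primitive q1 chi1" "real q1 \<le> Q" using F3_obtain[OF chi(1)] .
  obtain q2 where q2: "cubic_primitive q2 chi2" "real q2 \<le> Q" using F3_obtain[OF chi(2)] .
  interpret A: cubic_primitive q1 chi1 by (rule q1)
  interpret B: cubic_primitive q2 chi2 by (rule q2)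
  define d where "d = q1 * q2"
  have d0: "d > 0" using A.q_pos B.q_pos by (simp add: d_def)
  define f where "f n = chi1 n * cnj (chi2 n)" for n
  have fmult: "f (m * n) = f m * f n" for m n by (simp add: f_def A.chi_mult B.chi_mult)
  have "[n mod d = n] (mod q1)" "[n mod d = n] (mod q2)" for n
    by (simp_all add: d_def cong_def mod_mod_cancel)
  then have fmod: "f (n mod d) = f n" for n
    unfolding f_def using dirichlet_character_cong[OF A.dc] dirichlet_character_cong[OF B.dc]
        by metis
  have zero: "(\<Sum>b<d. f b) = 0"
  proof -
    have "\<not> (\<forall>n. coprime n (q1 * q2) \<longrightarrow> chi1 n = chi2 n)"
      using primitive_eqI[OF A.primitive B.primitive A.chi_1 B.chi_1] ne by blast
    then obtain a where a: "coprime a d" "chi1 a \<noteq> chi2 a" by (auto simp: d_def)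
    then have aa: "coprime a q1" "coprime a q2" by (auto simp: d_def)
    have "f a \<noteq> 1"
    proof
      assume "f a = 1"
      have "cnj (chi2 a) * chi2 a = 1"
        using complex_norm_square[of "chi2 a"] B.norm_chi[OF aa(2)] by (simp add: mult.commute)
      have "chi1 a = chi1 a * (cnj (chi2 a) * chi2 a)" unfolding \<open>cnj (chi2 a) * chi2 a = 1\<close> by simp
      also have "\<dots> = f a * chi2 a" by (simp only: f_def mult.assoc)
      finally show False using a(2) \<open>f a = 1\<close> by simp
    qed
    have "f a * (\<Sum>b<d. f b) = (\<Sum>b<d. f (a * b mod d))" by (simp add: sum_distrib_left fmod fmult)
    also have "\<dots> = (\<Sum>b<d. f b)" by (rule sum_mult_residues[OF a(1) d0])
    finally have "(f a - 1) * (\<Sum>b<d. f b) = 0" by (simp add: algebra_simps)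
    then show ?thesis using \<open>f a \<noteq> 1\<close> by simp
  qed
  define F where "F x = f (nat (x mod int d))" for x
  have Ff: "F (int n) = f n" for n by (simp add: F_def fmod nat_mod_distrib flip: zmod_int)
  have nf: "norm (f n) \<le> 1" for n
    unfolding f_def norm_mult using A.norm_chi_le[of n] B.norm_chi_le[of n]
        by (simp add: mult_le_one)
  have "norm ((\<Sum>x\<in>{1..<1 + int N}. F x) - of_nat (N div d) * (\<Sum>x\<in>{0..<int d}. F x)) \<le> real d * 1"
    by (rule sum_periodic_bound[OF d0]) (auto simp: F_def nf)
  also have "(\<Sum>x\<in>{0..<int d}. F x) = (\<Sum>b<d. f b)"
    by (rule sum.reindex_bij_witness[of _ int nat]) (auto simp: Ff [symmetric])
  also have "(\<Sum>x\<in>{1..<1 + int N}. F x) = (\<Sum>n=1..N. f n)"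
    by (rule sum.reindex_bij_witness[of _ int nat]) (auto simp: Ff [symmetric])
  finally have "norm (\<Sum>n=1..N. f n) \<le> real d" by (simp add: zero)
  also have "real d = real q1 * real q2" by (simp add: d_def)
  also have "\<dots> \<le> Q * Q" using q1 q2 by (intro mult_mono) auto
  finally show ?thesis by (simp add: f_def power2_eq_square)
qed

text \<open>Duality by hand: Cauchy-Schwarz moves the problem to the dual sums \<open>T n\<close>,
  whose mean square is expanded by orthogonality into \<open>N\<close> on the diagonal and
  \<open>Q ^ 2\<close> off it. The resulting inequality \<open>V ^ 2 <= K * b2 * V\<close> is
  divided by \<open>V\<close>.\<close>

lemma F3_large_sieve:
  fixes b :: "nat \<Rightarrow> complex"
  shows "(\<Sum>chi\<in>F3 Q. norm (\<Sum>n=1..N. b n * chi n) ^ 2) \<le>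
    (real N + Q ^ 2 * real (card (F3 Q))) * (\<Sum>n=1..N. norm (b n) ^ 2)"
proof -
  define B where "B chi = (\<Sum>n=1..N. b n * chi n)" for chi
  define V where "V = (\<Sum>chi\<in>F3 Q. norm (B chi) ^ 2)"
  define T where "T n = (\<Sum>chi\<in>F3 Q. cnj (B chi) * chi n)" for n
  define K where "K = real N + Q ^ 2 * real (card (F3 Q))"
  define b2 where "b2 = (\<Sum>n=1..N. norm (b n) ^ 2)"
  have V0: "V \<ge> 0" unfolding V_def by (intro sum_nonneg) auto
  have K0: "K \<ge> 0" by (simp add: K_def)
  have "complex_of_real V = (\<Sum>chi\<in>F3 Q. cnj (B chi) * B chi)"
    unfolding V_def of_real_sum complex_norm_square by (simp only: mult.commute)
  also have "\<dots> = (\<Sum>chi\<in>F3 Q. \<Sum>n=1..N. b n * (cnj (B chi) * chi n))"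
    by (intro sum.cong refl) (subst (2) B_def, simp add: sum_distrib_left mult_ac)
  also have "\<dots> = (\<Sum>n=1..N. b n * T n)" by (subst sum.swap) (simp add: T_def sum_distrib_left)
  finally have VT: "complex_of_real V = (\<Sum>n=1..N. b n * T n)" .
  have "V = norm (complex_of_real V)" using V0 by simp
  also have "\<dots> \<le> (\<Sum>n=1..N. norm (b n) * norm (T n))"
    unfolding VT by (rule order_trans[OF norm_sum]) (simp add: norm_mult)
  finally have "V ^ 2 \<le> (\<Sum>n=1..N. norm (b n) * norm (T n)) ^ 2" using V0 by (intro power_mono)
  also have "\<dots> \<le> b2 * (\<Sum>n=1..N. norm (T n) ^ 2)" unfolding b2_def by (rule Cauchy_Schwarz_ineq_sum)
  also have "(\<Sum>n=1..N. norm (T n) ^ 2) \<le> K * V"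
  proof -
    have "complex_of_real (\<Sum>n=1..N. norm (T n) ^ 2)
        = (\<Sum>n=1..N. \<Sum>chi\<in>F3 Q. \<Sum>chi'\<in>F3 Q. (cnj (B chi) * B chi') * (chi n * cnj (chi' n)))"
    proof -
      have "complex_of_real (norm (T n) ^ 2) = (\<Sum>chi\<in>F3 Q. \<Sum>chi'\<in>F3 Q. (cnj (B chi) * B chi')
          * (chi n * cnj (chi' n)))" for n
      proof -
        have "complex_of_real (norm (T n) ^ 2) = T n * cnj (T n)" by (rule complex_norm_square)
        also have "\<dots> = (\<Sum>chi\<in>F3 Q. \<Sum>chi'\<in>F3 Q. (cnj (B chi) * chi n) * (B chi' * cnj (chi' n)))"
          by (simp add: T_def sum_product)
        finally show ?thesis by (simp add: mult_ac)
      qed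
      then show ?thesis by simp
    qed
    also have "\<dots> = (\<Sum>chi\<in>F3 Q. \<Sum>chi'\<in>F3 Q. (cnj (B chi) * B chi') * (\<Sum>n=1..N. chi n
        * cnj (chi' n)))"
      by (simp only: sum.swap[of _ "F3 Q" "{1..N}"] sum_distrib_left)
    finally have eq: "complex_of_real (\<Sum>n=1..N. norm (T n) ^ 2) = \<dots>" .
    have "(\<Sum>n=1..N. norm (T n) ^ 2) = norm (complex_of_real (\<Sum>n=1..N. norm (T n) ^ 2))"
      by (subst norm_of_real) (simp add: sum_nonneg)
    also have "\<dots> \<le> (\<Sum>chi\<in>F3 Q. \<Sum>chi'\<in>F3 Q. (norm (B chi) * norm (B chi')) * ((if chi'
        = chi then real N else 0) + Q ^ 2))"
      unfolding eq
    proof (intro order_trans[OF norm_sum] sum_mono)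
      fix chi chi' assume c: "chi \<in> F3 Q" "chi' \<in> F3 Q"
      have "norm (\<Sum>n=1..N. chi n * cnj (chi' n)) \<le> (if chi' = chi then real N else 0) + Q ^ 2"
      proof (cases "chi' = chi")
        case True
        obtain q where q: "cubic_primitive q chi" using F3_obtain[OF c(1)] .
        have "norm (\<Sum>n=1..N. chi n * cnj (chi n)) \<le> (\<Sum>n=1..N. 1)"
          by (intro order_trans[OF norm_sum] sum_mono)
             (use cubic_primitive.norm_chi_le[OF q] in \<open>auto simp: norm_mult mult_le_one\<close>)
        also have "(\<Sum>n=1..N. 1) \<le> real N + Q ^ 2" by simp
        finally show ?thesis using True by simp
      next
        case False
        then show ?thesis using F3_orthogonality[OF c] by auto
      qed
      then show "norm (cnj (B chi) * B chi' * (\<Sum>n=1..N. chi n * cnj (chi' n))) \<le>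
         (norm (B chi) * norm (B chi')) * ((if chi' = chi then real N else 0) + Q ^ 2)"
        by (simp only: norm_mult complex_mod_cnj) (intro mult_left_mono; simp)
    qed
    also have "\<dots> = (\<Sum>chi\<in>F3 Q. \<Sum>chi'\<in>F3 Q. if chi' = chi then norm (B chi) * norm (B chi')
        * real N else 0)
         + (\<Sum>chi\<in>F3 Q. \<Sum>chi'\<in>F3 Q. norm (B chi) * norm (B chi') * Q ^ 2)"
      unfolding sum.distrib [symmetric] by (intro sum.cong refl) (simp add: algebra_simps)
    also have "(\<Sum>chi\<in>F3 Q. \<Sum>chi'\<in>F3 Q. if chi' = chi then norm (B chi) * norm (B chi')
        * real N else 0) = real N * V"
      by (simp add: finite_F3 V_def power2_eq_square sum_distrib_left mult_ac)
    also have "(\<Sum>chi\<in>F3 Q. \<Sum>chi'\<in>F3 Q. norm (B chi) * norm (B chi') * Q ^ 2) = Q ^ 2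
        * (\<Sum>chi\<in>F3 Q. norm (B chi)) ^ 2"
      by (simp add: power2_eq_square sum_product sum_distrib_left sum_distrib_right mult_ac)
    also have "real N * V + Q ^ 2 * (\<Sum>chi\<in>F3 Q. norm (B chi)) ^ 2 \<le> real N * V + Q ^ 2
        * (real (card (F3 Q)) * V)"
      unfolding V_def using sum_squared_le_sum_of_squares[of "\<lambda>chi. norm (B chi)" "F3 Q"]
      by (intro add_left_mono mult_left_mono) (simp_all add: mult.commute)
    finally show ?thesis by (simp add: K_def algebra_simps)
  qed
  finally have "V ^ 2 \<le> b2 * (K * V)" by (simp add: b2_def mult_left_mono sum_nonneg)
  then have "V * V \<le> (K * b2) * V" by (simp add: power2_eq_square mult_ac)
  moreover have "K * b2 \<ge> 0" using K0 by (simp add: b2_def sum_nonneg)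
  ultimately have "V \<le> K * b2" using V0 by (cases "V = 0") auto
  then show ?thesis by (simp add: V_def K_def b2_def B_def)
qed

text \<open>The \<open>k\<close>-th power of the prime sum is a sum over integers up to
  \<open>M ^ k\<close>, to which the large sieve applies. An integer arises from at most
  \<open>k ^ k\<close> tuples, because each entry of such a tuple divides, hence equals, an entry of
  one fixed tuple.\<close>

theorem F3_high_moment:
  fixes c :: "nat \<Rightarrow> complex"
  assumes fin: "finite S" and S: "\<And>p. p \<in> S \<Longrightarrow> prime p" "\<And>p. p \<in> S \<Longrightarrow> p \<le> M"
  shows "(\<Sum>chi\<in>F3 Q. norm (\<Sum>p\<in>S. c p * chi p) ^ (2 * k)) \<le>
    (real M ^ k + Q ^ 2 * real (card (F3 Q))) * (real k ^ k * (\<Sum>p\<in>S. norm (c p) ^ 2) ^ k)"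
proof -
  define PS where "PS = PiE {..<k} (\<lambda>_. S)"
  have finPS: "finite PS" unfolding PS_def by (intro finite_PiE) (use fin in auto)
  define pr where "pr P = (\<Prod>i<k. P i)" for P :: "nat \<Rightarrow> nat"
  have prim: "prime (P i)" "P i \<le> M" "P i \<ge> 1" if "P \<in> PS" "i < k" for P i
    using that S prime_ge_1_nat by (auto simp: PS_def PiE_def Pi_def)
  have prR: "pr P \<in> {1..M ^ k}" if "P \<in> PS" for P
  proof -
    have "pr P \<le> (\<Prod>i<k. M)" unfolding pr_def by (rule prod_mono) (use prim[OF that] in auto)
    moreover have "pr P \<ge> (\<Prod>i<k. 1)" unfolding pr_def
        by (rule prod_mono) (use prim[OF that] in auto)
    ultimately show ?thesis by simp
  qed
  define b where "b n = (\<Sum>P\<in>{P\<in>PS. pr P = n}. \<Prod>i<k. c (P i))" for n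
  have eq: "(\<Sum>p\<in>S. c p * chi p) ^ k = (\<Sum>n=1..M ^ k. b n * chi n)" if chi: "chi \<in> F3 Q" for chi
  proof -
    obtain q where q: "cubic_primitive q chi" using F3_obtain[OF chi] .
    interpret cubic_primitive q chi by (rule q)
    have chipr: "(\<Prod>i\<in>I. chi (P i)) = chi (\<Prod>i\<in>I. P i)" if "finite I" for P :: "nat \<Rightarrow> nat" and I
      using that by (induction I rule: finite_induct) (use chi_1 in \<open>auto simp: chi_mult\<close>)
    have "(\<Sum>p\<in>S. c p * chi p) ^ k = (\<Sum>P\<in>PS. (\<Prod>i<k. c (P i)) * chi (pr P))"
      unfolding power_sum_PiE[OF fin] PS_def prod.distrib pr_def by (simp add: chipr)
    also have "\<dots> = (\<Sum>n=1..M ^ k. \<Sum>P\<in>{P\<in>PS. pr P = n}. (\<Prod>i<k. c (P i)) * chi (pr P))"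
      by (rule sum.group[symmetric]) (use finPS prR in auto)
    also have "\<dots> = (\<Sum>n=1..M ^ k. b n * chi n)"
      by (intro sum.cong refl) (simp add: b_def sum_distrib_right)
    finally show ?thesis .
  qed
  have bn: "norm (b n) ^ 2 \<le> real k ^ k * (\<Sum>P\<in>{P\<in>PS. pr P = n}. \<Prod>i<k. norm (c (P i)) ^ 2)" for n
  proof -
    define A where "A = {P\<in>PS. pr P = n}"
    have finA: "finite A" using finPS by (simp add: A_def)
    have "card A \<le> k ^ k"
    proof (cases "A = {}")
      case False
      then obtain P0 where P0: "P0 \<in> PS" "pr P0 = n" by (auto simp: A_def)
      have "A \<subseteq> PiE {..<k} (\<lambda>_. P0 ` {..<k})"
      proof
        fix P assume P: "P \<in> A"
        have "P i \<in> P0 ` {..<k}" if i: "i < k" for i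
        proof -
          have "P i dvd pr P" unfolding pr_def by (rule dvd_prodI) (use i in auto)
          also have "pr P = pr P0" using P P0 by (simp add: A_def)
          finally have "P i dvd (\<Prod>i<k. P0 i)" by (simp add: pr_def)
          moreover have "prime (P i)" using prim P i by (simp add: A_def)
          ultimately obtain j where "j < k" "P i dvd P0 j" by (auto simp: prime_dvd_prod_iff)
          then have "P i = P0 j" using prim(1)[OF P0(1)] \<open>prime (P i)\<close> primes_dvd_imp_eq by blast
          then show ?thesis using \<open>j < k\<close> by blast
        qed
        moreover have "P \<in> extensional {..<k}" using P by (auto simp: A_def PS_def PiE_def)
        ultimately show "P \<in> PiE {..<k} (\<lambda>_. P0 ` {..<k})" by (auto simp: PiE_def)
      qed
      then have "card A \<le> card (PiE {..<k} (\<lambda>_. P0 ` {..<k}))" by (intro card_mono finite_PiE) auto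
      also have "\<dots> = card (P0 ` {..<k}) ^ k" by (simp add: card_PiE)
      also have "\<dots> \<le> k ^ k" using card_image_le[of "{..<k}" P0] by (intro power_mono) auto
      finally show ?thesis .
    qed simp
    then have cA: "real (card A) \<le> real k ^ k" by (metis of_nat_le_iff of_nat_power)
    have "norm (b n) ^ 2 \<le> (\<Sum>P\<in>A. \<Prod>i<k. norm (c (P i))) ^ 2"
      unfolding b_def A_def [symmetric]
      by (intro power_mono order_trans[OF norm_sum]) (simp_all add: prod_norm)
    also have "\<dots> \<le> real (card A) * (\<Sum>P\<in>A. (\<Prod>i<k. norm (c (P i))) ^ 2)"
      using sum_squared_le_sum_of_squares[of "\<lambda>P. \<Prod>i<k. norm (c (P i))" A]
          by (simp add: mult.commute)
    also have "\<dots> \<le> real k ^ k * (\<Sum>P\<in>A. (\<Prod>i<k. norm (c (P i))) ^ 2)"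
      by (intro mult_right_mono cA sum_nonneg) auto
    finally show ?thesis by (simp add: A_def prod_power_distrib)
  qed
  have "(\<Sum>chi\<in>F3 Q. norm (\<Sum>p\<in>S. c p * chi p) ^ (2 * k)) = (\<Sum>chi\<in>F3 Q. norm (\<Sum>n=1..M ^ k. b n
      * chi n) ^ 2)"
  proof (intro sum.cong refl)
    fix chi assume chi: "chi \<in> F3 Q"
    have "norm (\<Sum>p\<in>S. c p * chi p) ^ (2 * k) = norm ((\<Sum>p\<in>S. c p * chi p) ^ k) ^ 2"
      by (simp only: norm_power power_mult [symmetric] mult.commute)
    then show "norm (\<Sum>p\<in>S. c p * chi p) ^ (2 * k) = norm (\<Sum>n=1..M ^ k. b n * chi n) ^ 2"
      by (simp only: eq[OF chi])
  qed
  also have "\<dots> \<le> (real (M ^ k) + Q ^ 2 * real (card (F3 Q))) * (\<Sum>n=1..M ^ k. norm (b n) ^ 2)"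
    by (rule F3_large_sieve)
  also have "(\<Sum>n=1..M ^ k. norm (b n) ^ 2) \<le> (\<Sum>n=1..M ^ k. real k ^ k * (\<Sum>P\<in>{P\<in>PS. pr P
      = n}. \<Prod>i<k. norm (c (P i)) ^ 2))"
    by (intro sum_mono bn)
  also have "\<dots> = real k ^ k * (\<Sum>P\<in>PS. \<Prod>i<k. norm (c (P i)) ^ 2)"
    unfolding sum_distrib_left [symmetric]
    by (subst sum.group) (use finPS prR in auto)
  also have "(\<Sum>P\<in>PS. \<Prod>i<k. norm (c (P i)) ^ 2) = (\<Sum>p\<in>S. norm (c p) ^ 2) ^ k"
    unfolding power_sum_PiE[OF fin] PS_def ..
  finally show ?thesis by (simp add: mult_left_mono)
qed

section \<open>Sums over primes and smooth numbers\<close>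

lemma prod_primes_dvd:
  fixes m :: nat
  assumes "finite A" "\<And>p. p \<in> A \<Longrightarrow> prime p" "\<And>p. p \<in> A \<Longrightarrow> p dvd m"
  shows "\<Prod>A dvd m"
  using assms
proof (induction A rule: finite_induct)
  case (insert p A)
  have "coprime p (\<Prod>A)"
    using insert by (intro prod_coprime_right) (auto intro: primes_coprime)
  then show ?case using insert by (simp add: divides_mult)
qed simp

text \<open>Chebyshev's argument: all these primes divide the central binomial coefficient, which is
  at most \<open>4 ^ n\<close>; the constant comes from \<open>ln 2 <= 1\<close>.\<close>

lemma sum_ln_primes_block:
  "(\<Sum>p | prime p \<and> n < p \<and> p \<le> 2 * n. ln (real p)) \<le> 2 * real n"
proof -
  define A where "A = {p. prime p \<and> n < p \<and> p \<le> 2 * n}"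
  have fin: "finite A" by (rule finite_subset[of _ "{..2 * n}"]) (auto simp: A_def)
  have "\<Prod>A dvd (2 * n choose n)"
  proof (rule prod_primes_dvd[OF fin])
    fix p assume p: "p \<in> A"
    show "prime p" using p by (simp add: A_def)
    note \<open>prime p\<close>
    have "fact n * fact (2 * n - n) * (2 * n choose n) = (fact (2 * n) :: nat)"
      by (rule binomial_fact_lemma) simp
    moreover have "p dvd fact (2 * n)" using p by (simp add: A_def prime_dvd_fact_iff)
    moreover have "\<not> p dvd fact n" using p by (simp add: A_def prime_dvd_fact_iff)
    ultimately have "p dvd fact n * fact (2 * n - n) * (2 * n choose n)" "\<not> p dvd fact (2
        * n - n)" by simp_all
    then show "p dvd (2 * n choose n)" using \<open>prime p\<close> \<open>\<not> p dvd fact n\<close>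
      by (simp only: prime_dvd_mult_iff simp_thms)
  qed
  then have "\<Prod>A \<le> (2 * n choose n)" by (rule dvd_imp_le) simp
  also have "\<dots> \<le> (\<Sum>k\<le>2 * n. (2 * n choose k))"
    by (rule member_le_sum) auto
  also have "\<dots> = 4 ^ n" by (simp add: choose_row_sum power_mult)
  finally have le: "real (\<Prod>A) \<le> 4 ^ n" by (metis of_nat_le_iff of_nat_numeral of_nat_power)
  have pos: "p > 0" if "p \<in> A" for p using that by (simp add: A_def prime_gt_0_nat)
  have "(\<Sum>p\<in>A. ln (real p)) = ln (\<Prod>p\<in>A. real p)"
    using pos by (subst ln_prod) (auto intro: fin)
  also have "(\<Prod>p\<in>A. real p) = real (\<Prod>A)" by simp
  also have "ln \<dots> \<le> ln (4 ^ n)" using le pos by (subst ln_le_cancel_iff) (auto intro!: prod_pos)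
  also have "\<dots> = real n * ln (2 ^ 2)" by (simp add: ln_realpow)
  also have "ln (2 ^ 2 :: real) = 2 * ln 2" by (subst ln_realpow) auto
  also have "real n * (2 * ln 2) \<le> real n * 2"
    using ln_le_minus_one[of 2] by (intro mult_left_mono) auto
  finally show ?thesis by (simp add: A_def mult.commute)
qed

definition prime_block :: "real \<Rightarrow> nat set" where
  "prime_block P = {p. prime p \<and> P < real p \<and> real p \<le> 2 * P}"

lemma finite_prime_block: "finite (prime_block P)"
  by (rule finite_subset[of _ "{..nat \<lfloor>2 * P\<rfloor>}"]) (auto simp: prime_block_def le_nat_floor)

lemma card_prime_block:
  assumes "P \<ge> 1"
  shows "real (card (prime_block P)) * ln P \<le> 4 * P"
proof -
  define n where "n = nat \<lfloor>P\<rfloor>"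
  have n: "real n \<le> P" "P < real n + 1" using assms by (auto simp: n_def)
  define A where "A = {p. prime p \<and> n < p \<and> p \<le> 2 * n}"
  have fin: "finite A" by (rule finite_subset[of _ "{..2 * n}"]) (auto simp: A_def)
  \<comment> \<open>For real \<open>P\<close> with integer part \<open>n\<close>, the block from
    \<open>P\<close> to \<open>2 * P\<close> may reach the one further integer
    \<open>2 * n + 1\<close>.\<close>
  have sub: "prime_block P \<subseteq> insert (2 * n + 1) A"
  proof
    fix p assume p: "p \<in> prime_block P"
    then have "real n < real p" "real p < real (2 * n + 2)" using n by (auto simp: prime_block_def)
    then have "n < p" "p < 2 * n + 2" by linarith+
    then show "p \<in> insert (2 * n + 1) A" using p by (auto simp: A_def prime_block_def)
  qed
  have "card (prime_block P) \<le> card (insert (2 * n + 1) A)"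
      by (rule card_mono) (use fin sub in auto)
  also have "\<dots> = card A + 1" using fin by (subst card_insert_disjoint) (auto simp: A_def)
  finally have c: "real (card (prime_block P)) \<le> real (card A) + 1" by linarith
  have "real (card (prime_block P)) * ln P \<le> (real (card A) + 1) * ln P"
    using assms c by (intro mult_right_mono) auto
  also have "\<dots> = (\<Sum>p\<in>A. ln P) + ln P" by (simp add: algebra_simps)
  also have "(\<Sum>p\<in>A. ln P) \<le> (\<Sum>p\<in>A. ln (real p))"
  proof (intro sum_mono)
    fix p assume "p \<in> A"
    then have "real n + 1 \<le> real p" by (auto simp: A_def)
    then show "ln P \<le> ln (real p)" using n assms by simp
  qed
  also have "\<dots> \<le> 2 * real n" unfolding A_def by (rule sum_ln_primes_block)
  also have "ln P \<le> P" using ln_le_minus_one[of P] assms by linarith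
  finally show ?thesis using n by linarith
qed

text \<open>Each dyadic range contributes at most 2 by Chebyshev's bound.\<close>

lemma sum_ln_over_primes_le:
  "(\<Sum>p | prime p \<and> p \<le> 2 ^ r. ln (real p) / real p) \<le> 2 * real r"
proof (induction r)
  case 0
  have "{p::nat. prime p \<and> p \<le> 2 ^ 0} = {}" by (auto dest: prime_gt_1_nat)
  then show ?case by (simp only: sum.empty)
next
  case (Suc r)
  define A where "A = {p::nat. prime p \<and> p \<le> 2 ^ r}"
  define B where "B = {p::nat. prime p \<and> 2 ^ r < p \<and> p \<le> 2 * 2 ^ r}"
  have fin: "finite A" "finite B"
    by (rule finite_subset[of _ "{..2 * 2 ^ r}"]; auto simp: A_def B_def)+
  have "{p::nat. prime p \<and> p \<le> 2 ^ Suc r} = A \<union> B" by (auto simp: A_def B_def)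
  moreover have "A \<inter> B = {}" by (auto simp: A_def B_def)
  ultimately have "(\<Sum>p | prime p \<and> p \<le> 2 ^ Suc r. ln (real p) / real p) =
     (\<Sum>p\<in>A. ln (real p) / real p) + (\<Sum>p\<in>B. ln (real p) / real p)"
    using fin by (simp add: sum.union_disjoint)
  also have "(\<Sum>p\<in>B. ln (real p) / real p) \<le> (\<Sum>p\<in>B. ln (real p) / 2 ^ r)"
  proof (intro sum_mono divide_left_mono)
    fix p assume p: "p \<in> B"
    then have "real (2 ^ r) < real p" unfolding of_nat_less_iff by (simp add: B_def)
    then show "2 ^ r \<le> real p" by simp
    show "ln (real p) \<ge> 0" using p by (auto simp: B_def dest: prime_gt_0_nat)
    show "0 < real p * 2 ^ r" using p by (auto simp: B_def dest: prime_gt_0_nat)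
  qed
  also have "\<dots> = (\<Sum>p\<in>B. ln (real p)) / 2 ^ r" by (simp add: sum_divide_distrib)
  also have "\<dots> \<le> 2 * real (2 ^ r) / 2 ^ r"
    unfolding B_def by (intro divide_right_mono sum_ln_primes_block) auto
  finally show ?case using Suc by (simp add: A_def)
qed

lemma sum_inverse_le: "(\<Sum>m=1..K. 1 / real m) \<le> 1 + ln (real K)" if "K \<ge> 1"
  using that
proof (induction K rule: dec_induct)
  case (step K)
  have "ln (1 - 1 / real (Suc K)) \<le> - (1 / real (Suc K))"
    using ln_le_minus_one[of "1 - 1 / real (Suc K)"] step by simp
  also have "1 - 1 / real (Suc K) = real K / real (Suc K)" by (simp add: field_simps)
  also have "ln \<dots> = ln (real K) - ln (real (Suc K))" using step by (subst ln_div) auto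
  finally show ?case using step by simp
qed simp

lemma sum_geometric_le:
  fixes x :: real
  assumes "0 \<le> x" "x \<le> 1 / 2"
  shows "(\<Sum>a=1..N. x ^ a) \<le> 2 * x"
proof (cases "N \<ge> 1")
  case True
  then have "(\<Sum>a=1..N. x ^ a) \<le> 2 * x - x ^ N"
  proof (induction N rule: dec_induct)
    case (step N)
    have "x * x ^ N \<le> 1 / 2 * x ^ N" using assms by (intro mult_right_mono) auto
    then show ?case using step by simp
  qed simp
  then show ?thesis using assms zero_le_power[of x N] by linarith
qed (use assms in auto)

section \<open>Reciprocal sums over smooth numbers\<close>

definition smooth_upto :: "nat \<Rightarrow> nat \<Rightarrow> nat set" where
  "smooth_upto N B = {m. 1 \<le> m \<and> m \<le> N \<and> (\<forall>p. prime p \<and> p dvd m \<longrightarrow> p \<le> B)}"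

lemma finite_smooth_upto: "finite (smooth_upto N B)"
  by (rule finite_subset[of _ "{..N}"]) (auto simp: smooth_upto_def)

lemma smooth_upto_dvd:
  assumes "m \<in> smooth_upto N B" "d dvd m"
  shows "d \<in> smooth_upto N B"
proof -
  have m: "m > 0" "m \<le> N" using assms(1) by (auto simp: smooth_upto_def)
  then have "d > 0" "d \<le> N" using assms(2) dvd_imp_le[OF assms(2)] by (auto intro: Nat.gr0I)
  then show ?thesis using assms dvd_trans by (auto simp: smooth_upto_def)
qed

text \<open>Only prime powers contribute, and by a geometric series the higher powers at most double
  the sum of \<open>ln p / p\<close> over the primes.\<close>

lemma sum_mangoldt_smooth:
  "(\<Sum>d\<in>smooth_upto N (2 ^ r). mangoldt d / real d) \<le> 4 * real r"
proof -
  define M where "M = smooth_upto N (2 ^ r)"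
  define A where "A = {p::nat. prime p \<and> p \<le> 2 ^ r}"
  have finA: "finite A" by (rule finite_subset[of _ "{..2 ^ r}"]) (auto simp: A_def)
  have "(\<Sum>d\<in>M. mangoldt d / real d) = (\<Sum>d\<in>{d\<in>M. primepow d}. mangoldt d / real d)"
    by (intro sum.mono_neutral_right) (auto simp: M_def finite_smooth_upto mangoldt_def)
  also have "\<dots> \<le> (\<Sum>d\<in>(\<lambda>(p, a). p ^ a) ` (A \<times> {1..N}). mangoldt d / real d)"
  proof (rule sum_mono2)
    show "{d\<in>M. primepow d} \<subseteq> (\<lambda>(p, a). p ^ a) ` (A \<times> {1..N})"
    proof
      fix d assume d: "d \<in> {d\<in>M. primepow d}"
      then obtain p a where pa: "prime p" "a > 0" "d = p ^ a" by (auto simp: primepow_def)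
      have "p dvd d" using pa by simp
      then have "p \<in> A" using d pa by (auto simp: A_def M_def smooth_upto_def)
      have "a < 2 ^ a" by simp
      also have "\<dots> \<le> p ^ a" using prime_ge_2_nat[OF pa(1)] by (intro power_mono) auto
      also have "\<dots> \<le> N" using d pa by (auto simp: M_def smooth_upto_def)
      finally show "d \<in> (\<lambda>(p, a). p ^ a) ` (A \<times> {1..N})" using pa \<open>p \<in> A\<close> by force
    qed
  qed (use finA in \<open>auto intro!: divide_nonneg_nonneg mangoldt_nonneg\<close>)
  also have "\<dots> \<le> (\<Sum>x\<in>A \<times> {1..N}. ((\<lambda>d. mangoldt d / real d) \<circ> (\<lambda>(p, a). p ^ a)) x)"
    by (rule sum_image_le) (use finA in \<open>auto intro!: divide_nonneg_nonneg mangoldt_nonneg\<close>)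
  also have "\<dots> = (\<Sum>(p, a)\<in>A \<times> {1..N}. mangoldt (p ^ a) / real (p ^ a))"
    by (simp add: o_def case_prod_unfold)
  also have "\<dots> = (\<Sum>p\<in>A. \<Sum>a=1..N. ln (real p) * (1 / real p) ^ a)"
    unfolding sum.cartesian_product [symmetric]
    by (intro sum.cong refl) (auto simp: A_def power_divide)
  also have "\<dots> \<le> (\<Sum>p\<in>A. 2 * (ln (real p) / real p))"
  proof (intro sum_mono)
    fix p assume "p \<in> A"
    then have p: "prime p" "p \<ge> 2" using prime_ge_2_nat by (auto simp: A_def)
    have "(\<Sum>a=1..N. (1 / real p) ^ a) \<le> 2 * (1 / real p)"
      by (rule sum_geometric_le) (use p in \<open>auto simp: field_simps\<close>)
    then have "ln (real p) * (\<Sum>a=1..N. (1 / real p) ^ a) \<le> ln (real p) * (2 * (1 / real p))"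
      using p by (intro mult_left_mono) auto
    then show "(\<Sum>a=1..N. ln (real p) * (1 / real p) ^ a) \<le> 2 * (ln (real p) / real p)"
      by (simp add: sum_distrib_left mult.commute)
  qed
  also have "\<dots> \<le> 2 * (2 * real r)"
    unfolding sum_distrib_left [symmetric] A_def
        by (intro mult_left_mono sum_ln_over_primes_le) auto
  finally show ?thesis by (simp add: M_def)
qed

text \<open>For the weights \<open>1 / m\<close> the average of \<open>ln m\<close> is at most \<open>4 r\<close>, so at least half of the total weight lies on
  \<open>m\<close> with \<open>ln m \<le> 8 r\<close>.\<close>

lemma sum_smooth_le:
  assumes r: "r \<ge> 1"
  shows "(\<Sum>m\<in>smooth_upto N (2 ^ r). 1 / real m) \<le> 2 * (1 + 8 * real r)"
proof -
  define M where "M = smooth_upto N (2 ^ r)"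
  define S where "S = (\<Sum>m\<in>M. 1 / real m)"
  have fin: "finite M" by (simp add: M_def finite_smooth_upto)
  have pos: "m > 0" if "m \<in> M" for m using that by (simp add: M_def smooth_upto_def)
  \<comment> \<open>The average of \<open>ln m\<close> is controlled by writing \<open>ln\<close> as
    the divisor sum of \<open>mangoldt\<close>. Divisors and cofactors of elements of
    \<open>M\<close> stay in \<open>M\<close>, so each \<open>d\<close> contributes at most
    \<open>mangoldt d / d * S\<close>.\<close>
  have "(\<Sum>m\<in>M. ln (real m) / real m) = (\<Sum>m\<in>M. \<Sum>d\<in>{d\<in>M. d dvd m}. mangoldt d / real m)"
  proof (intro sum.cong refl)
    fix m assume m: "m \<in> M"
    have "{d\<in>M. d dvd m} = {d. d dvd m}" using smooth_upto_dvd m by (auto simp: M_def)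
    then show "ln (real m) / real m = (\<Sum>d\<in>{d\<in>M. d dvd m}. mangoldt d / real m)"
      using mangoldt_sum[of m, where ?'a = real] pos[OF m]
          by (simp add: sum_divide_distrib [symmetric])
  qed
  also have "\<dots> = (\<Sum>d\<in>M. \<Sum>m\<in>{m\<in>M. d dvd m}. mangoldt d / real m)"
    by (rule sum.swap_restrict) (use fin in auto)
  also have "\<dots> \<le> (\<Sum>d\<in>M. mangoldt d / real d * S)"
  proof (intro sum_mono)
    fix d assume d: "d \<in> M"
    have "(\<Sum>m\<in>{m\<in>M. d dvd m}. 1 / real m) = (\<Sum>m\<in>{m\<in>M. d dvd m}. 1 / real d * (1 / real (m div d)))"
      by (intro sum.cong refl) (auto simp: real_of_nat_div)
    also have "\<dots> = 1 / real d * (\<Sum>k\<in>(\<lambda>m. m div d) ` {m\<in>M. d dvd m}. 1 / real k)"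
    proof -
      have "inj_on (\<lambda>m. m div d) {m\<in>M. d dvd m}"
        by (rule inj_onI) (metis (no_types, lifting) dvd_mult_div_cancel mem_Collect_eq)
      then show ?thesis by (simp add: sum.reindex sum_distrib_left)
    qed
    also have "\<dots> \<le> 1 / real d * S"
      unfolding S_def
    proof (intro mult_left_mono sum_mono2 fin)
      show "(\<lambda>m. m div d) ` {m\<in>M. d dvd m} \<subseteq> M"
        using smooth_upto_dvd unfolding M_def by (auto elim!: dvdE)
    qed auto
    finally have "mangoldt d * (\<Sum>m\<in>{m\<in>M. d dvd m}. 1 / real m) \<le> mangoldt d * (1 / real d * S)"
      by (intro mult_left_mono mangoldt_nonneg)
    then show "(\<Sum>m\<in>{m\<in>M. d dvd m}. mangoldt d / real m) \<le> mangoldt d / real d * S"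
      by (simp add: sum_distrib_left)
  qed
  also have "\<dots> = (\<Sum>d\<in>M. mangoldt d / real d) * S" by (simp add: sum_distrib_right)
  also have "\<dots> \<le> (4 * real r) * S"
    unfolding M_def by (intro mult_right_mono sum_mangoldt_smooth) (auto simp: S_def intro:
        sum_nonneg)
  finally have key: "(\<Sum>m\<in>M. ln (real m) / real m) \<le> 4 * real r * S" .
  define K where "K = nat \<lfloor>exp (8 * real r)\<rfloor>"
  have K1: "K \<ge> 1" by (simp add: K_def le_nat_floor)
  have "S \<le> (\<Sum>m\<in>M. (if ln (real m) \<le> 8 * real r then 1 / real m else 0)
      + (ln (real m) / real m) / (8 * real r))"
    unfolding S_def
  proof (intro sum_mono)
    fix m assume m: "m \<in> M"
    show "1 / real m \<le> (if ln (real m) \<le> 8 * real r then 1 / real m else 0)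
        + (ln (real m) / real m) / (8 * real r)"
    proof (cases "ln (real m) \<le> 8 * real r")
      case True
      then show ?thesis using pos[OF m] r by simp
    next
      case False
      then have "1 \<le> ln (real m) / (8 * real r)" using r by simp
      then have "1 / real m \<le> ln (real m) / (8 * real r) / real m" using pos[OF m]
          by (intro divide_right_mono) auto
      then show ?thesis using False by (simp add: field_simps)
    qed
  qed
  also have "\<dots> = (\<Sum>m\<in>{m\<in>M. ln (real m) \<le> 8 * real r}. 1 / real m)
      + (\<Sum>m\<in>M. ln (real m) / real m) / (8 * real r)"
    using fin by (simp add: sum.distrib sum_divide_distrib sum.inter_filter)
  also have "(\<Sum>m\<in>{m\<in>M. ln (real m) \<le> 8 * real r}. 1 / real m) \<le> (\<Sum>m=1..K. 1 / real m)"
  proof (rule sum_mono2)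
    show "{m\<in>M. ln (real m) \<le> 8 * real r} \<subseteq> {1..K}"
    proof
      fix m assume m: "m \<in> {m\<in>M. ln (real m) \<le> 8 * real r}"
      then have "real m = exp (ln (real m))" using pos[of m] by simp
      also have "\<dots> \<le> exp (8 * real r)" using m by simp
      finally have "real m \<le> exp (8 * real r)" .
      then show "m \<in> {1..K}" using m pos[of m] by (auto simp: K_def le_nat_floor)
    qed
  qed auto
  also have "\<dots> \<le> 1 + ln (real K)" by (rule sum_inverse_le[OF K1])
  also have "ln (real K) \<le> ln (exp (8 * real r))"
    using K1 by (subst ln_le_cancel_iff) (auto simp: K_def)
  also have "(\<Sum>m\<in>M. ln (real m) / real m) / (8 * real r) \<le> (4 * real r * S) / (8 * real r)"
    using key by (intro divide_right_mono) auto
  also have "\<dots> = S / 2" using r by simp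
  finally show ?thesis by (simp add: S_def M_def)
qed

section \<open>Splitting the rough sum according to the largest prime factor\<close>

lemma lpf_upper: "p \<in> prime_factors n \<Longrightarrow> p \<le> largest_prime_factor n"
  unfolding largest_prime_factor_def by (intro Max_ge) auto

lemma lpf_prime:
  assumes "largest_prime_factor n > 1"
  shows "prime (largest_prime_factor n)" "largest_prime_factor n dvd n"
proof -
  have "largest_prime_factor n \<in> insert 1 (prime_factors n)"
    unfolding largest_prime_factor_def by (intro Max_in) auto
  then have "largest_prime_factor n \<in> prime_factors n" using assms by auto
  then show "prime (largest_prime_factor n)" "largest_prime_factor n dvd n" by auto
qed

lemma lpf_eqI:
  assumes "p \<in> prime_factors n" "\<And>q. q \<in> prime_factors n \<Longrightarrow> q \<le> p"
  shows "largest_prime_factor n = p"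
proof (rule antisym)
  have "p \<ge> 1" using assms(1) prime_ge_1_nat by auto
  then show "largest_prime_factor n \<le> p" unfolding largest_prime_factor_def using assms(2)
      by (subst Max_le_iff) auto
  show "p \<le> largest_prime_factor n" by (rule lpf_upper[OF assms(1)])
qed

lemma lpf_mult:
  assumes "m > 0" "prime p" "largest_prime_factor m \<le> p"
  shows "largest_prime_factor (m * p) = p"
proof (rule lpf_eqI)
  have pf: "prime_factors (m * p) = insert p (prime_factors m)"
    using assms by (subst prime_factors_product) (auto simp: prime_prime_factors dest:
        prime_gt_0_nat)
  then show "p \<in> prime_factors (m * p)" by simp
  fix q assume "q \<in> prime_factors (m * p)"
  then show "q \<le> p" using pf lpf_upper[of q m] assms(3) by auto
qed

lemma lpf_cofactor:
  assumes "n > 0" "p = largest_prime_factor n" "p > 1"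
  shows "largest_prime_factor (n div p) \<le> p" "n div p > 0" "n div p * p = n"
proof -
  have d: "p dvd n" "prime p" using lpf_prime[of n] assms by auto
  then show "n div p * p = n" by simp
  then show pos: "n div p > 0" using assms(1) by (cases "n div p = 0") auto
  have "q \<le> p" if "q \<in> prime_factors (n div p)" for q
  proof -
    have "q dvd n" using that \<open>n div p * p = n\<close>
        by (metis dvd_mult2 prime_factors_dvd in_prime_factors_iff)
    then have "q \<in> prime_factors n" using that assms(1) by (auto simp: in_prime_factors_iff)
    then show ?thesis using lpf_upper assms(2) by simp
  qed
  then show "largest_prime_factor (n div p) \<le> p"
    unfolding largest_prime_factor_def[of "n div p"] using assms(3) by (subst Max_le_iff) auto
qed

text \<open>The frequency is a free parameter because the factorisation \<open>n = m * p\<close>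
  replaces \<open>\<alpha>\<close> by \<open>m * \<alpha>\<close>; all later bounds have to be
  uniform in it.\<close>

definition phase :: "real \<Rightarrow> real \<Rightarrow> nat \<Rightarrow> complex" where
  "phase \<beta> t p = e (real p * \<beta>) / of_nat p powr (1 + \<i> * complex_of_real t)"

text \<open>The limits \<open>lo\<close> and \<open>hi\<close> encode the constraints that a
  cofactor \<open>m\<close> puts on \<open>p\<close>: at least the largest prime factor of
  \<open>m\<close>, with equality allowed since \<open>p\<close> may divide \<open>n\<close>
  repeatedly, and at most \<open>N div m\<close>.\<close>

definition block_sum :: "(nat \<Rightarrow> complex) \<Rightarrow> real \<Rightarrow> nat \<Rightarrow> nat \<Rightarrow> real \<Rightarrow> real \<Rightarrow> complex" where
  "block_sum f P lo hi \<beta> t = (\<Sum>p\<in>{p\<in>prime_block P. lo \<le> p \<and> p \<le> hi}. f p * phase \<beta> t p)"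

lemma norm_e [simp]: "norm (e x) = 1"
  by (simp add: e_def)

lemma norm_nat_powr: "p > 0 \<Longrightarrow> norm ((of_nat p :: complex) powr (1 + \<i> * complex_of_real t))
    = real p"
  using norm_powr_real_powr[of "of_nat p" "1 + \<i> * complex_of_real t"] by simp

lemma norm_phase: "p > 0 \<Longrightarrow> norm (phase \<beta> t p) = 1 / real p"
  by (simp add: phase_def norm_divide norm_nat_powr)

lemma phase_mult:
  assumes "m > 0" "p > 0"
  shows "phase \<beta> t (m * p) = (1 / of_nat m powr (1 + \<i> * complex_of_real t)) * phase (real m
      * \<beta>) t p"
proof -
  have "(of_nat (m * p) :: complex) powr (1 + \<i> * complex_of_real t) =
     of_nat m powr (1 + \<i> * complex_of_real t) * of_nat p powr (1 + \<i> * complex_of_real t)"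
    unfolding of_nat_mult by (rule powr_times_real) auto
  then show ?thesis by (simp add: phase_def mult_ac)
qed

lemma prime_block_cover:
  assumes "y < real p" "real p \<le> 2 ^ I * y" "prime p"
  shows "\<exists>i<I. p \<in> prime_block (2 ^ i * y)"
  using assms(2)
proof (induction I)
  case (Suc I)
  show ?case
  proof (cases "real p \<le> 2 ^ I * y")
    case True
    then show ?thesis using Suc.IH less_SucI by blast
  next
    case False
    then show ?thesis using Suc.prems assms(3) by (intro exI[of _ I]) (auto simp: prime_block_def)
  qed
qed (use assms in simp)

lemma prime_block_disjoint:
  assumes "y > 0" "p \<in> prime_block (2 ^ i * y)" "p \<in> prime_block (2 ^ j * y)"
  shows "i = j"
proof -
  have *: False if "i < j" "p \<in> prime_block (2 ^ i * y)" "p \<in> prime_block (2 ^ j * y)" for i j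
  proof -
    have "real p \<le> 2 ^ Suc i * y" using that(2) by (simp add: prime_block_def)
    also have "\<dots> \<le> 2 ^ j * y" using that(1) assms(1)
        by (intro mult_right_mono power_increasing) auto
    also have "\<dots> < real p" using that(3) by (simp add: prime_block_def)
    finally show False by simp
  qed
  show ?thesis using *[of i j] *[of j i] assms(2,3) by (cases i j rule: linorder_cases) auto
qed

text \<open>For a fixed cofactor \<open>m\<close> the primes form a block sum with limits depending
  on \<open>m\<close> and frequency \<open>m * \<alpha>\<close>, so the uniform bound
  \<open>v i\<close> applies; the weights \<open>1 / m\<close> then add up to at most
  \<open>W i\<close>.\<close>

lemma rough_sum_bound:
  fixes chi h :: "nat \<Rightarrow> complex"
  assumes y: "y \<ge> 1" and I: "Z \<le> 2 ^ I * y" and Z0: "Z \<ge> 0"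
    and mult: "\<And>m n. m > 0 \<Longrightarrow> n > 0 \<Longrightarrow> f (m * n) = f m * f n" and nf: "\<And>n. n > 0 \<Longrightarrow> norm (f n) \<le> 1"
    and f: "\<And>n. f n = chi n * h n"
    and v: "\<And>i lo hi \<beta>. i < I \<Longrightarrow> norm (block_sum f (2 ^ i * y) lo hi \<beta> t) \<le> v i"
    and W: "\<And>i. i < I \<Longrightarrow> (\<Sum>m\<in>smooth_upto (nat \<lfloor>Z\<rfloor>) (nat \<lfloor>2 * (2 ^ i * y)\<rfloor>). 1 / real m) \<le> W i"
  shows "norm (rough_sum chi h Z y t \<alpha>) \<le> (\<Sum>i<I. W i * v i)"
proof -
  define N where "N = nat \<lfloor>Z\<rfloor>"
  define A where "A = {n. 1 \<le> n \<and> real n \<le> Z \<and> real (largest_prime_factor n) > y}"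
  define Ai where "Ai i = {n. 1 \<le> n \<and> n \<le> N \<and> largest_prime_factor n \<in> prime_block (2 ^ i
      * y)}" for i
  have leN: "real n \<le> Z \<longleftrightarrow> n \<le> N" for n using Z0 by (auto simp: N_def le_nat_floor)
       linarith
  have finAi: "finite (Ai i)" for i by (rule finite_subset[of _ "{..N}"]) (auto simp: Ai_def)
  have A: "A = (\<Union>i<I. Ai i)"
  proof
    show "A \<subseteq> (\<Union>i<I. Ai i)"
    proof
      fix n assume n: "n \<in> A"
      define p where "p = largest_prime_factor n"
      have p: "y < real p" using n by (simp add: A_def p_def)
      then have "p > 1" using y by linarith
      then have "prime p" "p dvd n" using lpf_prime unfolding p_def by auto
      then have "p \<le> n" using n by (intro dvd_imp_le) (auto simp: A_def)
      then have "real p \<le> 2 ^ I * y" using n I by (auto simp: A_def)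
      from prime_block_cover[OF p this \<open>prime p\<close>] show "n \<in> (\<Union>i<I. Ai i)"
        using n by (auto simp: Ai_def A_def leN p_def)
    qed
    show "(\<Union>i<I. Ai i) \<subseteq> A"
    proof
      fix n assume "n \<in> (\<Union>i<I. Ai i)"
      then obtain i where n: "n \<in> Ai i" by blast
      then have "2 ^ i * y < real (largest_prime_factor n)" by (simp add: Ai_def prime_block_def)
      moreover have "1 * y \<le> 2 ^ i * y" using y by (intro mult_right_mono) auto
      ultimately show "n \<in> A" using n by (auto simp: Ai_def A_def leN)
    qed
  qed
  have "rough_sum chi h Z y t \<alpha> = (\<Sum>n\<in>A. f n * phase \<alpha> t n)"
    unfolding rough_sum_def A_def by (intro sum.cong refl) (simp add: f phase_def)
  also have "\<dots> = (\<Sum>i<I. \<Sum>n\<in>Ai i. f n * phase \<alpha> t n)"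
    unfolding A
  proof (rule sum.UNION_disjoint)
    show "\<forall>i\<in>{..<I}. \<forall>j\<in>{..<I}. i \<noteq> j \<longrightarrow> Ai i \<inter> Ai j = {}"
      using prime_block_disjoint[of y] y by (fastforce simp: Ai_def)
  qed (use finAi in auto)
  finally have eq: "rough_sum chi h Z y t \<alpha> = (\<Sum>i<I. \<Sum>n\<in>Ai i. f n * phase \<alpha> t n)" .
  have "norm (\<Sum>n\<in>Ai i. f n * phase \<alpha> t n) \<le> W i * v i" if i: "i < I" for i
  proof -
    define P where "P = 2 ^ i * y"
    have P1: "P \<ge> 1" unfolding P_def using y mult_mono[of 1 "2 ^ i" 1 y] by simp
    define M where "M = smooth_upto N (nat \<lfloor>2 * P\<rfloor>)"
    define T where "T m = {p\<in>prime_block P. largest_prime_factor m \<le> p \<and> p \<le> N div m}" for m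
    have finM: "finite M" by (simp add: M_def finite_smooth_upto)
    have finT: "finite (T m)" for m using finite_prime_block by (simp add: T_def)
    have bp: "prime p" "p > 1" "p \<le> nat \<lfloor>2 * P\<rfloor>" if "p \<in> prime_block P" for p
      using that by (auto simp: prime_block_def le_nat_floor dest: prime_gt_1_nat)
    have Mpos: "m > 0" if "m \<in> M" for m using that by (auto simp: M_def smooth_upto_def)
    have "(\<Sum>n\<in>Ai i. f n * phase \<alpha> t n) = (\<Sum>(m, p)\<in>Sigma M T. f (m * p) * phase \<alpha> t (m * p))"
    proof (rule sum.reindex_bij_witness[of _ "\<lambda>(m, p). m * p"
        "\<lambda>n. (n div largest_prime_factor n, largest_prime_factor n)"])
      fix n assume n: "n \<in> Ai i"
      define p where "p = largest_prime_factor n"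
      have n0: "n > 0" "n \<le> N" and pb: "p \<in> prime_block P" using n
          by (auto simp: Ai_def p_def P_def)
      note c = lpf_cofactor[OF n0(1) p_def bp(2)[OF pb]]
      show "(case (n div largest_prime_factor n, largest_prime_factor n) of (m, p) \<Rightarrow> m * p) = n"
        using c(3) by (simp add: p_def)
      show "(n div largest_prime_factor n, largest_prime_factor n) \<in> Sigma M T"
      proof (intro SigmaI)
        have "n div p \<le> N" using n0(2) div_le_dividend[of n p] by linarith
        moreover have "q \<le> nat \<lfloor>2 * P\<rfloor>" if "prime q" "q dvd n div p" for q
        proof -
          have "q \<in> prime_factors (n div p)" using that c(2) by (auto simp: in_prime_factors_iff)
          then have "q \<le> p" using lpf_upper c(1) order_trans by blast
          then show ?thesis using bp(3)[OF pb] by simp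
        qed
        ultimately show "n div largest_prime_factor n \<in> M" using c(2) n0
            by (auto simp: M_def smooth_upto_def p_def)
        have "p * (n div p) \<le> N" using c(3) n0 by (simp add: mult.commute)
        then have "p \<le> N div (n div p)" using c(2) by (simp add: less_eq_div_iff_mult_less_eq)
        then show "largest_prime_factor n \<in> T (n div largest_prime_factor n)"
          using pb c(1) by (simp add: T_def p_def)
      qed
      show "(case (n div largest_prime_factor n, largest_prime_factor n) of (m, p) \<Rightarrow> f (m * p)
          * phase \<alpha> t (m * p)) = f n * phase \<alpha> t n"
        using c(3) by (simp add: p_def)
    next
      fix mp assume "mp \<in> Sigma M T"
      then obtain m p where mp: "mp = (m, p)" "m \<in> M" "p \<in> T m" by blast
      have p: "prime p" "p > 1" "p \<in> prime_block P" "largest_prime_factor m \<le> p" "p \<le> N div m"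
        using mp bp by (auto simp: T_def)
      have l: "largest_prime_factor (m * p) = p" by (rule lpf_mult[OF Mpos[OF mp(2)] p(1,4)])
      have "p * m \<le> N" using p(5) Mpos[OF mp(2)] by (simp add: less_eq_div_iff_mult_less_eq)
      then show "(case mp of (m, p) \<Rightarrow> m * p) \<in> Ai i"
        using l p mp Mpos[OF mp(2)] by (auto simp: Ai_def P_def mult.commute)
      show "((case mp of (m, p) \<Rightarrow> m * p) div largest_prime_factor (case mp of (m, p) \<Rightarrow> m * p),
          largest_prime_factor (case mp of (m, p) \<Rightarrow> m * p)) = mp"
        using l p mp by simp
    qed
    also have "\<dots> = (\<Sum>m\<in>M. \<Sum>p\<in>T m. f (m * p) * phase \<alpha> t (m * p))"
      using finM finT by (simp add: sum.Sigma)
    also have "\<dots> = (\<Sum>m\<in>M. f m / of_nat m powr (1 + \<i> * complex_of_real t)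
        * block_sum f P (largest_prime_factor m) (N div m) (real m * \<alpha>) t)"
    proof (intro sum.cong refl)
      fix m assume m: "m \<in> M"
      show "(\<Sum>p\<in>T m. f (m * p) * phase \<alpha> t (m * p)) =
        f m / of_nat m powr (1 + \<i> * complex_of_real t)
            * block_sum f P (largest_prime_factor m) (N div m) (real m * \<alpha>) t"
        unfolding block_sum_def sum_distrib_left T_def [symmetric]
      proof (intro sum.cong refl)
        fix p assume "p \<in> T m"
        then have "p > 0" using bp(2) by (auto simp: T_def intro: less_trans)
        then show "f (m * p) * phase \<alpha> t (m * p) = f m / of_nat m powr (1 + \<i> * complex_of_real t)
            * (f p * phase (real m * \<alpha>) t p)"
          using Mpos[OF m] by (simp add: mult phase_mult)
      qed
    qed
    finally have "norm (\<Sum>n\<in>Ai i. f n * phase \<alpha> t n) \<le>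
      (\<Sum>m\<in>M. norm (f m / of_nat m powr (1 + \<i> * complex_of_real t)
          * block_sum f P (largest_prime_factor m) (N div m) (real m * \<alpha>) t))"
      by (simp only: norm_sum)
    also have "\<dots> \<le> (\<Sum>m\<in>M. 1 / real m * v i)"
    proof (intro sum_mono)
      fix m assume m: "m \<in> M"
      have "norm (f m) / real m \<le> 1 / real m" using nf[OF Mpos[OF m]]
          by (intro divide_right_mono) auto
      then show "norm (f m / of_nat m powr (1 + \<i> * complex_of_real t)
          * block_sum f P (largest_prime_factor m) (N div m) (real m * \<alpha>) t)
         \<le> 1 / real m * v i"
        unfolding norm_mult norm_divide norm_nat_powr[OF Mpos[OF m]] P_def
        by (intro mult_mono v[OF i]) auto
    qed
    also have "\<dots> = (\<Sum>m\<in>M. 1 / real m) * v i" by (simp only: sum_distrib_right)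
    also have "\<dots> \<le> W i * v i"
    proof (intro mult_right_mono)
      show "(\<Sum>m\<in>M. 1 / real m) \<le> W i" using W[OF i] by (simp add: M_def N_def P_def)
      show "0 \<le> v i" using v[OF i, of 0 0 0] norm_ge_zero order_trans by blast
    qed
    finally show ?thesis .
  qed
  then have b: "norm (\<Sum>n\<in>Ai i. f n * phase \<alpha> t n) \<le> W i * v i" if "i \<in> {..<I}" for i
    using that by simp
  show ?thesis unfolding eq by (rule order_trans[OF norm_sum sum_mono[OF b]])
qed

section \<open>Discretising the frequency, the twist and the range of primes\<close>

lemma norm_cis_diff_le: "norm (cis a - cis b) \<le> \<bar>a - b\<bar>"
proof -
  have "cis a - cis b = cis b * (exp (\<i> * of_real (a - b)) - 1)"
    by (simp add: cis_conv_exp algebra_simps flip: exp_add)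
  then have "norm (cis a - cis b) = norm (exp (\<i> * of_real (a - b)) - 1)" by (simp add: norm_mult)
  also have "\<dots> = 2 * \<bar>sin ((a - b) / 2)\<bar>" by (rule dist_exp_i_1)
  also have "\<dots> \<le> 2 * \<bar>(a - b) / 2\<bar>" by (intro mult_left_mono abs_sin_x_le_abs_x) auto
  finally show ?thesis by simp
qed

lemma phase_cis:
  assumes "p > 0"
  shows "phase \<beta> t p = of_real (1 / real p) * cis (2 * pi * (real p * \<beta>) - t * ln (real p))"
proof -
  have "(of_nat p :: complex) powr (1 + \<i> * complex_of_real t) = exp ((1 + \<i> * complex_of_real t)
      * of_real (ln (real p)))"
    using assms by (simp add: powr_def Ln_of_nat)
  also have "(1 + \<i> * complex_of_real t) * of_real (ln (real p)) = of_real (ln (real p)) + \<i>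
      * of_real (t * ln (real p))"
    by (simp add: algebra_simps)
  also have "exp \<dots> = of_real (real p) * cis (t * ln (real p))"
    using assms by (simp add: exp_add cis_conv_exp exp_of_real)
  finally have "(of_nat p :: complex) powr (1 + \<i> * complex_of_real t) = of_real (real p) * cis (t
      * ln (real p))" .
  moreover have "e (real p * \<beta>) = cis (2 * pi * (real p * \<beta>))"
    by (simp add: e_def cis_conv_exp mult_ac)
  ultimately show ?thesis by (simp add: phase_def cis_divide [symmetric] divide_inverse mult_ac)
qed

lemma phase_diff_le:
  assumes "p > 0"
  shows "norm (phase \<beta> t p - phase \<beta>' t' p) \<le> 2 * pi * \<bar>\<beta> - \<beta>'\<bar> + ln (real p) / real p * \<bar>t - t'\<bar>"
proof -
  define a b where "a = 2 * pi * (real p * \<beta>) - t * ln (real p)" and "b = 2 * pi * (real p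
      * \<beta>') - t' * ln (real p)"
  have "phase \<beta> t p - phase \<beta>' t' p = of_real (1 / real p) * (cis a - cis b)"
    unfolding phase_cis[OF assms] a_def b_def by (simp only: right_diff_distrib)
  then have "norm (phase \<beta> t p - phase \<beta>' t' p) = 1 / real p * norm (cis a - cis b)"
      by (simp add: norm_mult norm_divide)
  also have "\<dots> \<le> 1 / real p * \<bar>a - b\<bar>" by (intro mult_left_mono norm_cis_diff_le) auto
  also have "\<dots> \<le> 1 / real p * (2 * pi * real p * \<bar>\<beta> - \<beta>'\<bar> + ln (real p) * \<bar>t - t'\<bar>)"
  proof (intro mult_left_mono)
    have "a - b = 2 * pi * real p * (\<beta> - \<beta>') - ln (real p) * (t - t')"
        by (simp add: a_def b_def algebra_simps)
    also have "\<bar>\<dots>\<bar> \<le> \<bar>2 * pi * real p * (\<beta> - \<beta>')\<bar> + \<bar>ln (real p) * (t - t')\<bar>"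
        by (rule abs_triangle_ineq4)
    also have "\<dots> = 2 * pi * real p * \<bar>\<beta> - \<beta>'\<bar> + ln (real p) * \<bar>t - t'\<bar>" using assms
        by (simp add: abs_mult)
    finally show "\<bar>a - b\<bar> \<le> 2 * pi * real p * \<bar>\<beta> - \<beta>'\<bar> + ln (real p) * \<bar>t - t'\<bar>" .
  qed simp
  also have "\<dots> = 2 * pi * \<bar>\<beta> - \<beta>'\<bar> + ln (real p) / real p * \<bar>t - t'\<bar>" using assms
      by (simp add: field_simps)
  finally show ?thesis .
qed

lemma phase_frac: "p > 0 \<Longrightarrow> phase (frac \<beta>) t p = phase \<beta> t p"
proof -
  have "e (real p * \<beta>) = e (real p * frac \<beta>)"
  proof -
    have "real p * \<beta> = real p * frac \<beta> + real_of_int (int p * \<lfloor>\<beta>\<rfloor>)"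
        by (simp add: frac_def algebra_simps)
    then have "e (real p * \<beta>) = e (real p * frac \<beta>) * exp (2 * of_int (int p * \<lfloor>\<beta>\<rfloor>) * of_real pi
        * \<i>)"
      by (simp add: e_def exp_add [symmetric] algebra_simps)
    also have "exp (2 * of_int (int p * \<lfloor>\<beta>\<rfloor>) * of_real pi * \<i>) = 1"
      by (subst exp_eq_1) (auto simp: intro!: exI[of _ "int p * \<lfloor>\<beta>\<rfloor>"])
    finally show ?thesis by simp
  qed
  then show ?thesis by (simp add: phase_def)
qed

text \<open>The index of the subinterval of length \<open>P / J\<close> of \<open>(P, 2 P]\<close> that contains \<open>p\<close>.\<close>

definition cell :: "real \<Rightarrow> nat \<Rightarrow> nat \<Rightarrow> int" where
  "cell P J p = \<lceil>(real p - P) * real J / P\<rceil>"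

lemma cell_mono: "P > 0 \<Longrightarrow> cell P J p < cell P J q \<Longrightarrow> p < q"
proof (rule ccontr)
  assume P: "P > 0" and c: "cell P J p < cell P J q" and "\<not> p < q"
  then have "(real q - P) * real J / P \<le> (real p - P) * real J / P"
    by (intro divide_right_mono mult_right_mono) auto
  then have "cell P J q \<le> cell P J p" unfolding cell_def by (rule ceiling_mono)
  then show False using c by simp
qed

lemma cell_mono': "P > 0 \<Longrightarrow> p \<le> q \<Longrightarrow> cell P J p \<le> cell P J q"
  using cell_mono[of P J q p] by linarith

lemma cell_range:
  assumes "P > 0" "J > 0" "p \<in> prime_block P"
  shows "1 \<le> cell P J p" "cell P J p \<le> int J"
proof -
  have p: "P < real p" "real p \<le> 2 * P" using assms(3) by (auto simp: prime_block_def)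
  have "0 < (real p - P) * real J / P" using p assms by (intro divide_pos_pos mult_pos_pos) auto
  then have "0 < cell P J p" unfolding cell_def by simp
  then show "1 \<le> cell P J p" by simp
  have "(real p - P) * real J / P \<le> P * real J / P" using p assms
      by (intro divide_right_mono mult_right_mono) auto
  also have "\<dots> = real J" using assms by simp
  finally show "cell P J p \<le> int J" unfolding cell_def by (simp add: ceiling_le_iff)
qed

text \<open>All integers of the cell are counted. Since each term of a block sum has size at most
  \<open>1 / P\<close>, one cell then costs only \<open>1 / J + 1 / P\<close>.\<close>

lemma card_cell:
  assumes "P > 0" "J > 0"
  shows "real (card {p\<in>prime_block P. cell P J p = c}) \<le> P / real J + 1"
proof (cases "{p\<in>prime_block P. cell P J p = c} = {}")
  case False
  then obtain p0 where p0: "p0 \<in> prime_block P" "cell P J p0 = c" by blast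
  then have c1: "c \<ge> 1" using cell_range[OF assms] by blast
  define a b where "a = P + (real_of_int c - 1) * P / real J" and "b = P + real_of_int c
      * P / real J"
  have a0: "a \<ge> 0" unfolding a_def using assms c1
      by (intro add_nonneg_nonneg divide_nonneg_nonneg mult_nonneg_nonneg) auto
  have ab: "b - a = P / real J" by (simp add: a_def b_def left_diff_distrib diff_divide_distrib)
  have sub: "{p\<in>prime_block P. cell P J p = c} \<subseteq> {nat \<lfloor>a\<rfloor><..nat \<lfloor>b\<rfloor>}"
  proof
    fix p assume "p \<in> {p\<in>prime_block P. cell P J p = c}"
    then have "real_of_int c - 1 < (real p - P) * real J / P" "(real p - P) * real J / P
        \<le> real_of_int c"
      unfolding cell_def by (auto simp: ceiling_eq_iff)
    then have "a < real p" "real p \<le> b" using assms by (auto simp: a_def b_def field_simps)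
    then show "p \<in> {nat \<lfloor>a\<rfloor><..nat \<lfloor>b\<rfloor>}" using a0
        by (auto simp: le_nat_floor nat_less_iff floor_less_iff)
  qed
  have "card {p\<in>prime_block P. cell P J p = c} \<le> card {nat \<lfloor>a\<rfloor><..nat \<lfloor>b\<rfloor>}"
      by (rule card_mono) (use sub in auto)
  also have "\<dots> = nat \<lfloor>b\<rfloor> - nat \<lfloor>a\<rfloor>" by simp
  finally have "real (card {p\<in>prime_block P. cell P J p = c}) \<le> real (nat \<lfloor>b\<rfloor> - nat \<lfloor>a\<rfloor>)" by simp
  also have "\<dots> \<le> b - a + 1"
  proof -
    have "P / real J > 0" using assms by simp
    then have "a \<le> b" using ab by linarith
    then have "nat \<lfloor>a\<rfloor> \<le> nat \<lfloor>b\<rfloor>" by (intro nat_mono floor_mono)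
    then have "real (nat \<lfloor>b\<rfloor> - nat \<lfloor>a\<rfloor>) = real (nat \<lfloor>b\<rfloor>) - real (nat \<lfloor>a\<rfloor>)" by (rule of_nat_diff)
    moreover have "real (nat \<lfloor>b\<rfloor>) \<le> b" "a - 1 \<le> real (nat \<lfloor>a\<rfloor>)" using a0 \<open>a \<le> b\<close> by linarith+
    ultimately show ?thesis by linarith
  qed
  finally show ?thesis by (simp add: ab)
qed (use assms in \<open>simp only: card.empty, simp\<close>)

text \<open>Two cell indices for the range of \<open>p\<close>, a frequency of spacing about
  \<open>1 / (P * J)\<close> and a twist of spacing \<open>1 / J\<close>. The frequency is finer by
  a factor \<open>P\<close> because up to \<open>O(P)\<close> terms each move by a constant times
  the frequency error.\<close>

definition grid :: "real \<Rightarrow> nat \<Rightarrow> (nat \<times> nat \<times> nat \<times> nat) set" where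
  "grid P J = {..J + 1} \<times> {..J + 1} \<times> {..<nat \<lceil>P\<rceil> * J} \<times> {..J}"

text \<open>Strict inequalities drop the cells of the two endpoints, so that the set lies inside the
  true range and misses at most two cells of it.\<close>

definition grid_set :: "real \<Rightarrow> nat \<Rightarrow> nat \<Rightarrow> nat \<Rightarrow> nat set" where
  "grid_set P J i j = {p\<in>prime_block P. int i < cell P J p \<and> cell P J p < int j}"

definition grid_phase :: "real \<Rightarrow> nat \<Rightarrow> nat \<Rightarrow> nat \<Rightarrow> nat \<Rightarrow> complex" where
  "grid_phase P J u w p = phase (real u / real (nat \<lceil>P\<rceil> * J)) (real w / real J) p"

lemma finite_grid: "finite (grid P J)" by (simp add: grid_def)

lemma card_grid:
  assumes "P \<ge> 1" "J \<ge> 1"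
  shows "real (card (grid P J)) \<le> 36 * P * real J ^ 4"
proof -
  have c: "real (nat \<lceil>P\<rceil>) \<le> 2 * P" using assms by linarith
  have "real (card (grid P J)) = (real J + 2) * ((real J + 2) * ((real (nat \<lceil>P\<rceil>) * real J)
      * (real J + 1)))"
    by (simp add: grid_def card_cartesian_product algebra_simps)
  also have "\<dots> \<le> (3 * real J) * ((3 * real J) * ((2 * P * real J) * (2 * real J)))"
    using assms c by (intro mult_mono mult_nonneg_nonneg) auto
  also have "\<dots> = 36 * P * real J ^ 4" by (simp add: power4_eq_xxxx)
  finally show ?thesis .
qed

text \<open>The dropped endpoint cells cost \<open>4 / J\<close>, where \<open>J <= P\<close> is
  used, and rounding the frequency and the twist costs \<open>(28 + 8 * ln P) / J\<close>;
  \<open>ln P >= 1\<close> combines them.\<close>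

lemma grid_approx:
  assumes P: "P \<ge> 3" and J: "J \<ge> 1" "real J \<le> P" and t: "t \<in> {0..1}" and f: "\<And>p. p > 0
      \<Longrightarrow> norm (f p) \<le> 1"
  shows "\<exists>(i, j, u, w)\<in>grid P J. norm (block_sum f P lo hi \<beta> t - (\<Sum>p\<in>grid_set P J i j. f p
      * grid_phase P J u w p)) \<le> 40 * ln P / real J"
proof -
  define L where "L = nat \<lceil>P\<rceil> * J"
  have P0: "P > 0" and cP: "P \<le> real (nat \<lceil>P\<rceil>)" using P by linarith+
  have LP: "real L \<ge> P * real J" unfolding L_def of_nat_mult using cP
      by (intro mult_right_mono) auto
  have L0: "real L > 0" using LP P J by (smt (verit) mult_pos_pos of_nat_0_less_iff less_le_trans
      zero_less_one of_nat_less_iff)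
  define u where "u = nat \<lfloor>frac \<beta> * real L\<rfloor>"
  define w where "w = nat \<lfloor>t * real J\<rfloor>"
  \<comment> \<open>Endpoints outside the block are sent to the sentinel cells 0 and
    \<open>J + 1\<close>, which contain no prime of the block.\<close>
  define clamp where "clamp c = nat (max 0 (min (int J + 1) c))" for c
  define i j where "i = clamp (cell P J lo)" and "j = clamp (cell P J hi)"
  have lnP: "ln P \<ge> 1"
  proof -
    have "exp 1 \<le> P" using exp_le P by linarith
    then show ?thesis using P0 by (subst ln_ge_iff) auto
  qed
  have u1: "real u \<le> frac \<beta> * real L" "frac \<beta> * real L < real u + 1"
    using frac_ge_0[of \<beta>] L0 by (auto simp: u_def)
  have uL: "u < L"
  proof -
    have "frac \<beta> * real L < 1 * real L" using frac_lt_1[of \<beta>] L0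
        by (intro mult_strict_right_mono) auto
    then have "real u < real L" using u1 by linarith
    then show ?thesis by simp
  qed
  have du: "\<bar>frac \<beta> - real u / real L\<bar> \<le> 1 / real L"
  proof -
    have "frac \<beta> - real u / real L = (frac \<beta> * real L - real u) / real L" using L0
        by (simp add: field_simps)
    moreover have "\<bar>frac \<beta> * real L - real u\<bar> \<le> 1" using u1 by linarith
    ultimately show ?thesis using L0 by (simp add: divide_right_mono)
  qed
  have w1: "real w \<le> t * real J" "t * real J < real w + 1" using t by (auto simp: w_def)
  have wJ: "w \<le> J"
  proof -
    have "t * real J \<le> 1 * real J" using t by (intro mult_right_mono) auto
    then show ?thesis using w1 by simp
  qed
  have dw: "\<bar>t - real w / real J\<bar> \<le> 1 / real J"
  proof -
    have "t - real w / real J = (t * real J - real w) / real J" using J by (simp add: field_simps)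
    moreover have "\<bar>t * real J - real w\<bar> \<le> 1" using w1 by linarith
    ultimately show ?thesis using J by (simp add: divide_right_mono)
  qed
  have g: "(i, j, u, w) \<in> grid P J"
    using uL wJ by (auto simp: grid_def L_def i_def j_def clamp_def)
  define I where "I = {p\<in>prime_block P. lo \<le> p \<and> p \<le> hi}"
  define S where "S = grid_set P J i j"
  have finI: "finite I" unfolding I_def using finite_prime_block by simp
  have pb: "p > 0" "P < real p" "real p \<le> 2 * P" if "p \<in> prime_block P" for p
    using that by (auto simp: prime_block_def dest: prime_gt_0_nat)
  have ci: "int (clamp c) = max 0 (min (int J + 1) c)" for c by (simp add: clamp_def)
  have SI: "S \<subseteq> I"
  proof
    fix p assume "p \<in> S"
    then have p: "p \<in> prime_block P" "int i < cell P J p" "cell P J p < int j"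
        by (auto simp: S_def grid_set_def)
    have r: "1 \<le> cell P J p" "cell P J p \<le> int J" using cell_range[OF P0 _ p(1)] J by auto
    have "cell P J lo < cell P J p" using p(2) r unfolding i_def ci by linarith
    moreover have "cell P J p < cell P J hi" using p(3) r unfolding j_def ci by linarith
    ultimately show "p \<in> I" using cell_mono[OF P0] p(1) by (force simp: I_def)
  qed
  have IS: "I - S \<subseteq> {p\<in>prime_block P. cell P J p = int i} \<union> {p\<in>prime_block P. cell P J p = int j}"
  proof
    fix p assume "p \<in> I - S"
    then have p: "p \<in> prime_block P" "lo \<le> p" "p \<le> hi" "\<not> (int i < cell P J p \<and> cell P J p < int j)"
      by (auto simp: I_def S_def grid_set_def)
    have r: "1 \<le> cell P J p" "cell P J p \<le> int J" using cell_range[OF P0 _ p(1)] J by auto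
    have "cell P J lo \<le> cell P J p" "cell P J p \<le> cell P J hi" using cell_mono'[OF P0] p by auto
    then have "cell P J p = int i \<or> cell P J p = int j" using p(4) r unfolding i_def j_def ci
        by linarith
    then show "p \<in> {p\<in>prime_block P. cell P J p = int i} \<union> {p\<in>prime_block P. cell P J p = int j}"
        using p(1) by blast
  qed
  have cIS: "real (card (I - S)) \<le> 2 * (P / real J + 1)"
  proof -
    have "card (I - S) \<le> card ({p\<in>prime_block P. cell P J p
        = int i} \<union> {p\<in>prime_block P. cell P J p = int j})"
      by (rule card_mono[OF _ IS]) (use finite_prime_block in auto)
    also have "\<dots> \<le> card {p\<in>prime_block P. cell P J p = int i} + card {p\<in>prime_block P. cell P J p
        = int j}"
      by (rule card_Un_le)
    finally have "real (card (I - S)) \<le> real (card {p\<in>prime_block P. cell P J p = int i})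
        + real (card {p\<in>prime_block P. cell P J p = int j})"
      by linarith
    also have "\<dots> \<le> (P / real J + 1) + (P / real J + 1)"
      using J by (intro add_mono card_cell P0) auto
    finally show ?thesis by simp
  qed
  define ph where "ph p = grid_phase P J u w p" for p
  have "norm (\<Sum>p\<in>I - S. f p * ph p) \<le> (\<Sum>p\<in>I - S. 1 / P)"
  proof (intro order_trans[OF norm_sum] sum_mono)
    fix p assume "p \<in> I - S"
    then have p: "p > 0" "P < real p" using pb by (auto simp: I_def)
    have "norm (f p * ph p) \<le> 1 * (1 / real p)"
      unfolding norm_mult ph_def grid_phase_def norm_phase[OF p(1)]
          by (intro mult_right_mono f p) auto
    also have "\<dots> \<le> 1 / P" using p P0 by (simp add: frac_le)
    finally show "norm (f p * ph p) \<le> 1 / P" .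
  qed
  also have "\<dots> = real (card (I - S)) / P" by simp
  also have "\<dots> \<le> 2 * (P / real J + 1) / P" using cIS P0 by (intro divide_right_mono) auto
  also have "\<dots> = 2 / real J + 2 / P" using P0 by (simp add: field_simps)
  also have "2 / P \<le> 2 / real J" using J by (intro divide_left_mono) auto
  finally have D1: "norm (\<Sum>p\<in>I - S. f p * ph p) \<le> 4 / real J" by simp
  have "norm (\<Sum>p\<in>I. f p * phase \<beta> t p - f p * ph p) \<le> (\<Sum>p\<in>I. (7 + 2 * ln P) / (P * real J))"
  proof (intro order_trans[OF norm_sum] sum_mono)
    fix p assume "p \<in> I"
    then have p: "p > 0" "P < real p" "real p \<le> 2 * P" using pb by (auto simp: I_def)
    have "norm (f p * phase \<beta> t p - f p * ph p) = norm (f p)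
        * norm (phase (frac \<beta>) t p - phase (real u / real L) (real w / real J) p)"
      unfolding phase_frac[OF p(1)] by (simp add: ph_def grid_phase_def L_def norm_mult flip:
          right_diff_distrib)
    also have "\<dots> \<le> 1 * (2 * pi * \<bar>frac \<beta> - real u / real L\<bar> + ln (real p) / real p
        * \<bar>t - real w / real J\<bar>)"
      by (intro mult_mono f p phase_diff_le) auto
    also have "\<dots> \<le> 1 * (2 * pi * (1 / real L) + ln (real p) / real p * (1 / real J))"
      using p by (intro mult_left_mono add_mono du dw) auto
    also have "\<dots> \<le> 7 * (1 / (P * real J)) + (2 * ln P) / P * (1 / real J)"
    proof -
      have A: "2 * pi * (1 / real L) \<le> 7 * (1 / (P * real J))"
        using LP P0 J L0 pi_less_4 pi_approx by (intro mult_mono divide_left_mono) (auto intro!: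
            mult_pos_pos)
      have B: "ln (real p) / real p \<le> (2 * ln P) / P"
      proof (intro frac_le)
        have "ln (real p) \<le> ln (2 * P)" using p by simp
        also have "\<dots> = ln 2 + ln P" using P0 by (simp add: ln_mult)
        also have "ln 2 \<le> ln P" using P by simp
        finally show "ln (real p) \<le> 2 * ln P" by simp
      qed (use p P P0 lnP in auto)
      show ?thesis unfolding mult_1_left by (intro add_mono A mult_right_mono B) simp
    qed
    also have "\<dots> = (7 + 2 * ln P) / (P * real J)" using P0 J by (simp add: field_simps)
    finally show "norm (f p * phase \<beta> t p - f p * ph p) \<le> (7 + 2 * ln P) / (P * real J)" .
  qed
  also have "\<dots> = real (card I) * ((7 + 2 * ln P) / (P * real J))" by simp
  also have "\<dots> \<le> (4 * P) * ((7 + 2 * ln P) / (P * real J))"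
  proof (intro mult_right_mono)
    have "real (card I) \<le> real (card (prime_block P))"
      by (intro of_nat_mono card_mono finite_prime_block) (auto simp: I_def)
    also have "\<dots> = real (card (prime_block P)) * 1" by simp
    also have "\<dots> \<le> real (card (prime_block P)) * ln P" using lnP by (intro mult_left_mono) auto
    also have "\<dots> \<le> 4 * P" by (rule card_prime_block) (use P in auto)
    finally show "real (card I) \<le> 4 * P" .
  qed (use P0 lnP in auto)
  also have "\<dots> = (28 + 8 * ln P) / real J" using P0 J by (simp add: field_simps)
  finally have D2: "norm (\<Sum>p\<in>I. f p * phase \<beta> t p - f p * ph p) \<le> (28 + 8 * ln P) / real J" .
  have "block_sum f P lo hi \<beta> t - (\<Sum>p\<in>S. f p * ph p) = (\<Sum>p\<in>I. f p * phase \<beta> t p - f p * ph p)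
      + (\<Sum>p\<in>I - S. f p * ph p)"
    using sum_diff[OF finI SI, of "\<lambda>p. f p * ph p"]
        by (simp add: block_sum_def I_def [symmetric] sum_subtractf)
  then have "norm (block_sum f P lo hi \<beta> t - (\<Sum>p\<in>S. f p * ph p)) \<le>
      norm (\<Sum>p\<in>I. f p * phase \<beta> t p - f p * ph p) + norm (\<Sum>p\<in>I - S. f p * ph p)"
    by (simp only: norm_triangle_ineq)
  also have "\<dots> \<le> (28 + 8 * ln P) / real J + 4 / real J" by (intro add_mono D1 D2)
  also have "\<dots> \<le> 40 * ln P / real J" using lnP J
      by (simp add: add_divide_distrib [symmetric] divide_right_mono)
  finally show ?thesis using g unfolding S_def ph_def by (intro bexI[of _ "(i, j, u, w)"]) auto
qed

definition good_block :: "(nat \<Rightarrow> complex) \<Rightarrow> real \<Rightarrow> real \<Rightarrow> bool" where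
  "good_block f P v \<longleftrightarrow> (\<forall>lo hi \<beta> t. t \<in> {0..1} \<longrightarrow> norm (block_sum f P lo hi \<beta> t) \<le> v)"

text \<open>Half of the threshold \<open>2 * v\<close> absorbs the discretisation error. The other
  half is tested at each grid point, where the coefficients \<open>h p * grid_phase\<close> are
  fixed and of size at most \<open>1 / P\<close>, and a union bound over the grid finishes.\<close>

lemma card_not_good:
  fixes F :: "(nat \<Rightarrow> complex) set"
  assumes fin: "finite F" and P: "P \<ge> 3" and J: "J \<ge> 1" "real J \<le> P" and err: "40 * ln P / real J
      \<le> v"
    and f: "\<And>chi p. chi \<in> F \<Longrightarrow> p > 0 \<Longrightarrow> norm (chi p) \<le> 1" "\<And>p. p > 0 \<Longrightarrow> norm (h p) \<le> 1"
    and K: "\<And>S c. S \<subseteq> prime_block P \<Longrightarrow> (\<And>p. p \<in> S \<Longrightarrow> norm (c p) \<le> 1 / P) \<Longrightarrow>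
      real (card {chi\<in>F. norm (\<Sum>p\<in>S. c p * chi p) > v}) \<le> K"
  shows "real (card {chi\<in>F. \<not> good_block (\<lambda>n. chi n * h n) P (2 * v)}) \<le> 36 * P * real J ^ 4 * K"
proof -
  define B where "B = (\<lambda>(i, j, u, w). {chi\<in>F. norm (\<Sum>p\<in>grid_set P J i j. (h p
      * grid_phase P J u w p) * chi p) > v})"
  have finB: "finite (B g)" for g using fin by (auto simp: B_def split: prod.splits)
  have "{chi\<in>F. \<not> good_block (\<lambda>n. chi n * h n) P (2 * v)} \<subseteq> (\<Union>g\<in>grid P J. B g)"
  proof
    fix chi assume "chi \<in> {chi\<in>F. \<not> good_block (\<lambda>n. chi n * h n) P (2 * v)}"
    then obtain lo hi \<beta> t where c: "chi \<in> F" "t \<in> {0..1}" "norm (block_sum (\<lambda>n. chi n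
        * h n) P lo hi \<beta> t) > 2 * v"
      by (auto simp: good_block_def not_le)
    have "norm (chi p * h p) \<le> 1" if "p > 0" for p
      unfolding norm_mult using f(1)[OF c(1) that] f(2)[OF that] by (simp add: mult_le_one)
    from grid_approx[OF P J c(2), of "\<lambda>n. chi n * h n" lo hi \<beta>, OF this]
    obtain i j u w where g: "(i, j, u, w) \<in> grid P J"
      "norm (block_sum (\<lambda>n. chi n * h n) P lo hi \<beta> t - (\<Sum>p\<in>grid_set P J i j. chi p * h p
          * grid_phase P J u w p)) \<le> 40 * ln P / real J"
      by auto
    have "norm (\<Sum>p\<in>grid_set P J i j. chi p * h p * grid_phase P J u w p) > v"
      using g(2) c(3) err norm_triangle_ineq2[of "block_sum (\<lambda>n. chi n * h n) P lo hi \<beta> t"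
          "\<Sum>p\<in>grid_set P J i j. chi p * h p * grid_phase P J u w p"]
      by linarith
    then have "chi \<in> B (i, j, u, w)" using c(1) by (simp add: B_def mult_ac)
    then show "chi \<in> (\<Union>g\<in>grid P J. B g)" using g(1) by blast
  qed
  then have "card {chi\<in>F. \<not> good_block (\<lambda>n. chi n * h n) P (2 * v)} \<le> card (\<Union>g\<in>grid P J. B g)"
    by (rule card_mono[rotated]) (use finB finite_grid in auto)
  also have "\<dots> \<le> (\<Sum>g\<in>grid P J. card (B g))" by (rule card_UN_le[OF finite_grid])
  finally have "real (card {chi\<in>F. \<not> good_block (\<lambda>n. chi n * h n) P (2 * v)})
      \<le> real (\<Sum>g\<in>grid P J. card (B g))"
    by (rule of_nat_mono)
  also have "\<dots> = (\<Sum>g\<in>grid P J. real (card (B g)))" by simp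
  also have "\<dots> \<le> (\<Sum>g\<in>grid P J. K)"
  proof (intro sum_mono)
    fix g assume "g \<in> grid P J"
    obtain i j u w where g: "g = (i, j, u, w)" by (metis prod_cases4)
    show "real (card (B g)) \<le> K" unfolding g B_def prod.case
    proof (rule K)
      show "grid_set P J i j \<subseteq> prime_block P" by (auto simp: grid_set_def)
      fix p assume "p \<in> grid_set P J i j"
      then have p: "p > 0" "P < real p" by (auto simp: grid_set_def prime_block_def dest:
          prime_gt_0_nat)
      have "norm (h p * grid_phase P J u w p) \<le> 1 * (1 / real p)"
        unfolding norm_mult grid_phase_def norm_phase[OF p(1)] by (intro mult_right_mono f p) auto
      also have "\<dots> \<le> 1 / P" using p P by (simp add: frac_le)
      finally show "norm (h p * grid_phase P J u w p) \<le> 1 / P" .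
    qed
  qed
  also have "\<dots> = real (card (grid P J)) * K" by simp
  also have "\<dots> \<le> (36 * P * real J ^ 4) * K"
  proof (intro mult_right_mono card_grid)
    have "real (card {chi\<in>F. norm (\<Sum>p\<in>{}. (0::complex) * chi p) > v}) \<le> K" by (rule K) auto
    then show "K \<ge> 0" using of_nat_0_le_iff order_trans by blast
  qed (use P J in auto)
  finally show ?thesis .
qed

section \<open>Counting the exceptional characters\<close>

lemma box_size:
  assumes "Q \<ge> 1" "X = nat \<lfloor>2 * sqrt Q\<rfloor> + 1"
  shows "real X > 2 * sqrt Q" "real (2 * X) \<le> 6 * sqrt Q" "real (2 * X) ^ 2 \<le> 36 * Q"
proof -
  have s: "sqrt Q \<ge> 1" using assms by simp
  have "real X = of_int \<lfloor>2 * sqrt Q\<rfloor> + 1" using assms s by simp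
  then show "real X > 2 * sqrt Q" and le: "real (2 * X) \<le> 6 * sqrt Q" using s by linarith+
  have "real (2 * X) ^ 2 \<le> (6 * sqrt Q) ^ 2" using le by (intro power_mono) auto
  then show "real (2 * X) ^ 2 \<le> 36 * Q" using assms by (simp add: power_mult_distrib)
qed

lemma card_F3_le:
  assumes "Q \<ge> 1" shows "real (card (F3 Q)) \<le> 36 * Q"
proof -
  define X where "X = nat \<lfloor>2 * sqrt Q\<rfloor> + 1"
  note X = box_size[OF assms X_def]
  have "(\<Sum>chi\<in>F3 Q. 1) \<le> (\<Sum>a\<in>sqbox X. \<Sum>b\<in>sqbox X. (1::real))"
    by (rule F3_sum_le_box_sum[OF X(1), where G = "\<lambda>_. 1"]) auto
  also have "\<dots> = real (2 * X) ^ 2" by (simp add: sqbox_def power2_eq_square)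
  finally show ?thesis using X(3) by simp
qed

lemma card_large_le_moment:
  fixes A :: "'a \<Rightarrow> complex"
  assumes "finite F" "v > 0" "(\<Sum>x\<in>F. norm (A x) ^ (2 * k)) \<le> B"
  shows "real (card {x\<in>F. norm (A x) > v}) \<le> B / v ^ (2 * k)"
proof -
  have "real (card {x\<in>F. norm (A x) > v}) * v ^ (2 * k) = (\<Sum>x\<in>{x\<in>F. norm (A x) > v}. v ^ (2 * k))"
      by simp
  also have "\<dots> \<le> (\<Sum>x\<in>{x\<in>F. norm (A x) > v}. norm (A x) ^ (2 * k))"
    using assms by (intro sum_mono power_mono) auto
  also have "\<dots> \<le> (\<Sum>x\<in>F. norm (A x) ^ (2 * k))" using assms by (intro sum_mono2) auto
  finally show ?thesis using assms by (simp add: pos_le_divide_eq)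
qed

lemma ln_ge_1: "P \<ge> 3 \<Longrightarrow> ln P \<ge> (1::real)"
proof -
  assume P: "P \<ge> 3"
  have "exp 1 \<le> P" using exp_le P by linarith
  then show ?thesis using P by (subst ln_ge_iff) auto
qed

text \<open>The factor \<open>ln P\<close> that Chebyshev's bound saves in the mean square cancels
  one of the two logarithms of the squared threshold, which lets \<open>k\<close> grow to a constant
  times \<open>P / ln P\<close>.\<close>

lemma block_coeff_sums:
  fixes c :: "nat \<Rightarrow> complex"
  assumes P: "P \<ge> 3" and S: "S \<subseteq> prime_block P" and c: "\<And>p. p \<in> S \<Longrightarrow> norm (c p) \<le> 1 / P"
  shows "(\<Sum>p\<in>S. norm (c p) ^ 2) \<le> 4 / (P * ln P)" "(\<Sum>p\<in>S. norm (c p)) \<le> 4"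
proof -
  have l: "ln P \<ge> 1" by (rule ln_ge_1[OF P])
  have "real (card S) \<le> real (card (prime_block P))"
    by (intro of_nat_mono card_mono finite_prime_block S)
  also have "\<dots> \<le> 4 * P / ln P" using card_prime_block[of P] P l by (simp add: pos_le_divide_eq)
  finally have cS: "real (card S) \<le> 4 * P / ln P" .
  have "(\<Sum>p\<in>S. norm (c p) ^ 2) \<le> (\<Sum>p\<in>S. (1 / P) ^ 2)" by (intro sum_mono power_mono c) auto
  also have "\<dots> = real (card S) * (1 / P) ^ 2" by simp
  also have "\<dots> \<le> 4 * P / ln P * (1 / P) ^ 2" by (intro mult_right_mono cS) auto
  also have "\<dots> = 4 / (P * ln P)" using P l by (simp add: field_simps power2_eq_square)
  finally show "(\<Sum>p\<in>S. norm (c p) ^ 2) \<le> 4 / (P * ln P)" .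
  have "(\<Sum>p\<in>S. norm (c p)) \<le> (\<Sum>p\<in>S. 1 / P)" by (intro sum_mono c)
  also have "\<dots> = real (card S) * (1 / P)" by simp
  also have "\<dots> \<le> 4 * P / ln P * (1 / P)" using P by (intro mult_right_mono cS) auto
  also have "\<dots> = 4 / ln P" using P by simp
  also have "\<dots> \<le> 4" using l by (simp add: pos_divide_le_eq)
  finally show "(\<Sum>p\<in>S. norm (c p)) \<le> 4" .
qed

lemma prime_block_props:
  assumes P: "P \<ge> 3" and S: "S \<subseteq> prime_block P" and p: "p \<in> S"
  shows "prime p" "p > 3" "p \<le> nat \<lfloor>2 * P\<rfloor>"
proof -
  have *: "prime p" "P < real p" "real p \<le> 2 * P" using S p by (auto simp: prime_block_def)
  then show "prime p" "p \<le> nat \<lfloor>2 * P\<rfloor>" by (auto simp: le_nat_floor)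
  have "3 < real p" using * P by linarith
  then show "p > 3" by simp
qed

text \<open>All primes of the block exceed 3, so reciprocity covers them. The constants multiply out
  those of \<open>box_size\<close>, \<open>cubsym_moment\<close> and
  \<open>block_coeff_sums\<close>: 144 = 36 * 4, 96 = 24 * 4, 12 = 2 * 6 and 8 = 2 * 4.\<close>

lemma count_small_primes:
  fixes c :: "nat \<Rightarrow> complex"
  assumes Q: "Q \<ge> 1" and P: "P \<ge> 3" and v: "v > 0" and k: "k > 0"
    and S: "S \<subseteq> prime_block P" and c: "\<And>p. p \<in> S \<Longrightarrow> norm (c p) \<le> 1 / P"
  shows "real (card {chi\<in>F3 Q. norm (\<Sum>p\<in>S. c p * chi p) > v}) \<le>
    (144 * Q * (96 * real k / (P * ln P)) ^ k + 12 * sqrt Q * (8 * P) ^ (2 * k)) / v ^ (2 * k)"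
proof (rule card_large_le_moment[OF finite_F3 v])
  define X where "X = nat \<lfloor>2 * sqrt Q\<rfloor> + 1"
  note X = box_size[OF Q X_def]
  have l: "ln P \<ge> 1" by (rule ln_ge_1[OF P])
  note pr = prime_block_props[OF P S]
  have finS: "finite S" using S finite_prime_block finite_subset by blast
  define M where "M = nat \<lfloor>2 * P\<rfloor>"
  have M: "M \<ge> 1" "real M \<le> 2 * P" using P by (auto simp: M_def le_nat_floor)
  have "(\<Sum>chi\<in>F3 Q. norm (\<Sum>p\<in>S. c p * chi p) ^ (2 * k)) \<le>
     (\<Sum>a\<in>sqbox X. \<Sum>b\<in>sqbox X. norm (\<Sum>p\<in>S. c p * cubsym p (Eis a b)) ^ (2 * k))"
  proof (rule F3_sum_le_box_sum[OF X(1), where G = "\<lambda>x. norm (\<Sum>p\<in>S. c p * cubsym p x) ^ (2 * k)"])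
    fix chi J assume eq: "\<And>l. prime l \<Longrightarrow> l \<noteq> 3 \<Longrightarrow> chi l = cubsym l J"
    have "(\<Sum>p\<in>S. c p * chi p) = (\<Sum>p\<in>S. c p * cubsym p J)"
      using pr eq by (intro sum.cong refl) (metis less_irrefl)
    then show "norm (\<Sum>p\<in>S. c p * chi p) ^ (2 * k) \<le> norm (\<Sum>p\<in>S. c p * cubsym p J) ^ (2 * k)" by simp
  qed simp
  also have "\<dots> \<le> real (2 * X) ^ 2 * (4 * (24 * real k * (4 / (P * ln P))) ^ k) +
      2 * real (2 * X) * real M ^ (2 * k) * (\<Sum>p\<in>S. norm (c p)) ^ (2 * k)"
    by (rule cubsym_moment[OF finS pr(1) pr(2) _ M(1) block_coeff_sums(1)[OF P S c] _ k])
       (use pr(3) P l in \<open>auto simp: M_def\<close>)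
  also have "\<dots> \<le> 36 * Q * (4 * (24 * real k * (4 / (P * ln P))) ^ k) + 2 * (6 * sqrt Q) * (2
      * P) ^ (2 * k) * 4 ^ (2 * k)"
    using X M P l Q
    by (intro add_mono mult_mono power_mono block_coeff_sums(2)[OF P S c] mult_nonneg_nonneg
        zero_le_power sum_nonneg) auto
  also have "\<dots> = 144 * Q * (96 * real k / (P * ln P)) ^ k + 12 * sqrt Q * (8 * P) ^ (2 * k)"
  proof -
    have "(2 * P) ^ (2 * k) * 4 ^ (2 * k) = (2 * P * 4) ^ (2 * k)"
        by (simp only: power_mult_distrib)
    then have "(2 * P) ^ (2 * k) * 4 ^ (2 * k) = (8 * P) ^ (2 * k)" by (simp add: mult.commute)
    moreover have "24 * real k * (4 / (P * ln P)) = 96 * real k / (P * ln P)" by simp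
    ultimately show ?thesis by (simp add: mult.assoc)
  qed
  finally show "(\<Sum>chi\<in>F3 Q. norm (\<Sum>p\<in>S. c p * chi p) ^ (2 * k)) \<le> \<dots>" .
qed

text \<open>The term \<open>36 * Q ^ 3\<close> is \<open>Q ^ 2\<close> from orthogonality times the
  bound \<open>36 * Q\<close> for the number of characters; it becomes harmless once
  \<open>P ^ k\<close> exceeds \<open>Q ^ 3\<close>.\<close>

lemma count_large_primes:
  fixes c :: "nat \<Rightarrow> complex"
  assumes Q: "Q \<ge> 1" and P: "P \<ge> 3" and v: "v > 0"
    and S: "S \<subseteq> prime_block P" and c: "\<And>p. p \<in> S \<Longrightarrow> norm (c p) \<le> 1 / P"
  shows "real (card {chi\<in>F3 Q. norm (\<Sum>p\<in>S. c p * chi p) > v}) \<le>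
    (((2 * P) ^ k + 36 * Q ^ 3) * (real k ^ k * (4 / P) ^ k)) / v ^ (2 * k)"
proof (rule card_large_le_moment[OF finite_F3 v])
  have l: "ln P \<ge> 1" by (rule ln_ge_1[OF P])
  note pr = prime_block_props[OF P S]
  have finS: "finite S" using S finite_prime_block finite_subset by blast
  define M where "M = nat \<lfloor>2 * P\<rfloor>"
  have M: "real M \<le> 2 * P" using P by (auto simp: M_def)
  have "(\<Sum>p\<in>S. norm (c p) ^ 2) \<le> 4 / (P * ln P)" by (rule block_coeff_sums(1)[OF P S c])
  also have "\<dots> \<le> 4 / (P * 1)" using P l by (intro divide_left_mono mult_left_mono) auto
  finally have s2: "(\<Sum>p\<in>S. norm (c p) ^ 2) \<le> 4 / P" by simp
  have "(\<Sum>chi\<in>F3 Q. norm (\<Sum>p\<in>S. c p * chi p) ^ (2 * k)) \<le>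
    (real M ^ k + Q ^ 2 * real (card (F3 Q))) * (real k ^ k * (\<Sum>p\<in>S. norm (c p) ^ 2) ^ k)"
    by (rule F3_high_moment[OF finS pr(1)]) (use pr(3) in \<open>auto simp: M_def\<close>)
  also have "\<dots> \<le> ((2 * P) ^ k + Q ^ 2 * (36 * Q)) * (real k ^ k * (4 / P) ^ k)"
    using M P Q by (intro mult_mono add_mono power_mono s2 card_F3_le mult_nonneg_nonneg
        add_nonneg_nonneg zero_le_power sum_nonneg) auto
  also have "Q ^ 2 * (36 * Q) = 36 * Q ^ 3" by (simp add: power2_eq_square power3_eq_cube)
  finally show "(\<Sum>chi\<in>F3 Q. norm (\<Sum>p\<in>S. c p * chi p) ^ (2 * k)) \<le> ((2 * P) ^ k + 36 * Q ^ 3)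
      * (real k ^ k * (4 / P) ^ k)" .
qed

lemma sum_smooth_le_ln:
  assumes P: "P \<ge> 3"
  shows "(\<Sum>m\<in>smooth_upto N (nat \<lfloor>2 * P\<rfloor>). 1 / real m) \<le> 60 * ln P"
proof -
  have l: "ln P \<ge> 1" by (rule ln_ge_1[OF P])
  define r where "r = nat \<lceil>log 2 (2 * P)\<rceil>"
  have lg: "log 2 (2 * P) = 1 + ln P / ln 2" using P
      by (simp add: log_def ln_mult add_divide_distrib)
  have "ln P / ln 2 \<le> ln P / (2 / 3)" using ln2_ge_two_thirds l by (intro divide_left_mono) auto
  then have lg2: "log 2 (2 * P) \<le> 1 + 3 / 2 * ln P" unfolding lg by simp
  have lg0: "log 2 (2 * P) \<ge> 1" unfolding lg using l by simp
  have r: "real r \<le> log 2 (2 * P) + 1" "log 2 (2 * P) \<le> real r" using lg0 by (auto simp: r_def)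
  have r1: "r \<ge> 1" using r lg0 by linarith
  have "2 * P = 2 powr (log 2 (2 * P))" using P by simp
  also have "\<dots> \<le> 2 powr (real r)" using r by (intro powr_mono) auto
  also have "\<dots> = real (2 ^ r)" by (simp add: powr_realpow)
  finally have "nat \<lfloor>2 * P\<rfloor> \<le> 2 ^ r" by linarith
  then have sub: "smooth_upto N (nat \<lfloor>2 * P\<rfloor>) \<subseteq> smooth_upto N (2 ^ r)"
    by (auto simp: smooth_upto_def intro: order_trans)
  have "(\<Sum>m\<in>smooth_upto N (nat \<lfloor>2 * P\<rfloor>). 1 / real m) \<le> (\<Sum>m\<in>smooth_upto N (2 ^ r). 1 / real m)"
    by (intro sum_mono2 finite_smooth_upto sub) auto
  also have "\<dots> \<le> 2 * (1 + 8 * real r)" by (rule sum_smooth_le[OF r1])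
  \<comment> \<open>Here \<open>r <= 2 + 3 / 2 * ln P\<close>, so the bound is at most
    \<open>34 + 24 * ln P\<close>.\<close>
  also have "\<dots> \<le> 60 * ln P" using r(1) lg2 l by argo
  finally show ?thesis .
qed

text \<open>With cofactor weight \<open>60 * ln P\<close> and block bound twice this threshold,
  block \<open>i\<close> contributes \<open>1 / (2 * (1 + i) ^ 2)\<close>; these add up to at most
  1, which fixes the constant 240.\<close>

definition block_threshold :: "nat \<Rightarrow> real \<Rightarrow> real" where
  "block_threshold i P = 1 / (240 * (1 + real i) ^ 2 * ln P)"

lemma sum_inverse_squares_le: "(\<Sum>i<I. 1 / (1 + real i) ^ 2) \<le> 2"
proof (cases "I \<ge> 1")
  case True
  then have "(\<Sum>i<I. 1 / (1 + real i) ^ 2) \<le> 2 - 1 / real I"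
  proof (induction I rule: dec_induct)
    case (step I)
    have "1 / (1 + real I) ^ 2 \<le> 1 / (real I * (1 + real I))"
      using step by (intro divide_left_mono) (auto simp: power2_eq_square intro!: mult_pos_pos)
    also have "\<dots> = 1 / real I - 1 / real (Suc I)" using step by (simp add: field_simps)
    finally show ?case using step by simp
  qed simp
  also have "\<dots> \<le> 2" by simp
  finally show ?thesis .
qed (cases I; simp)

lemma max_rough_sum_good:
  assumes y: "y \<ge> 3" and I: "Z \<le> 2 ^ I * y" and Z: "Z \<ge> 0"
    and chi: "chi \<in> F3 Q" and h: "completely_multiplicative h" "\<And>n. n \<ge> 1 \<Longrightarrow> norm (h n) \<le> 1"
    and g: "\<And>i. i < I \<Longrightarrow> good_block (\<lambda>n. chi n * h n) (2 ^ i * y) (2 * block_threshold i (2 ^ i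
        * y))"
  shows "\<not> max_rough_sum chi h Z y > 1"
proof -
  obtain q where q: "cubic_primitive q chi" using F3_obtain[OF chi] .
  interpret cubic_primitive q chi by (rule q)
  have P3: "2 ^ i * y \<ge> 3" for i using y mult_mono[of 1 "2 ^ i" 3 y] by simp
  have "norm (rough_sum chi h Z y t \<alpha>) \<le> 1" if t: "t \<in> {0..1}" for t \<alpha>
  proof -
    have "norm (rough_sum chi h Z y t \<alpha>) \<le> (\<Sum>i<I. (60 * ln (2 ^ i * y)) * (2
        * block_threshold i (2 ^ i * y)))"
    proof (rule rough_sum_bound[where f = "\<lambda>n. chi n * h n", OF _ I Z])
      show "chi (m * n) * h (m * n) = chi m * h m * (chi n * h n)" if "m > 0" "n > 0" for m n
        using h(1) that by (simp add: completely_multiplicative_def chi_mult)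
      show "norm (chi n * h n) \<le> 1" if "n > 0" for n
        unfolding norm_mult using norm_chi_le[of n] h(2)[of n] that by (simp add: mult_le_one)
      show "norm (block_sum (\<lambda>n. chi n * h n) (2 ^ i * y) lo hi \<beta> t) \<le> 2
          * block_threshold i (2 ^ i * y)"
        if "i < I" for i lo hi \<beta> using g[OF that] t by (auto simp: good_block_def)
      show "(\<Sum>m\<in>smooth_upto (nat \<lfloor>Z\<rfloor>) (nat \<lfloor>2 * (2 ^ i * y)\<rfloor>). 1 / real m) \<le> 60 * ln (2 ^ i
          * y)" for i
        by (rule sum_smooth_le_ln[OF P3])
    qed (use y in auto)
    also have "\<dots> = (\<Sum>i<I. 1 / 2 * (1 / (1 + real i) ^ 2))"
    proof (intro sum.cong refl)
      fix i
      have "ln (2 ^ i * y) \<ge> 1" by (rule ln_ge_1[OF P3])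
      then show "(60 * ln (2 ^ i * y)) * (2 * block_threshold i (2 ^ i * y)) = 1 / 2 * (1 / (1
          + real i) ^ 2)"
        by (simp add: block_threshold_def field_simps)
    qed
    also have "\<dots> \<le> 1 / 2 * 2" unfolding sum_distrib_left [symmetric]
      by (intro mult_left_mono sum_inverse_squares_le) auto
    finally show ?thesis by simp
  qed
  then have "\<not> 1 < norm (rough_sum chi h Z y t \<alpha>)" if "t \<in> {0..1}" for t \<alpha>
    using that by (simp add: not_less)
  then show ?thesis unfolding max_rough_sum_greater_iff by blast
qed

text \<open>Allows the factor \<open>(1 + i) ^ 2\<close> of the threshold to be traded for
  \<open>ln P ^ 2\<close>.\<close>

lemma index_le_ln:
  assumes "y \<ge> 3"
  shows "1 + real i \<le> 5 / 2 * ln (2 ^ i * y)"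
proof -
  have "ln (2 ^ i * y) = real i * ln 2 + ln y" using assms by (simp add: ln_mult ln_realpow)
  moreover have "real i * (2 / 3) \<le> real i * ln 2" using ln2_ge_two_thirds
      by (intro mult_left_mono) auto
  ultimately show ?thesis using ln_ge_1[OF assms] by linarith
qed

lemma norm_F3_le: "chi \<in> F3 Q \<Longrightarrow> norm (chi n) \<le> 1"
  using F3_obtain cubic_primitive.norm_chi_le by metis

section \<open>Exceptional characters of a single block\<close>

lemma bad_small_block:
  fixes y :: real
  assumes Q: "Q \<ge> 1" and y: "y \<ge> 3" and P: "P = 2 ^ i * y"
    and big: "60000 * ln P ^ 4 \<le> P - 1" "12000 * ln P ^ 3 \<le> P ^ 2"
    and \<delta>: "\<delta> > 0" "96 * 57600 * \<delta> * (1 + real i) ^ 5 \<le> exp (- 1) * (4 / 3) ^ i"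
    and k: "k \<ge> 11" "real k \<le> \<delta> * y / ln y"
    and h: "\<And>n. n \<ge> 1 \<Longrightarrow> norm (h n) \<le> 1"
  shows "real (card {chi\<in>F3 Q. \<not> good_block (\<lambda>n. chi n * h n) P (2 * block_threshold i P)}) \<le>
    5184 * Q * y ^ 5 * exp (- real k) * (1 / 2) ^ i + 432 * sqrt Q * P ^ (5 + 6 * k)"
proof -
  have P3: "P \<ge> 3" unfolding P using y mult_mono[of 1 "2 ^ i" 3 y] by simp
  have l: "ln P \<ge> 1" by (rule ln_ge_1[OF P3])
  have ly: "ln y \<ge> 1" by (rule ln_ge_1[OF y])
  define v where "v = block_threshold i P"
  have v0: "v > 0" unfolding v_def block_threshold_def using l
      by (intro divide_pos_pos mult_pos_pos) auto
  define u where "u = 240 * (1 + real i) ^ 2 * ln P"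
  have vu: "v = 1 / u" by (simp add: v_def block_threshold_def u_def)
  have u0: "u > 0" using v0 vu by simp
  have il: "1 + real i \<le> 5 / 2 * ln P" unfolding P by (rule index_le_ln[OF y])
  have il2: "(1 + real i) ^ 2 \<le> 25 / 4 * ln P ^ 2"
    using power_mono[OF il, of 2] by (simp add: power_mult_distrib power_divide)
  have u1: "u \<le> 1500 * ln P ^ 3"
  proof -
    have "u \<le> 240 * (25 / 4 * ln P ^ 2) * ln P" unfolding u_def using il2 l
        by (intro mult_right_mono mult_left_mono) auto
    then show ?thesis by (simp add: power2_eq_square power3_eq_cube)
  qed
  \<comment> \<open>The finest grid that \<open>grid_approx\<close> admits. It has
    \<open>O(P ^ 5)\<close> points, which the \<open>k\<close>-th power in the moment bound can
    afford.\<close>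
  define J where "J = nat \<lfloor>P\<rfloor>"
  have J: "J \<ge> 1" "real J \<le> P" "real J \<ge> P - 1" using P3 by (auto simp: J_def le_nat_floor)
  have err: "40 * ln P / real J \<le> v"
  proof -
    have "40 * ln P * u \<le> 40 * ln P * (1500 * ln P ^ 3)" using l by (intro mult_left_mono u1) auto
    also have "\<dots> = 60000 * ln P ^ 4" by (simp add: power4_eq_xxxx power3_eq_cube)
    also have "\<dots> \<le> real J" using big(1) J(3) by linarith
    finally show ?thesis unfolding vu using u0 J(1) by (simp add: field_simps)
  qed
  define K where "K = (144 * Q * (96 * real k / (P * ln P)) ^ k + 12 * sqrt Q * (8 * P) ^ (2
      * k)) / v ^ (2 * k)"
  have K0: "K \<ge> 0" unfolding K_def using Q P3 l v0
      by (intro divide_nonneg_nonneg add_nonneg_nonneg mult_nonneg_nonneg zero_le_power) auto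
  have "real (card {chi\<in>F3 Q. \<not> good_block (\<lambda>n. chi n * h n) P (2 * v)}) \<le> 36 * P * real J ^ 4 * K"
    unfolding K_def
    by (rule card_not_good[OF finite_F3 P3 J(1,2) err])
       (use norm_F3_le h count_small_primes[OF Q P3 v0] k in auto)
  also have "\<dots> \<le> 36 * P * P ^ 4 * K"
    using J P3 K0 by (intro mult_right_mono mult_left_mono power_mono) auto
  also have "36 * P * P ^ 4 = 36 * P ^ 5" by (simp add: eval_nat_numeral)
  also have "K = 144 * Q * (96 * real k / (P * ln P) * u ^ 2) ^ k + 12 * sqrt Q * (8 * P * u) ^ (2
      * k)"
    unfolding K_def vu by (simp add: power_divide power_mult_distrib add_divide_distrib power_mult
        [symmetric] field_simps)
  also have "36 * P ^ 5 * (144 * Q * (96 * real k / (P * ln P) * u ^ 2) ^ k + 12 * sqrt Q * (8 * P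
      * u) ^ (2 * k)) =
    5184 * Q * (P ^ 5 * (96 * real k / (P * ln P) * u ^ 2) ^ k) + 432 * sqrt Q * (P ^ 5 * (8 * P
        * u) ^ (2 * k))"
    by (simp add: algebra_simps)
  also have "\<dots> \<le> 5184 * Q * (y ^ 5 * exp (- real k) * (1 / 2) ^ i) + 432 * sqrt Q * P ^ (5 + 6 * k)"
  proof (intro add_mono mult_left_mono)
    have lnP: "ln P \<le> (1 + real i) * ln y"
    proof -
      have "ln P = real i * ln 2 + ln y" unfolding P using y by (simp add: ln_mult ln_realpow)
      also have "real i * ln 2 \<le> real i * ln y" using y by (intro mult_left_mono) auto
      finally show ?thesis by (simp add: algebra_simps)
    qed
    \<comment> \<open>57600 is \<open>240 ^ 2\<close>. One logarithm of \<open>u ^ 2\<close> cancels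
      against the mean square; the other is at most \<open>(1 + i) * ln y\<close> and cancels the
      \<open>ln y\<close> in the bound for \<open>k\<close>.\<close>
    have "96 * c / (P * L) * (240 * a ^ 2 * L) ^ 2 = 96 * 57600 * c * (a ^ 4 * L) / P" if "L
        \<ge> 1" for a c L
      using that P3 by (simp add: power2_eq_square power4_eq_xxxx field_simps)
    from this[OF l] have "96 * real k / (P * ln P) * u ^ 2 = 96 * 57600 * real k * ((1
        + real i) ^ 4 * ln P) / P"
      unfolding u_def .
    also have "\<dots> \<le> 96 * 57600 * (\<delta> * y / ln y) * ((1 + real i) ^ 4 * ((1 + real i) * ln y)) / P"
      using k lnP P3 l ly \<delta> y by (intro divide_right_mono mult_mono mult_left_mono
          mult_nonneg_nonneg) auto
    also have "\<dots> = 96 * 57600 * \<delta> * (1 + real i) ^ 5 / 2 ^ i"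
      unfolding P using ly y by (simp add: eval_nat_numeral)
    also have "\<dots> \<le> exp (- 1) * (4 / 3) ^ i / 2 ^ i" by (intro divide_right_mono \<delta>) auto
    also have "\<dots> = exp (- 1) * (2 / 3) ^ i"
    proof -
      have "(4 / 3 :: real) ^ i / 2 ^ i = (4 / 3 / 2) ^ i" by (simp only: power_divide)
      then have q: "(4 / 3 :: real) ^ i / 2 ^ i = (2 / 3) ^ i" by simp
      show ?thesis unfolding times_divide_eq_right [symmetric] q ..
    qed
    finally have th: "96 * real k / (P * ln P) * u ^ 2 \<le> exp (- 1) * (2 / 3) ^ i" .
    have "(96 * real k / (P * ln P) * u ^ 2) ^ k \<le> (exp (- 1) * (2 / 3) ^ i) ^ k"
      using P3 l by (intro power_mono th) auto
    also have "\<dots> = exp (- real k) * ((2 / 3) ^ k) ^ i"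
      by (simp add: power_mult_distrib exp_of_nat_mult [symmetric] power_mult [symmetric]
          mult.commute)
    finally have "P ^ 5 * (96 * real k / (P * ln P) * u ^ 2) ^ k \<le> P ^ 5 * (exp (- real k)
        * ((2 / 3) ^ k) ^ i)"
      using P3 by (intro mult_left_mono) auto
    also have "P ^ 5 * (exp (- real k) * ((2 / 3) ^ k) ^ i) = y ^ 5 * exp (- real k) * (32
        * (2 / 3) ^ k) ^ i"
    proof -
      have "P ^ 5 = (2 ^ 5) ^ i * y ^ 5" unfolding P power_mult_distrib power_mult [symmetric]
          by (simp only: mult.commute)
      then show ?thesis by (simp add: power_mult_distrib)
    qed
    also have "\<dots> \<le> y ^ 5 * exp (- real k) * (1 / 2) ^ i"
    proof (intro mult_left_mono power_mono)
      \<comment> \<open>\<open>32 ^ i\<close> is the cost \<open>P ^ 5\<close> of the grid relative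
        to \<open>y ^ 5\<close>, and 11 is the least exponent for which
        \<open>32 * (2 / 3) ^ k\<close> drops below 1/2.\<close>
      have "(2 / 3 :: real) ^ k \<le> (2 / 3) ^ 11" using k by (intro power_decreasing) auto
      then show "32 * (2 / 3) ^ k \<le> (1 / 2 :: real)" by (simp add: eval_nat_numeral)
    qed (use y in auto)
    finally show "P ^ 5 * (96 * real k / (P * ln P) * u ^ 2) ^ k \<le> y ^ 5 * exp (- real k)
        * (1 / 2) ^ i" .
    have "8 * P * u \<le> P ^ 3"
    proof -
      have "8 * P * u \<le> 8 * P * (1500 * ln P ^ 3)" using P3 by (intro mult_left_mono u1) auto
      also have "\<dots> = P * (12000 * ln P ^ 3)" by simp
      also have "\<dots> \<le> P * P ^ 2" using P3 by (intro mult_left_mono big) auto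
      finally show ?thesis by (simp add: power2_eq_square power3_eq_cube)
    qed
    then have "P ^ 5 * (8 * P * u) ^ (2 * k) \<le> P ^ 5 * (P ^ 3) ^ (2 * k)"
      using P3 u0 by (intro mult_left_mono power_mono) auto
    also have "\<dots> = P ^ (5 + 6 * k)" by (simp add: power_add power_mult [symmetric])
    finally show "P ^ 5 * (8 * P * u) ^ (2 * k) \<le> P ^ (5 + 6 * k)" .
  qed (use Q in auto)
  finally show ?thesis by (simp add: v_def mult.assoc)
qed

text \<open>Here \<open>k\<close> is about \<open>3 * ln Q / ln P\<close>, independent of
  \<open>y\<close>. The moment method loses \<open>X ^ (10 * k)\<close>, and
  \<open>X ^ 330 <= P\<close> keeps this below \<open>Q powr (1/11)\<close> times a power of
  \<open>X\<close>, since 30 / 330 = 1 / 11.\<close>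

lemma bad_large_block:
  fixes y :: real
  assumes Q: "Q \<ge> 1" "X = ln Q" and X: "X \<ge> 1500" "60000 * X ^ 4 \<le> X ^ 6 - 1"
    and y: "y \<ge> 3" and P: "P = 2 ^ i * y" "X ^ 330 \<le> P" "P \<le> Q powr (21/40)"
    and h: "\<And>n. n \<ge> 1 \<Longrightarrow> norm (h n) \<le> 1"
  shows "real (card {chi\<in>F3 Q. \<not> good_block (\<lambda>n. chi n * h n) P (2 * block_threshold i P)}) \<le>
    1332 * Q powr (5/8) * X ^ 34"
proof -
  have Q0: "Q > 0" using Q by simp
  have P3: "P \<ge> 3" unfolding P(1) using y mult_mono[of 1 "2 ^ i" 3 y] by simp
  have l: "ln P \<ge> 1" by (rule ln_ge_1[OF P3])
  have lX: "ln P \<le> X"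
  proof -
    have "ln P \<le> ln (Q powr (21/40))" using P(3) P3 Q0 by (subst ln_le_cancel_iff) auto
    also have "\<dots> = 21/40 * X" using Q0 Q(2) by (simp add: ln_powr)
    finally show ?thesis using X by linarith
  qed
  have lnX: "ln X \<ge> 1" using ln_ge_1[of X] X by simp
  have lR: "330 * ln X \<le> ln P"
  proof -
    have "ln (X ^ 330) \<le> ln P" using P(2) P3 X by (subst ln_le_cancel_iff) auto
    then show ?thesis using X by (simp add: ln_realpow)
  qed
  define v where "v = block_threshold i P"
  have v0: "v > 0" unfolding v_def block_threshold_def using l
      by (intro divide_pos_pos mult_pos_pos) auto
  define u where "u = 240 * (1 + real i) ^ 2 * ln P"
  have vu: "v = 1 / u" by (simp add: v_def block_threshold_def u_def)
  have u0: "u > 0" using v0 vu by simp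
  have il: "1 + real i \<le> 5 / 2 * ln P" unfolding P(1) by (rule index_le_ln[OF y])
  have il2: "(1 + real i) ^ 2 \<le> 25 / 4 * ln P ^ 2"
    using power_mono[OF il, of 2] by (simp add: power_mult_distrib power_divide)
  have u1: "u \<le> 1500 * X ^ 3"
  proof -
    have "u \<le> 240 * (25 / 4 * ln P ^ 2) * ln P" unfolding u_def using il2 l
        by (intro mult_right_mono mult_left_mono) auto
    also have "\<dots> = 1500 * ln P ^ 3" by (simp add: power2_eq_square power3_eq_cube)
    also have "\<dots> \<le> 1500 * X ^ 3" using lX l by (intro mult_left_mono power_mono) auto
    finally show ?thesis .
  qed
  have u4: "u \<le> X ^ 4"
  proof -
    have "1500 * X ^ 3 \<le> X * X ^ 3" using X by (intro mult_right_mono) auto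
    then show ?thesis using u1 by (simp add: eval_nat_numeral)
  qed
  \<comment> \<open>A power of \<open>X\<close> already beats the discretisation error
    \<open>60000 * X ^ 4\<close>, and the grid has then only \<open>P\<close> times a power of
    \<open>X\<close> points.\<close>
  define J where "J = nat \<lfloor>X ^ 6\<rfloor>"
  have X6: "X ^ 6 \<ge> 1" using X by simp
  have J: "J \<ge> 1" "real J \<le> X ^ 6" "real J \<ge> X ^ 6 - 1" using X6 by (auto simp: J_def le_nat_floor)
  have JP: "real J \<le> P"
  proof -
    have "X ^ 6 \<le> X ^ 330" using X by (intro power_increasing) auto
    then show ?thesis using J(2) P(2) by linarith
  qed
  have err: "40 * ln P / real J \<le> v"
  proof -
    have "40 * ln P * u \<le> 40 * X * (1500 * X ^ 3)" using l lX u1 u0 by (intro mult_mono) auto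
    also have "\<dots> = 60000 * X ^ 4" by (simp add: power4_eq_xxxx power3_eq_cube)
    also have "\<dots> \<le> real J" using X(2) J(3) by linarith
    finally show ?thesis unfolding vu using u0 J(1) by (simp add: field_simps)
  qed
  \<comment> \<open>The least \<open>k\<close> with \<open>P ^ k >= Q ^ 3\<close>.\<close>
  define k where "k = nat \<lceil>3 * X / ln P\<rceil>"
  have k: "real k \<ge> 3 * X / ln P" "real k \<le> 3 * X / ln P + 1"
    using X l by (auto simp: k_def)
  have kX: "real k \<le> X"
  proof -
    have "3 * X / ln P \<le> 3 * X / 330" using lR lnX X by (intro divide_left_mono) auto
    then show ?thesis using k X by linarith
  qed
  define K where "K = (((2 * P) ^ k + 36 * Q ^ 3) * (real k ^ k * (4 / P) ^ k)) / v ^ (2 * k)"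
  have K0: "K \<ge> 0" unfolding K_def using Q P3 v0
      by (intro divide_nonneg_nonneg add_nonneg_nonneg mult_nonneg_nonneg zero_le_power) auto
  have Q3: "Q ^ 3 \<le> P ^ k"
  proof -
    have "ln (Q ^ 3) = 3 * X" using Q0 Q(2) by (simp add: ln_realpow)
    also have "\<dots> \<le> real k * ln P" using k(1) l by (simp add: pos_divide_le_eq)
    also have "\<dots> = ln (P ^ k)" using P3 by (simp add: ln_realpow)
    finally show ?thesis using Q0 P3 by (subst (asm) ln_le_cancel_iff) auto
  qed
  have KX: "K \<le> 37 * X ^ (10 * k)"
  proof -
    have "K = ((2 * P) ^ k + 36 * Q ^ 3) / P ^ k * (4 * real k * u ^ 2) ^ k"
      unfolding K_def vu by (simp add: power_divide power_mult_distrib power_mult [symmetric]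
          field_simps)
    also have "\<dots> \<le> ((2 * P) ^ k + 36 * P ^ k) / P ^ k * (4 * X * (X ^ 4) ^ 2) ^ k"
      using Q3 P3 kX u4 u0 X
      by (intro mult_mono divide_right_mono add_mono mult_left_mono power_mono mult_nonneg_nonneg
          divide_nonneg_nonneg) auto
    also have "((2 * P) ^ k + 36 * P ^ k) / P ^ k = 2 ^ k + 36" using P3
        by (simp add: power_mult_distrib field_simps)
    also have "(2 ^ k + 36) * (4 * X * (X ^ 4) ^ 2) ^ k \<le> 37 * 2 ^ k * (4 * X * (X ^ 4) ^ 2) ^ k"
      using one_le_power[of "2::real" k] X by (intro mult_right_mono zero_le_power) auto
    also have "37 * 2 ^ k * (4 * X * (X ^ 4) ^ 2) ^ k = 37 * (2 * (4 * X * (X ^ 4) ^ 2)) ^ k"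
      by (simp only: power_mult_distrib mult.assoc)
    also have "\<dots> \<le> 37 * (X ^ 10) ^ k"
    proof (intro mult_left_mono power_mono)
      have "2 * (4 * X * (X ^ 4) ^ 2) = 8 * X ^ 9" by (simp add: eval_nat_numeral)
      also have "\<dots> \<le> X * X ^ 9" using X by (intro mult_right_mono) auto
      also have "\<dots> = X ^ 10" by (simp add: eval_nat_numeral)
      finally show "2 * (4 * X * (X ^ 4) ^ 2) \<le> X ^ 10" .
    qed (use X in auto)
    finally show ?thesis by (simp add: power_mult)
  qed
  have "X ^ (10 * k) = exp (real (10 * k) * ln X)" using X exp_of_nat_mult[of "10 * k" "ln X"]
      by simp
  also have "\<dots> \<le> exp (X / 11 + 10 * ln X)"
  proof (subst exp_le_cancel_iff)
    have "real (10 * k) * ln X = 10 * (real k * ln X)" by simp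
    also have "\<dots> \<le> 10 * ((3 * X / ln P + 1) * ln X)" using k lnX
        by (intro mult_left_mono mult_right_mono) auto
    also have "\<dots> = 30 * X * (ln X / ln P) + 10 * ln X" by (simp add: field_simps)
    also have "\<dots> \<le> 30 * X * (1 / 330) + 10 * ln X"
    proof (intro add_mono mult_left_mono order_refl)
      show "ln X / ln P \<le> 1 / 330" using lR l by (simp add: field_simps)
    qed (use X in auto)
    finally show "real (10 * k) * ln X \<le> X / 11 + 10 * ln X" by simp
  qed
  also have "\<dots> = Q powr (1/11) * X ^ 10"
  proof -
    have "exp (10 * ln X) = X ^ 10" using X exp_of_nat_mult[of 10 "ln X"] by simp
    moreover have "exp (X / 11) = Q powr (1/11)" using Q0 Q(2) by (simp add: powr_def)
    ultimately show ?thesis by (simp add: exp_add)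
  qed
  finally have X10: "X ^ (10 * k) \<le> Q powr (1/11) * X ^ 10" .
  have "real (card {chi\<in>F3 Q. \<not> good_block (\<lambda>n. chi n * h n) P (2 * v)}) \<le> 36 * P * real J ^ 4 * K"
    unfolding K_def
    by (rule card_not_good[OF finite_F3 P3 J(1) JP err])
       (use norm_F3_le h count_large_primes[OF Q(1) P3 v0] in auto)
  also have "\<dots> \<le> 36 * Q powr (21/40) * (X ^ 6) ^ 4 * (37 * (Q powr (1/11) * X ^ 10))"
  proof (intro mult_mono P(3) power_mono J(2) mult_left_mono)
    have "37 * X ^ (10 * k) \<le> 37 * (Q powr (1/11) * X ^ 10)" using X10 by simp
    then show "K \<le> 37 * (Q powr (1/11) * X ^ 10)" using KX by linarith
  qed (use K0 P3 in \<open>auto intro!: mult_nonneg_nonneg\<close>)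
  also have "\<dots> = 1332 * (Q powr (21/40) * Q powr (1/11)) * X ^ 34"
  proof -
    have "(X ^ 6) ^ 4 * X ^ 10 = X ^ 34" by (simp add: power_mult [symmetric] power_add [symmetric])
    then show ?thesis by (simp add: mult_ac)
  qed
  also have "Q powr (21/40) * Q powr (1/11) = Q powr (21/40 + 1/11)" by (rule powr_add [symmetric])
  \<comment> \<open>In the denominator 440: 21/40 + 1/11 = 271/440, while 5/8 = 275/440.\<close>
  also have "1332 * Q powr (21/40 + 1/11) * X ^ 34 \<le> 1332 * Q powr (5/8) * X ^ 34"
    using Q X by (intro mult_right_mono mult_left_mono powr_mono) auto
  finally show ?thesis by (simp add: v_def)
qed

text \<open>Any base between 1 and 2 would serve: set against the \<open>2 ^ i\<close> in
  \<open>P = 2 ^ i * y\<close>, the base 4/3 leaves the decay \<open>(2 / 3) ^ i\<close>.\<close>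

lemma poly_le_exp_const: "\<exists>C>0. \<forall>i::nat. (1 + real i) ^ 5 \<le> C * (4 / 3) ^ i"
proof -
  have "(\<lambda>i::nat. (1 + real i) ^ 5 / (4 / 3) ^ i) \<longlonglongrightarrow> 0" by real_asymp
  then have "Bseq (\<lambda>i::nat. (1 + real i) ^ 5 / (4 / 3) ^ i)"
    by (intro convergent_imp_Bseq) (auto simp: convergent_def)
  then obtain K where K: "K > 0" "\<And>i::nat. norm ((1 + real i) ^ 5 / (4 / 3) ^ i) \<le> K"
    by (auto simp: Bseq_def)
  have "(1 + real i) ^ 5 \<le> K * (4 / 3) ^ i" for i :: nat
  proof -
    have "(1 + real i) ^ 5 / (4 / 3) ^ i \<le> K" using K(2)[of i] by simp
    moreover have "(4 / 3 :: real) ^ i > 0" by simp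
    ultimately show ?thesis by (simp only: pos_divide_le_eq)
  qed
  then show ?thesis using K(1) by blast
qed

text \<open>The two regimes are separated at \<open>P = X ^ 330\<close>. Below it,
  \<open>P ^ (5 + 6 * k)\<close> is at most \<open>X ^ 1650 * X ^ (1980 * k)\<close>, from 330 * 5
  and 330 * 6, and \<open>kX\<close> bounds the second factor by \<open>Q powr (1/8)\<close>;
  together with \<open>sqrt Q\<close> this is \<open>Q powr (5/8)\<close>.\<close>

lemma bad_block:
  fixes y :: real
  assumes Q: "Q \<ge> 1" "X = ln Q" and X: "X \<ge> 1500" "60000 * X ^ 4 \<le> X ^ 6 - 1"
    and y: "y \<ge> 3" and P: "P = 2 ^ i * y" "P \<le> Q powr (21/40)"
    and big: "60000 * ln P ^ 4 \<le> P - 1" "12000 * ln P ^ 3 \<le> P ^ 2"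
    and \<delta>: "\<delta> > 0" "96 * 57600 * \<delta> * (1 + real i) ^ 5 \<le> exp (- 1) * (4 / 3) ^ i"
    and k: "k \<ge> 11" "real k \<le> \<delta> * y / ln y" and kX: "1980 * real k * ln X \<le> X / 8"
    and h: "\<And>n. n \<ge> 1 \<Longrightarrow> norm (h n) \<le> 1"
  shows "real (card {chi\<in>F3 Q. \<not> good_block (\<lambda>n. chi n * h n) P (2 * block_threshold i P)}) \<le>
    5184 * Q * y ^ 5 * exp (- real k) * (1 / 2) ^ i + 2000 * Q powr (5/8) * X ^ 1650"
proof (cases "X ^ 330 \<le> P")
  case True
  have "real (card {chi\<in>F3 Q. \<not> good_block (\<lambda>n. chi n * h n) P (2 * block_threshold i P)}) \<le> 1332
      * Q powr (5/8) * X ^ 34"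
    by (rule bad_large_block[OF Q X y P(1) True P(2) h])
  also have "\<dots> \<le> 2000 * Q powr (5/8) * X ^ 1650"
    using X by (intro mult_mono power_increasing) auto
  also have "\<dots> \<le> 5184 * Q * y ^ 5 * exp (- real k) * (1 / 2) ^ i + 2000 * Q powr (5/8) * X ^ 1650"
    using Q y by simp
  finally show ?thesis .
next
  case False
  have P3: "P \<ge> 3" unfolding P(1) using y mult_mono[of 1 "2 ^ i" 3 y] by simp
  have Q0: "Q > 0" using Q by simp
  have "P ^ (5 + 6 * k) \<le> (X ^ 330) ^ (5 + 6 * k)" using False P3 by (intro power_mono) auto
  also have "\<dots> = X ^ 1650 * X ^ (1980 * k)"
    by (simp only: power_mult [symmetric] power_add [symmetric] distrib_left mult.assoc
        [symmetric]) simp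
  also have "X ^ (1980 * k) = exp (real (1980 * k) * ln X)" using X exp_of_nat_mult[of "1980
      * k" "ln X"] by simp
  also have "\<dots> \<le> exp (X / 8)" using kX by simp
  also have "exp (X / 8) = Q powr (1/8)" using Q0 Q(2) by (simp add: powr_def)
  finally have PX: "P ^ (5 + 6 * k) \<le> X ^ 1650 * Q powr (1/8)" using X by (simp add: mult_left_mono)
  have "real (card {chi\<in>F3 Q. \<not> good_block (\<lambda>n. chi n * h n) P (2 * block_threshold i P)}) \<le>
    5184 * Q * y ^ 5 * exp (- real k) * (1 / 2) ^ i + 432 * sqrt Q * P ^ (5 + 6 * k)"
    by (rule bad_small_block[OF Q(1) y P(1) big \<delta> k h])
  also have "432 * sqrt Q * P ^ (5 + 6 * k) \<le> 2000 * Q powr (1/2) * (X ^ 1650 * Q powr (1/8))"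
    using Q X P3 by (intro mult_mono PX) (auto simp: powr_half_sqrt)
  also have "\<dots> = 2000 * (Q powr (1/2) * Q powr (1/8)) * X ^ 1650" by (simp add: mult_ac)
  also have "Q powr (1/2) * Q powr (1/8) = Q powr (5/8)" by (simp add: powr_add [symmetric])
  finally show ?thesis by simp
qed

theorem theorem2p2:
  "\<exists>b1 b2 b3 C Q0 :: real. b1 > 0 \<and> b2 > 0 \<and> b3 > 0 \<and> C > 0 \<and>
     (\<forall>h :: nat \<Rightarrow> complex. completely_multiplicative h \<and> (\<forall>n\<ge>1. norm (h n) \<le> 1) \<longrightarrow>
       (\<forall>Q Z y :: real. Q \<ge> Q0 \<and> Z = Q powr (21/40) \<and>
           b1 \<le> y \<and> y \<le> ln Q / (b2 * ln (ln Q)) \<longrightarrow>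
         real (card {chi \<in> F3 Q. max_rough_sum chi h Z y > 1})
           \<le> C * Q * exp (- b3 * (y / ln y))))"
proof -
  obtain C5 :: real where C5: "C5 > 0" "\<And>i::nat. (1 + real i) ^ 5 \<le> C5 * (4 / 3) ^ i"
    using poly_le_exp_const by blast
  \<comment> \<open>The largest value for which the polynomial factor \<open>(1 + i) ^ 5\<close>,
    bounded through \<open>C5\<close>, leaves the base
    \<open>exp (- 1) * (4 / 3) ^ i\<close>.\<close>
  define \<delta> where "\<delta> = exp (- 1) / (96 * 57600 * C5)"
  have \<delta>: "\<delta> > 0" using C5 by (simp add: \<delta>_def)
  have \<delta>5: "96 * 57600 * \<delta> * (1 + real i) ^ 5 \<le> exp (- 1) * (4 / 3) ^ i" for i :: nat
  proof -
    have "96 * 57600 * \<delta> * (1 + real i) ^ 5 \<le> 96 * 57600 * \<delta> * (C5 * (4 / 3) ^ i)"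
      using \<delta> by (intro mult_left_mono C5(2)) auto
    also have "\<dots> = exp (- 1) * (4 / 3) ^ i" using C5(1) by (simp add: \<delta>_def)
    finally show ?thesis .
  qed
  have "eventually (\<lambda>P::real. 60000 * ln P ^ 4 \<le> P - 1) at_top" by real_asymp
  then obtain p1 :: real where p1: "\<And>P. P \<ge> p1 \<Longrightarrow> 60000 * ln P ^ 4 \<le> P - 1"
    by (auto simp: eventually_at_top_linorder)
  have "eventually (\<lambda>P::real. 12000 * ln P ^ 3 \<le> P ^ 2) at_top" by real_asymp
  then obtain p2 :: real where p2: "\<And>P. P \<ge> p2 \<Longrightarrow> 12000 * ln P ^ 3 \<le> P ^ 2"
    by (auto simp: eventually_at_top_linorder)
  \<comment> \<open>Makes the integer part \<open>k\<close> at least 11, as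
    \<open>bad_small_block\<close> demands.\<close>
  have "eventually (\<lambda>y::real. 12 \<le> \<delta> * y / ln y) at_top" using \<delta> by real_asymp
  then obtain y1 :: real where y1: "\<And>y. y \<ge> y1 \<Longrightarrow> 12 \<le> \<delta> * y / ln y"
    by (auto simp: eventually_at_top_linorder)
  have "eventually (\<lambda>y::real. y ^ 5 \<le> exp (\<delta> / 2 * (y / ln y))) at_top" using \<delta> by real_asymp
  then obtain y2 :: real where y2: "\<And>y. y \<ge> y2 \<Longrightarrow> y ^ 5 \<le> exp (\<delta> / 2 * (y / ln y))"
    by (auto simp: eventually_at_top_linorder)
  have "eventually (\<lambda>X::real. 60000 * X ^ 4 \<le> X ^ 6 - 1) at_top" by real_asymp
  then obtain x1 :: real where x1: "\<And>X. X \<ge> x1 \<Longrightarrow> 60000 * X ^ 4 \<le> X ^ 6 - 1"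
    by (auto simp: eventually_at_top_linorder)
  have "eventually (\<lambda>X::real. 4000 * X ^ 1651 \<le> exp (X / 8)) at_top" by real_asymp
  then obtain x2 :: real where x2: "\<And>X. X \<ge> x2 \<Longrightarrow> 4000 * X ^ 1651 \<le> exp (X / 8)"
    by (auto simp: eventually_at_top_linorder)
  define b1 where "b1 = Max {3, p1, p2, y1, y2}"
  \<comment> \<open>Since 1980 * 8 < 16000, the range of \<open>y\<close> then gives
    \<open>1980 * k * ln X <= X / 8\<close>.\<close>
  define b2 where "b2 = max 1 (16000 * \<delta>)"
  \<comment> \<open>Half of the saving \<open>exp (- \<delta> * y / ln y)\<close> is spent on the
    factor \<open>y ^ 5\<close>. The 1/4 belongs to the error term: 5/8 + 1/8 = 3/4 leaves
    \<open>Q * exp (- X / 4)\<close>, and \<open>y / ln y <= X\<close>.\<close>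
  define b3 where "b3 = min (\<delta> / 2) (1 / 4)"
  define X0 where "X0 = Max {1500, x1, x2}"
  have b1: "b1 \<ge> 3" "b1 \<ge> p1" "b1 \<ge> p2" "b1 \<ge> y1" "b1 \<ge> y2" by (simp_all add: b1_def)
  have X0: "X0 \<ge> 1500" "X0 \<ge> x1" "X0 \<ge> x2" by (simp_all add: X0_def)
  have main: "real (card {chi \<in> F3 Q. max_rough_sum chi h Z y > 1}) \<le> 31105 * Q * exp (- b3
      * (y / ln y))"
    if h: "completely_multiplicative h" "\<forall>n\<ge>1. norm (h n) \<le> 1" and Q: "Q \<ge> exp X0" and Z: "Z
        = Q powr (21/40)"
      and y: "b1 \<le> y" "y \<le> ln Q / (b2 * ln (ln Q))" for h Q Z y
  proof -
    define X where "X = ln Q"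
    have Q0: "Q > 0" using Q exp_gt_zero less_le_trans by blast
    have "X \<ge> X0" unfolding X_def using Q Q0 by (subst ln_ge_iff) auto
    then have X: "X \<ge> 1500" "X \<ge> x1" "X \<ge> x2" using X0 by linarith+
    have Q1: "Q \<ge> 1"
    proof -
      have "1 \<le> exp X0" using X0 by simp
      then show ?thesis using Q by linarith
    qed
    have lnX: "ln X \<ge> 1" using X by (intro ln_ge_1) simp
    have b2: "b2 \<ge> 1" "b2 \<ge> 16000 * \<delta>" by (simp_all add: b2_def)
    have y3: "y \<ge> 3" using y b1 by linarith
    have lny: "ln y \<ge> 1" by (rule ln_ge_1[OF y3])
    have ylX: "y * (b2 * ln X) \<le> X"
      using y(2) b2 lnX by (simp add: X_def pos_le_divide_eq)
    have yX: "y \<le> X"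
    proof -
      have "y * 1 \<le> y * (b2 * ln X)" using y3 b2 lnX mult_mono[of 1 b2 1 "ln X"]
          by (intro mult_left_mono) auto
      then show ?thesis using ylX by linarith
    qed
    have yln: "y / ln y \<le> y"
    proof -
      have "y / ln y \<le> y / 1" using lny y3 by (intro divide_left_mono) auto
      then show ?thesis by simp
    qed
    define k where "k = nat \<lfloor>\<delta> * y / ln y\<rfloor>"
    have "\<delta> * y / ln y \<ge> 12" using y1 y b1 by simp
    then have k: "k \<ge> 11" "real k \<le> \<delta> * y / ln y" "real k \<ge> \<delta> * y / ln y - 1"
      unfolding k_def by linarith+
    have kX: "1980 * real k * ln X \<le> X / 8"
    proof -
      have "real k \<le> \<delta> * y" using k(2) yln \<delta> mult_left_mono[OF yln, of \<delta>] by simp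
      then have "1980 * real k * ln X \<le> 1980 * (\<delta> * y) * ln X" using lnX
          by (intro mult_right_mono mult_left_mono) auto
      also have "\<dots> = 1980 / 16000 * (16000 * \<delta> * (y * ln X))" by simp
      also have "\<dots> \<le> 1980 / 16000 * (b2 * (y * ln X))"
        using b2 y3 lnX by (intro mult_left_mono mult_right_mono) auto
      also have "\<dots> \<le> 1980 / 16000 * X" using ylX by (intro mult_left_mono) (simp_all add: mult_ac)
      also have "\<dots> \<le> X / 8" using X by simp
      finally show ?thesis .
    qed
    have Z0: "Z \<ge> 0" by (simp add: Z)
    obtain n where "Z / y < 2 ^ n" using real_arch_pow[of 2 "Z / y"] by auto
    then have ex: "Z \<le> 2 ^ n * y" using y3 by (simp add: field_simps)
    \<comment> \<open>The least choice guarantees \<open>2 ^ i * y <= Z\<close> for every block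
      \<open>i < I\<close>, the upper bound on \<open>P\<close> required by
      \<open>bad_block\<close>.\<close>
    define I where "I = (LEAST I. Z \<le> 2 ^ I * y)"
    have I: "Z \<le> 2 ^ I * y" unfolding I_def by (rule LeastI[of "\<lambda>I. Z \<le> 2 ^ I * y", OF ex])
    have Ii: "2 ^ i * y \<le> Z" if "i < I" for i
      using not_less_Least[of i "\<lambda>I. Z \<le> 2 ^ I * y"] that unfolding I_def by simp
    have IX: "real I \<le> 2 * X"
    proof (cases I)
      case (Suc i)
      have "2 ^ i * y \<le> Z" using Ii[of i] Suc by simp
      then have "ln (2 ^ i * y) \<le> ln Z" using y3 Q0 by (subst ln_le_cancel_iff) (auto simp: Z)
      also have "\<dots> = 21/40 * X" using Q0 by (simp add: Z X_def ln_powr)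
      finally have "1 + real i \<le> 5 / 2 * (21/40 * X)" using index_le_ln[OF y3, of i] by linarith
      then show ?thesis using Suc X by simp
    qed (use X in simp)
    define bad where "bad i = {chi\<in>F3 Q. \<not> good_block (\<lambda>n. chi n * h n) (2 ^ i * y) (2
        * block_threshold i (2 ^ i * y))}" for i
    have finbad: "finite (bad i)" for i using finite_F3 by (simp add: bad_def)
    define D where "D = 2000 * Q powr (5/8) * X ^ 1650"
    define A where "A = 5184 * Q * y ^ 5 * exp (- real k)"
    have A0: "A \<ge> 0" using Q0 y3 by (simp add: A_def)
    have D0: "D \<ge> 0" using X by (simp add: D_def)
    have sub: "{chi \<in> F3 Q. max_rough_sum chi h Z y > 1} \<subseteq> (\<Union>i<I. bad i)"
    proof
      fix chi assume chi: "chi \<in> {chi \<in> F3 Q. max_rough_sum chi h Z y > 1}"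
      show "chi \<in> (\<Union>i<I. bad i)"
      proof (rule ccontr)
        assume "chi \<notin> (\<Union>i<I. bad i)"
        then have "good_block (\<lambda>n. chi n * h n) (2 ^ i * y) (2 * block_threshold i (2 ^ i
            * y))" if "i < I" for i
          using chi that by (auto simp: bad_def)
        from max_rough_sum_good[OF y3 I Z0 _ h(1) _ this] show False using chi h(2) by auto
      qed
    qed
    have "card {chi \<in> F3 Q. max_rough_sum chi h Z y > 1} \<le> card (\<Union>i<I. bad i)"
      by (rule card_mono[OF _ sub]) (use finbad in auto)
    also have "\<dots> \<le> (\<Sum>i<I. card (bad i))" by (rule card_UN_le) simp
    finally have "real (card {chi \<in> F3 Q. max_rough_sum chi h Z y > 1}) \<le> real (\<Sum>i<I. card (bad i))"
      by (rule of_nat_mono)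
    also have "\<dots> = (\<Sum>i<I. real (card (bad i)))" by simp
    \<comment> \<open>The first part decays geometrically in \<open>i\<close>; the second is
      multiplied by the number of blocks, which is at most \<open>2 * X\<close>.\<close>
    also have "\<dots> \<le> (\<Sum>i<I. A * (1 / 2) ^ i + D)"
    proof (intro sum_mono)
      fix i assume i: "i \<in> {..<I}"
      have yP: "y \<le> 2 ^ i * y" using y3 mult_right_mono[of 1 "2 ^ i" y] by simp
      then have yP': "p1 \<le> 2 ^ i * y" "p2 \<le> 2 ^ i * y" using y(1) b1 by linarith+
      show "real (card (bad i)) \<le> A * (1 / 2) ^ i + D"
        unfolding bad_def A_def D_def
        by (rule bad_block[OF Q1 X_def X(1) x1[OF X(2)] y3 refl _ p1[OF yP'(1)] p2[OF yP'(2)] \<delta> \<delta>5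
            k(1,2) kX])
           (use Ii i h(2) in \<open>auto simp: Z\<close>)
    qed
    also have "\<dots> = A * (\<Sum>i<I. (1 / 2) ^ i) + real I * D" by (simp add: sum.distrib sum_distrib_left)
    also have "\<dots> \<le> A * 2 + 2 * X * D"
    proof (intro add_mono mult_left_mono mult_right_mono IX D0 A0)
      have "(\<Sum>i<I. (1 / 2 :: real) ^ i) = 2 - 2 * (1 / 2) ^ I"
        by (subst geometric_sum) (auto simp: field_simps)
      then show "(\<Sum>i<I. (1 / 2 :: real) ^ i) \<le> 2" by simp
    qed
    also have "2 * X * D = Q powr (5/8) * (4000 * X ^ 1651)"
    proof -
      have "X * X ^ 1650 = X ^ 1651" by (metis Suc_numeral power_Suc semiring_norm(5) add.commute)
      then show ?thesis by (simp add: D_def mult_ac)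
    qed
    also have "\<dots> \<le> Q powr (5/8) * exp (X / 8)" by (intro mult_left_mono x2 X) auto
    also have "\<dots> = Q * exp (- (1 / 4) * X)"
    proof -
      have "Q powr (5/8) = exp (5/8 * X)" "Q = exp X" using Q0 by (simp_all add: powr_def X_def)
      then show ?thesis by (simp add: exp_add [symmetric])
    qed
    also have "\<dots> \<le> 1 * Q * exp (- b3 * (y / ln y))"
    proof -
      have "b3 * (y / ln y) \<le> 1 / 4 * X"
        using yln yX y3 lny \<delta> by (intro mult_mono) (auto simp: b3_def)
      then show ?thesis using Q0 by simp
    qed
    \<comment> \<open>31104 = 5184 * 2 * 3, where 3 bounds the factor \<open>e\<close> lost by
      rounding \<open>k\<close> down; the error term adds the final 1.\<close>
    also have "A * 2 \<le> 31104 * Q * exp (- b3 * (y / ln y))"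
    proof -
      have "exp (- real k) \<le> exp (1 + - (\<delta> * (y / ln y)))" using k(3) by simp
      also have "\<dots> \<le> 3 * exp (- (\<delta> * (y / ln y)))" unfolding exp_add
          by (intro mult_right_mono exp_le) auto
      finally have "y ^ 5 * exp (- real k) \<le> exp (\<delta> / 2 * (y / ln y)) * (3 * exp (- (\<delta>
          * (y / ln y))))"
        using y b1 y3 by (intro mult_mono y2) auto
      also have "\<dots> = 3 * exp (- (\<delta> / 2) * (y / ln y))"
          by (simp add: exp_add [symmetric] field_simps)
      also have "\<dots> \<le> 3 * exp (- b3 * (y / ln y))"
      proof -
        have "b3 * (y / ln y) \<le> \<delta> / 2 * (y / ln y)" using y3 lny
            by (intro mult_right_mono) (auto simp: b3_def)
        then show ?thesis by simp
      qed
      finally have "10368 * Q * (y ^ 5 * exp (- real k)) \<le> 10368 * Q * (3 * exp (- b3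
          * (y / ln y)))"
        using Q0 by (intro mult_left_mono) auto
      then show ?thesis by (simp add: A_def mult_ac)
    qed
    finally show ?thesis by (simp add: algebra_simps)
  qed
  show ?thesis
  proof (rule exI[of _ b1], rule exI[of _ b2], rule exI[of _ b3], rule exI[of _ 31105], rule
      exI[of _ "exp X0"],
      intro conjI allI impI)
    show "b1 > 0" "b2 > 0" "b3 > 0" using b1 \<delta> by (auto simp: b2_def b3_def)
  qed (use main in auto)
qed

end
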